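(* Let $\mathbf f=(f_1,\ldots,f_L):[0,1]^2\to\mathbb R^L$ be linearly independent with $\mathbf f\in\mathcal C$, let $\boldsymbol\theta_0\in\mathbb R^L$, and for each $n$ let $\pi$ be a random permutation in $S_n$ with law $\mathbb P_{n,\boldsymbol\theta_0}$. For $p,q\in[L]$ set $$\widehat\Sigma_{p,q}(\boldsymbol\theta)=\frac1{n^3}\sum_{\substack{(i,j),(k,\ell)\in\mathcal E_n\\ |\{i,j\}\cap\{k,\ell\}|=1}}\frac{y_{\pi,p}(i,j)\,y_{\pi,q}(k,\ell)}{(1+e^{\boldsymbol\theta^\top\mathbf y_\pi(i,j)})(1+e^{\boldsymbol\theta^\top\mathbf y_\pi(k,\ell)})},$$ $$\widehat A_{p,q}(\boldsymbol\theta)=\frac1{n^2}\sum_{(i,j)\in\mathcal E_n}\frac{y_{\pi,p}(i,j)\,y_{\pi,q}(i,j)\,e^{\boldsymbol\theta^\top\mathbf y_\pi(i,j)}}{(1+e^{\boldsymbol\theta^\top\mathbf y_\pi(i,j)})^2}.$$ Then for any $\alpha\in(0,1)$ and any $\mathbf d\in\mathbb R^L$ with $\mathbf d\neq\mathbf 0$, $$\lim_{n\to\infty}\mathbb P_{n,\boldsymbol\theta_0}\left(\big|\mathbf d^\top\hat{\boldsymbol\theta}_{PL}-\mathbf d^\top\boldsymbol\theta_0\big|\le\frac{z_{\alpha/2}}{\sqrt n}\sqrt{\mathbf d^\top\Big[[\widehat A(\hat{\boldsymbol\theta}_{PL})]^{-1}\widehat\Sigma(\hat{\boldsymbol\theta}_{PL})[\widehat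 A(\hat{\boldsymbol\theta}_{PL})]^{-1}\Big]\mathbf d}\right)=1-\alpha,$$ where $z_\alpha$ denotes the $(1-\alpha)$-th quantile of the standard normal distribution.
   Context: $[n]=\{1,\ldots,n\}$, $S_n$ is the set of permutations of $[n]$, and $\mathcal E_n=\{(i,j):1\le i<j\le n\}$. The double sum is over ordered pairs of elements of $\mathcal E_n$ sharing exactly one index. Class $\mathcal C$: the set of continuous $F:[0,1]^2\to\mathbb R$, not almost everywhere $0$, such that $\int_0^1F(x,z)\,dz=0$ for all $x$ and $\int_0^1F(z,y)\,dz=0$ for all $y$. For a vector function, $\mathbf f\in\mathcal C$ means $f_r\in\mathcal C$ for every $r\in[L]$. $\mathbf f$ is linearly independent if there is no nonzero $\mathbf d\in\mathbb R^L$ with $\mathbf d^\top\mathbf f=0$ Lebesgue-a.e. on $[0,1]^2$. Model: for $\boldsymbol\theta\in\mathbb R^L$, $\mathbb P_{n,\boldsymbol\theta}(\pi)=\exp(\boldsymbol\theta^\top\mathbf T(\pi)-Z_n(\boldsymbol\theta))$ for $\pi\in S_n$, where $\mathbf T(\pi)=\sum_{i=1}^n\mathbf f(i/n,\pi(i)/n)$ and $Z_n(\boldsymbol\theta)=\log\sum_{\pi\in S_n}\exp(\boldsymbol\theta^\top\mathbf T(\pi))$. For $(i,j)\in\mathcal E_n$, $\mathbf y_\pi(i,j)=\mathbf f(\frac in,\frac{\pi(i)}n)+\mathbf f(\frac jn,\frac{\pi(j)}n)-\mathbf f(\frac in,\frac{\pi(j)}n)-\mathbf f(\frac jn,\frac{\pi(i)}n)\in\mathbb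 R^L$, with $p$-th component $y_{\pi,p}(i,j)$. The pseudo-likelihood estimator $\hat{\boldsymbol\theta}_{PL}$ is the root in $\boldsymbol\theta\in\mathbb R^L$ of $$\sum_{(i,j)\in\mathcal E_n}\frac{1}{1+e^{\boldsymbol\theta^\top\mathbf y_\pi(i,j)}}\mathbf y_\pi(i,j)=\mathbf 0,$$ which exists and is unique with probability tending to $1$. The event in the claim is understood on the set of $\pi$ for which the quantities in it are defined. *)

theory Defs
  imports "HOL-Probability.Probability"
begin

abbreviation unit_square :: "(real \<times> real) set" where
  "unit_square \<equiv> {0..1} \<times> {0..1}"

(* Functions on the unit square are total functions on real \<times> real; only their
   values on the square matter. *)

definition class_C :: "(real \<times> real \<Rightarrow> real) set" where
  "class_C = {F. continuous_on unit_square F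
     \<and> \<not> (AE p in lebesgue_on unit_square. F p = 0)
     \<and> (\<forall>x\<in>{0..1}. integral {0..1} (\<lambda>z. F (x, z)) = 0)
     \<and> (\<forall>y\<in>{0..1}. integral {0..1} (\<lambda>z. F (z, y)) = 0)}"

definition ae_lin_indep :: "(real \<times> real \<Rightarrow> real ^ 'l) \<Rightarrow> bool" where
  "ae_lin_indep f \<longleftrightarrow>
     \<not> (\<exists>d. d \<noteq> 0 \<and> (AE p in lebesgue_on unit_square. d \<bullet> f p = 0))"

definition perms :: "nat \<Rightarrow> (nat \<Rightarrow> nat) set" where
  "perms n = {\<pi>. \<pi> permutes {1..n}}"

definition edges :: "nat \<Rightarrow> (nat \<times> nat) set" where
  "edges n = {(i, j). 1 \<le> i \<and> i < j \<and> j \<le> n}"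

definition suff_stat ::
  "(real \<times> real \<Rightarrow> real ^ 'l) \<Rightarrow> nat \<Rightarrow> (nat \<Rightarrow> nat) \<Rightarrow> real ^ 'l" where
  "suff_stat f n \<pi> = (\<Sum>i=1..n. f (real i / real n, real (\<pi> i) / real n))"

definition log_partition ::
  "(real \<times> real \<Rightarrow> real ^ 'l) \<Rightarrow> nat \<Rightarrow> real ^ 'l \<Rightarrow> real" where
  "log_partition f n \<theta> = ln (\<Sum>\<pi>\<in>perms n. exp (\<theta> \<bullet> suff_stat f n \<pi>))"

definition perm_model ::
  "(real \<times> real \<Rightarrow> real ^ 'l) \<Rightarrow> nat \<Rightarrow> real ^ 'l \<Rightarrow> (nat \<Rightarrow> nat) measure" where
  "perm_model f n \<theta> = point_measure (perms n)
     (\<lambda>\<pi>. ennreal (exp (\<theta> \<bullet> suff_stat f n \<pi> - log_partition f n \<theta>)))"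

lemma finite_perms: "finite (perms n)"
  by (simp add: perms_def finite_permutations)

lemma id_in_perms: "id \<in> perms n"
  by (simp add: perms_def permutes_id)

lemma prob_space_perm_model: "prob_space (perm_model f n \<theta>)"
proof
  let ?w = "\<lambda>\<pi>. exp (\<theta> \<bullet> suff_stat f n \<pi>)"
  have pos: "(\<Sum>\<pi>\<in>perms n. ?w \<pi>) > 0"
    using finite_perms id_in_perms by (intro sum_pos) auto
  have "(\<Sum>\<pi>\<in>perms n. exp (\<theta> \<bullet> suff_stat f n \<pi> - log_partition f n \<theta>))
        = (\<Sum>\<pi>\<in>perms n. ?w \<pi>) / exp (log_partition f n \<theta>)"
    by (simp add: exp_diff sum_divide_distrib)
  also have "\<dots> = 1"
    using pos by (simp add: log_partition_def)
  finally have "(\<Sum>\<pi>\<in>perms n. exp (\<theta> \<bullet> suff_stat f n \<pi> - log_partition f n \<theta>)) = 1" .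
  then show "emeasure (perm_model f n \<theta>) (space (perm_model f n \<theta>)) = 1"
    by (simp add: perm_model_def space_point_measure emeasure_point_measure_finite
        finite_perms sum_ennreal)
qed

definition y_diff ::
  "(real \<times> real \<Rightarrow> real ^ 'l) \<Rightarrow> nat \<Rightarrow> (nat \<Rightarrow> nat) \<Rightarrow> nat \<times> nat \<Rightarrow> real ^ 'l" where
  "y_diff f n \<pi> = (\<lambda>(i, j).
       f (real i / real n, real (\<pi> i) / real n) + f (real j / real n, real (\<pi> j) / real n)
     - f (real i / real n, real (\<pi> j) / real n) - f (real j / real n, real (\<pi> i) / real n))"

definition pl_root ::
  "(real \<times> real \<Rightarrow> real ^ 'l) \<Rightarrow> nat \<Rightarrow> (nat \<Rightarrow> nat) \<Rightarrow> real ^ 'l \<Rightarrow> bool" where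
  "pl_root f n \<pi> \<theta> \<longleftrightarrow>
     (\<Sum>e\<in>edges n. (1 / (1 + exp (\<theta> \<bullet> y_diff f n \<pi> e))) *\<^sub>R y_diff f n \<pi> e) = 0"

(* Meaningful only for those \<pi> with exactly one root. *)
definition pl_estimator ::
  "(real \<times> real \<Rightarrow> real ^ 'l) \<Rightarrow> nat \<Rightarrow> (nat \<Rightarrow> nat) \<Rightarrow> real ^ 'l" where
  "pl_estimator f n \<pi> = (THE \<theta>. pl_root f n \<pi> \<theta>)"

(* Ordered pairs of edges sharing exactly one index. *)
definition adjacent_edges :: "nat \<Rightarrow> ((nat \<times> nat) \<times> (nat \<times> nat)) set" where
  "adjacent_edges n = {((i, j), (k, l)).
     (i, j) \<in> edges n \<and> (k, l) \<in> edges n \<and> card ({i, j} \<inter> {k, l}) = 1}"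

definition Sigma_hat ::
  "(real \<times> real \<Rightarrow> real ^ 'l) \<Rightarrow> nat \<Rightarrow> (nat \<Rightarrow> nat) \<Rightarrow> real ^ 'l \<Rightarrow> real ^ 'l ^ 'l" where
  "Sigma_hat f n \<pi> \<theta> = (\<chi> p q. 1 / real n ^ 3 *
     (\<Sum>(e, e')\<in>adjacent_edges n.
        (y_diff f n \<pi> e $ p * y_diff f n \<pi> e' $ q) /
        ((1 + exp (\<theta> \<bullet> y_diff f n \<pi> e)) * (1 + exp (\<theta> \<bullet> y_diff f n \<pi> e')))))"

definition A_hat ::
  "(real \<times> real \<Rightarrow> real ^ 'l) \<Rightarrow> nat \<Rightarrow> (nat \<Rightarrow> nat) \<Rightarrow> real ^ 'l \<Rightarrow> real ^ 'l ^ 'l" where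
  "A_hat f n \<pi> \<theta> = (\<chi> p q. 1 / real n ^ 2 *
     (\<Sum>e\<in>edges n.
        (y_diff f n \<pi> e $ p * y_diff f n \<pi> e $ q * exp (\<theta> \<bullet> y_diff f n \<pi> e)) /
        (1 + exp (\<theta> \<bullet> y_diff f n \<pi> e)) ^ 2))"

definition quantile :: "real measure \<Rightarrow> real \<Rightarrow> real" where
  "quantile M p = Inf {x. p \<le> cdf M x}"

definition z_normal :: "real \<Rightarrow> real" where
  "z_normal \<alpha> = quantile std_normal_distribution (1 - \<alpha>)"

end

theory Submission
  imports Defs
begin

text \<open>
Write \<open>y_e\<close> for the vector attached to a pair \<open>e = (i, j)\<close>. Swapping the
values of \<open>\<pi>\<close> at \<open>i\<close> and \<open>j\<close> multiplies the probability
of \<open>\<pi>\<close> by \<open>exp (- \<theta>\<^sub>0 \<bullet> y_e)\<close> and replaces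
\<open>y_e\<close> by its negative, so that \<open>h_e = (v \<bullet> y_e) / (1 + exp
(\<theta>\<^sub>0 \<bullet> y_e))\<close>, weighted by the probability, is antisymmetric under the
swap. Hence \<open>E (h_e \<phi>) = E (h_e (\<phi> - \<phi> \<circ> swap_e)) / 2\<close> for every
statistic \<open>\<phi>\<close> (lemma \<open>stein_identity\<close>). Almost everything about the
score \<open>U = (\<Sum>e. h_e)\<close> of the pseudo-likelihood at \<open>\<theta>\<^sub>0\<close>
comes from this identity:

\<^item> with \<open>\<phi> = 1\<close>, the score has mean zero; with \<open>\<phi> = h_e'\<close> for a pair \<open>e'\<close> disjoint from \<open>e\<close>, such pairs are
  uncorrelated, so that the variance of \<open>U / n^(3/2)\<close> is the mean of \<open>v \<bullet> Sigma_hat v\<close> up to \<open>O(1/n)\<close>;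
\<^item> with \<open>\<phi> = v \<bullet> T\<close>, where \<open>T\<close> is the sufficient statistic, the covariance of \<open>U\<close> and \<open>v \<bullet> T\<close> is at least of
  order \<open>n\<^sup>2\<close>, and since the variance of \<open>v \<bullet> T\<close> is \<open>O(n)\<close>, Cauchy-Schwarz bounds the variance of \<open>U\<close> from below
  by a multiple of \<open>n^3\<close> (\<open>score_variance_lower\<close>);
\<^item> with \<open>\<phi> = exp (i t U / sd)\<close>, the characteristic function of the standardised score satisfies the Gaussian
  differential equation \<open>\<psi>' = - t \<psi>\<close> up to \<open>O(n^(-1/2))\<close>, which gives the central limit theorem (\<open>score_clt\<close>).

The second ingredient is concentration. The model is the Gibbs measure on perfect matchings whose
weights lie between \<open>1 / K\<close> and \<open>K\<close>. Changing one value of the permutation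
changes the conditional law of the other values only in a bounded number of places on average: two
conditional laws differ by an alternating path, and at each step there is a probability at least
\<open>1 / K^4\<close> that the path closes. This is the coupling lemma
\<open>gibbs_coupling\<close>. Consequently a statistic that changes by at most \<open>L\<close> per
changed position has variance \<open>O(n L\<^sup>2)\<close>, whatever
\<open>\<theta>\<^sub>0\<close> is (\<open>gibbs_variance\<close>). So \<open>A_hat\<close>,
\<open>Sigma_hat\<close> and the conditional variance in the central limit theorem are close to
their means. No limit of those means is ever identified: they only have to be bounded and bounded
below.

The rest is standard. The estimating equation is monotone in \<open>\<theta>\<close> and Brouwer's
theorem gives a root at distance \<open>O(n^(-1/2))\<close> from \<open>\<theta>\<^sub>0\<close> as
soon as \<open>A_hat\<close> is positive definite (\<open>pl_root_exists\<close>). A Taylor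
expansion turns \<open>sqrt n (d \<bullet> \<theta>_PL - d \<bullet> \<theta>\<^sub>0)\<close> into
the score in the direction \<open>v = (E A_hat)\<inverse> d\<close>, and the plug-in variance into
its variance (\<open>estimator_expansion\<close>, \<open>estimator_expansion_whp\<close>). Squeezing
the coverage event between events of the form \<open>\<bar>W\<bar> \<le> z \<plusminus> k\<close>
for the standardised score \<open>W\<close> finishes the proof.
\<close>

section \<open>Gibbs measures on perfect matchings\<close>

text \<open>
Matchings are sets of pairs rather than functions because rows and columns then play symmetric
roles: transposition is \<open>converse\<close>, and removing a row together with a column needs no
convention for values outside the domain.
\<close>

definition matchings :: "nat set \<Rightarrow> nat set \<Rightarrow> (nat \<times> nat) set set" where
  "matchings R S = {M. M \<subseteq> R \<times> S \<and> (\<forall>i\<in>R. \<exists>!j. (i, j) \<in> M) \<and> (\<forall>j\<in>S. \<exists>!i. (i, j) \<in> M)}"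

definition gibbs_sum ::
  "(nat \<Rightarrow> nat \<Rightarrow> real) \<Rightarrow> nat set \<Rightarrow> nat set \<Rightarrow> ((nat \<times> nat) set \<Rightarrow> real) \<Rightarrow> real" where
  "gibbs_sum w R S F = (\<Sum>M\<in>matchings R S. (\<Prod>(i, j)\<in>M. w i j) * F M)"

abbreviation gibbs_Z :: "(nat \<Rightarrow> nat \<Rightarrow> real) \<Rightarrow> nat set \<Rightarrow> nat set \<Rightarrow> real" where
  "gibbs_Z w R S \<equiv> gibbs_sum w R S (\<lambda>_. 1)"

definition gibbs_mean ::
  "(nat \<Rightarrow> nat \<Rightarrow> real) \<Rightarrow> nat set \<Rightarrow> nat set \<Rightarrow> ((nat \<times> nat) set \<Rightarrow> real) \<Rightarrow> real" where
  "gibbs_mean w R S F = gibbs_sum w R S F / gibbs_Z w R S"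

lemma finite_matchings: "finite R \<Longrightarrow> finite S \<Longrightarrow> finite (matchings R S)"
  by (rule finite_subset[of _ "Pow (R \<times> S)"]) (auto simp: matchings_def)

lemma matchings_converse: "matchings S R = converse ` matchings R S"
proof -
  have "converse M \<in> matchings S R" if "M \<in> matchings R S" for R S M
    using that by (auto simp: matchings_def)
  then show ?thesis
    by (metis (no_types, lifting) converse_converse image_eqI image_subsetI subsetI subset_antisym)
qed

lemma gibbs_sum_transpose:
  "gibbs_sum w R S F = gibbs_sum (\<lambda>j i. w i j) S R (\<lambda>M. F (converse M))"
proof -
  have inj: "inj_on converse (matchings R S)"
    by (auto simp: inj_on_def)
  have *: "(\<Prod>(j, i)\<in>converse M. w i j) = (\<Prod>(i, j)\<in>M. w i j)" for M
    by (rule prod.reindex_bij_witness[of _ prod.swap prod.swap]) auto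
  show ?thesis
    unfolding gibbs_sum_def matchings_converse[of S R]
    by (subst sum.reindex[OF inj]) (auto simp: *)
qed

lemma gibbs_mean_transpose:
  "gibbs_mean w R S F = gibbs_mean (\<lambda>j i. w i j) S R (\<lambda>M. F (converse M))"
  by (simp add: gibbs_mean_def gibbs_sum_transpose[of w R S])

lemma insert_in_matchings:
  assumes "k \<in> R" "b \<in> S" "N \<in> matchings (R - {k}) (S - {b})"
  shows "insert (k, b) N \<in> matchings R S"
proof -
  have N: "N \<subseteq> (R - {k}) \<times> (S - {b})" "\<And>i. i \<in> R \<Longrightarrow> i \<noteq> k \<Longrightarrow> \<exists>!j. (i, j) \<in> N"
    "\<And>j. j \<in> S \<Longrightarrow> j \<noteq> b \<Longrightarrow> \<exists>!i. (i, j) \<in> N"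
    using assms(3) by (auto simp: matchings_def)
  have "\<exists>!j. (i, j) \<in> insert (k, b) N" if "i \<in> R" for i
  proof (cases "i = k")
    case True then show ?thesis using N(1) by auto
  next
    case False then show ?thesis using N(2)[OF that False] by auto
  qed
  moreover have "\<exists>!i. (i, j) \<in> insert (k, b) N" if "j \<in> S" for j
  proof (cases "j = b")
    case True then show ?thesis using N(1) by auto
  next
    case False then show ?thesis using N(3)[OF that False] by auto
  qed
  ultimately show ?thesis
    using N(1) assms(1,2) by (auto simp: matchings_def)
qed

lemma remove_in_matchings:
  assumes "(k, b) \<in> M" "M \<in> matchings R S"
  shows "M - {(k, b)} \<in> matchings (R - {k}) (S - {b})"
proof -
  have M: "M \<subseteq> R \<times> S" "\<And>i. i \<in> R \<Longrightarrow> \<exists>!j. (i, j) \<in> M" "\<And>j. j \<in> S \<Longrightarrow> \<exists>!i. (i, j) \<in> M"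
    using assms(2) by (auto simp: matchings_def)
  have "\<exists>!j. (i, j) \<in> M - {(k, b)}" if "i \<in> R - {k}" for i
    using M(2)[of i] that by auto
  moreover have "\<exists>!i. (i, j) \<in> M - {(k, b)}" if "j \<in> S - {b}" for j
    using M(3)[of j] that by auto
  moreover have "M - {(k, b)} \<subseteq> (R - {k}) \<times> (S - {b})"
  proof
    fix x assume x: "x \<in> M - {(k, b)}"
    obtain i j where ij: "x = (i, j)" by (cases x)
    have "i \<in> R" "j \<in> S" "k \<in> R" "b \<in> S" using x ij M(1) assms(1) by auto
    then have "i \<noteq> k" "j \<noteq> b"
      using M(2)[of k] M(3)[of b] x ij assms(1) by blast+
    then show "x \<in> (R - {k}) \<times> (S - {b})" using ij \<open>i \<in> R\<close> \<open>j \<in> S\<close> by auto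
  qed
  ultimately show ?thesis by (simp add: matchings_def)
qed

text \<open>
The Laplace-type expansion of a permanent along a column: choose the row \<open>k\<close> matched
with \<open>b\<close>, then match the rest.
\<close>

lemma gibbs_sum_expand_col:
  assumes fin: "finite R" "finite S" and b: "b \<in> S"
  shows "gibbs_sum w R S F =
    (\<Sum>k\<in>R. w k b * gibbs_sum w (R - {k}) (S - {b}) (\<lambda>N. F (insert (k, b) N)))"
proof -
  let ?I = "Sigma R (\<lambda>k. matchings (R - {k}) (S - {b}))"
  let ?row = "\<lambda>M. THE k. (k, b) \<in> M"
  have row: "\<exists>!k. (k, b) \<in> M" if "M \<in> matchings R S" for M
    using that b by (auto simp: matchings_def)
  have row_eq: "?row M = k" if "M \<in> matchings R S" "(k, b) \<in> M" for M k
    using row[OF that(1)] that(2) by (metis the_equality)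
  have notin: "(k, b) \<notin> N" if "N \<in> matchings (R - {k}) (S - {b})" for k N
    using that by (auto simp: matchings_def)
  have fN: "finite N" if "N \<in> matchings (R - {k}) (S - {b})" for k N
    using that fin by (auto simp: matchings_def intro: finite_subset[of _ "R \<times> S"])
  have "gibbs_sum w R S F =
    (\<Sum>(k, N)\<in>?I. (\<Prod>(i, j)\<in>insert (k, b) N. w i j) * F (insert (k, b) N))"
    unfolding gibbs_sum_def
  proof (rule sum.reindex_bij_witness[of _ "\<lambda>(k, N). insert (k, b) N"
        "\<lambda>M. (?row M, M - {(?row M, b)})"], goal_cases)
    case (1 M)
    then have "(?row M, b) \<in> M" using theI'[OF row] by auto
    then show ?case by auto
  next
    case (2 M)
    then have "(?row M, b) \<in> M" using theI'[OF row] by auto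
    moreover from this 2 have "?row M \<in> R" by (auto simp: matchings_def)
    ultimately show ?case using remove_in_matchings 2 by auto
  next
    case (3 a)
    obtain k N where a: "a = (k, N)" by (cases a)
    have k: "k \<in> R" "N \<in> matchings (R - {k}) (S - {b})" using 3 a by auto
    have "?row (insert (k, b) N) = k"
      by (rule row_eq[OF insert_in_matchings[OF k(1) b k(2)]]) auto
    then show ?case using notin[OF k(2)] a by auto
  next
    case (4 a)
    then show ?case using insert_in_matchings b by auto
  next
    case (5 M)
    then have "(?row M, b) \<in> M" using theI'[OF row] by auto
    then have "insert (?row M, b) (M - {(?row M, b)}) = M" by auto
    then show ?case by (simp del: insert_Diff_single)
  qed
  also have "\<dots> = (\<Sum>k\<in>R. \<Sum>N\<in>matchings (R - {k}) (S - {b}).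
     (\<Prod>(i, j)\<in>insert (k, b) N. w i j) * F (insert (k, b) N))"
    using fin by (subst sum.Sigma) (auto intro: finite_matchings)
  also have "\<dots> = (\<Sum>k\<in>R. w k b * gibbs_sum w (R - {k}) (S - {b}) (\<lambda>N. F (insert (k, b) N)))"
    unfolding gibbs_sum_def sum_distrib_left
    by (intro sum.cong refl) (use notin fN in \<open>auto simp: mult.assoc\<close>)
  finally show ?thesis .
qed

lemma gibbs_sum_expand_row:
  assumes fin: "finite R" "finite S" and i: "i \<in> R"
  shows "gibbs_sum w R S F =
    (\<Sum>s\<in>S. w i s * gibbs_sum w (R - {i}) (S - {s}) (\<lambda>N. F (insert (i, s) N)))"
proof -
  have converse_insert: "converse (insert (s, i) N) = insert (i, s) (converse N)" for s i :: nat and N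
    by auto
  have "gibbs_sum w R S F = gibbs_sum (\<lambda>j i. w i j) S R (\<lambda>M. F (converse M))"
    by (rule gibbs_sum_transpose)
  also have "\<dots> = (\<Sum>s\<in>S. w i s * gibbs_sum (\<lambda>j i. w i j) (S - {s}) (R - {i})
      (\<lambda>N. F (converse (insert (s, i) N))))"
    by (rule gibbs_sum_expand_col[OF fin(2,1) i])
  also have "\<dots> = (\<Sum>s\<in>S. w i s * gibbs_sum w (R - {i}) (S - {s}) (\<lambda>N. F (insert (i, s) N)))"
    by (simp add: gibbs_sum_transpose[of w] converse_insert)
  finally show ?thesis .
qed

text \<open>
The bounds are imposed on all pairs of indices, so that they survive transposition and the removal
of rows and columns.
\<close>

definition bounded_weights :: "real \<Rightarrow> (nat \<Rightarrow> nat \<Rightarrow> real) \<Rightarrow> bool" where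
  "bounded_weights K w \<longleftrightarrow> 1 \<le> K \<and> (\<forall>i j. 1 / K \<le> w i j \<and> w i j \<le> K)"

lemma bounded_weightsD:
  assumes "bounded_weights K w"
  shows "1 \<le> K" "0 < K" "w i j > 0" "w i j \<le> K\<^sup>2 * w k l" "w i j \<ge> 1 / K" "w i j \<le> K"
proof -
  show 1: "1 \<le> K" "0 < K" and w: "w i j \<ge> 1 / K" "w i j \<le> K"
    using assms unfolding bounded_weights_def by force+
  have "0 < 1 / K" using 1 by simp
  then show "w i j > 0" using w(1) by linarith
  have kl: "1 / K \<le> w k l" using assms by (auto simp: bounded_weights_def)
  have "K = K\<^sup>2 * (1 / K)" using 1 by (simp add: power2_eq_square)
  also have "\<dots> \<le> K\<^sup>2 * w k l" using kl by (intro mult_left_mono) auto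
  finally show "w i j \<le> K\<^sup>2 * w k l" using w(2) by linarith
qed

lemma bounded_weights_transpose: "bounded_weights K w \<Longrightarrow> bounded_weights K (\<lambda>j i. w i j)"
  by (auto simp: bounded_weights_def)

lemma gibbs_sum_mono:
  assumes "bounded_weights K w" "\<And>M. M \<in> matchings R S \<Longrightarrow> F M \<le> G M"
  shows "gibbs_sum w R S F \<le> gibbs_sum w R S G"
  unfolding gibbs_sum_def
  by (intro sum_mono mult_left_mono prod_nonneg assms)
     (auto intro!: less_imp_le bounded_weightsD(3)[OF assms(1)])

lemma gibbs_Z_pos:
  assumes "bounded_weights K w" "finite R" "finite S" "card R = card S"
  shows "gibbs_Z w R S > 0"
  using assms
proof (induction "card R" arbitrary: R S)
  case 0
  then have "R = {}" "S = {}" by auto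
  then have "matchings R S = {{}}" by (auto simp: matchings_def)
  then show ?case by (simp add: gibbs_sum_def)
next
  case (Suc n)
  then obtain i where i: "i \<in> R" by (metis card.empty equals0I nat.distinct(1))
  have ne: "S \<noteq> {}" using Suc by auto
  show ?case
    unfolding gibbs_sum_expand_row[OF Suc(4,5) i]
    by (intro sum_pos mult_pos_pos Suc(1) bounded_weightsD(3)[OF Suc(3)])
       (use Suc i ne in auto)
qed

lemma gibbs_mean_expand_row:
  assumes "bounded_weights K w" "finite R" "finite S" "card R = card S" "i \<in> R"
  shows "gibbs_mean w R S F = (\<Sum>s\<in>S. (w i s * gibbs_Z w (R - {i}) (S - {s}) / gibbs_Z w R S)
      * gibbs_mean w (R - {i}) (S - {s}) (\<lambda>N. F (insert (i, s) N)))"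
proof -
  have "gibbs_Z w (R - {i}) (S - {s}) \<noteq> 0" if "s \<in> S" for s
    using gibbs_Z_pos[OF assms(1), of "R - {i}" "S - {s}"] assms that by auto
  then show ?thesis
    unfolding gibbs_mean_def gibbs_sum_expand_row[OF assms(2,3,5), of w F] sum_divide_distrib
    by (intro sum.cong refl) auto
qed

lemma gibbs_mean_expand_col:
  assumes "bounded_weights K w" "finite R" "finite S" "card R = card S" "b \<in> S"
  shows "gibbs_mean w R S F = (\<Sum>k\<in>R. (w k b * gibbs_Z w (R - {k}) (S - {b}) / gibbs_Z w R S)
      * gibbs_mean w (R - {k}) (S - {b}) (\<lambda>N. F (insert (k, b) N)))"
proof -
  have "gibbs_Z w (R - {k}) (S - {b}) \<noteq> 0" if "k \<in> R" for k
    using gibbs_Z_pos[OF assms(1), of "R - {k}" "S - {b}"] assms that by auto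
  then show ?thesis
    unfolding gibbs_mean_def gibbs_sum_expand_col[OF assms(2,3,5), of w F] sum_divide_distrib
    by (intro sum.cong refl) auto
qed

lemma gibbs_mean_1:
  assumes "bounded_weights K w" "finite R" "finite S" "card R = card S"
  shows "gibbs_mean w R S (\<lambda>_. 1) = 1"
  using gibbs_Z_pos[OF assms] by (simp add: gibbs_mean_def)

lemma gibbs_mean_mono:
  assumes "bounded_weights K w" "finite R" "finite S" "card R = card S"
    and "\<And>M. M \<in> matchings R S \<Longrightarrow> F M \<le> G M"
  shows "gibbs_mean w R S F \<le> gibbs_mean w R S G"
  using gibbs_Z_pos[OF assms(1-4)] gibbs_sum_mono[OF assms(1,5)]
  by (simp add: gibbs_mean_def divide_right_mono)

lemma gibbs_mean_add_const:
  assumes "bounded_weights K w" "finite R" "finite S" "card R = card S"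
  shows "gibbs_mean w R S (\<lambda>M. F M + c) = gibbs_mean w R S F + c"
proof -
  have "gibbs_sum w R S (\<lambda>M. F M + c) = gibbs_sum w R S F + c * gibbs_Z w R S"
    by (simp add: gibbs_sum_def algebra_simps sum.distrib sum_distrib_left)
  then show ?thesis
    using gibbs_Z_pos[OF assms] by (simp add: gibbs_mean_def field_simps)
qed

text \<open>
All the events \<open>(k, b) \<in> M\<close>, for a fixed column \<open>b\<close>, have
probabilities within a factor \<open>K^4\<close> of each other: exchanging the rows \<open>k\<close>
and \<open>j\<close> changes two weights, each by a factor at most \<open>K\<^sup>2\<close>. As
these probabilities sum to one, none is much smaller than \<open>1 / card R\<close>.
\<close>

lemma gibbs_marginal_lower:
  assumes bw: "bounded_weights K w" and fin: "finite R" "finite S" and "card R = card S"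
    and j: "j \<in> R" and b: "b \<in> S"
  shows "1 / (K ^ 4 * real (card R)) * gibbs_Z w R S \<le> w j b * gibbs_Z w (R - {j}) (S - {b})"
proof -
  note B = bounded_weightsD[OF bw]
  let ?S = "S - {b}"
  have Zc: "gibbs_Z w (R - {k}) ?S \<le> K\<^sup>2 * gibbs_Z w (R - {j}) ?S" if k: "k \<in> R" for k
  proof (cases "k = j")
    case True
    have "gibbs_Z w (R - {j}) ?S > 0"
      by (rule gibbs_Z_pos[OF bw]) (use assms in auto)
    then show ?thesis using True B(1) by (simp add: mult_le_cancel_right1)
  next
    case False
    have eq: "R - {k} - {j} = R - {j} - {k}" by auto
    have "gibbs_Z w (R - {k}) ?S = (\<Sum>s\<in>?S. w j s * gibbs_Z w (R - {k} - {j}) (?S - {s}))"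
      by (rule gibbs_sum_expand_row) (use fin j False in auto)
    also have "\<dots> \<le> (\<Sum>s\<in>?S. K\<^sup>2 * w k s * gibbs_Z w (R - {k} - {j}) (?S - {s}))"
    proof (intro sum_mono mult_right_mono B(4) less_imp_le[OF gibbs_Z_pos[OF bw]])
      fix s assume "s \<in> ?S"
      then show "card (R - {k} - {j}) = card (?S - {s})"
        using assms k False by auto
    qed (use fin in auto)
    also have "\<dots> = K\<^sup>2 * gibbs_Z w (R - {j}) ?S"
      unfolding eq by (subst gibbs_sum_expand_row[of "R - {j}" _ k])
        (use fin k False in \<open>auto simp: sum_distrib_left mult.assoc\<close>)
    finally show ?thesis .
  qed
  have pos: "gibbs_Z w (R - {j}) ?S > 0"
    by (rule gibbs_Z_pos[OF bw]) (use assms in auto)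
  have "gibbs_Z w R S = (\<Sum>k\<in>R. w k b * gibbs_Z w (R - {k}) ?S)"
    by (rule gibbs_sum_expand_col[OF fin b])
  also have "\<dots> \<le> (\<Sum>k\<in>R. (K\<^sup>2 * w j b) * (K\<^sup>2 * gibbs_Z w (R - {j}) ?S))"
  proof (intro sum_mono mult_mono B(4) Zc)
    fix k assume "k \<in> R"
    show "0 \<le> gibbs_Z w (R - {k}) ?S"
      by (rule less_imp_le[OF gibbs_Z_pos[OF bw]]) (use assms \<open>k \<in> R\<close> in auto)
    show "0 \<le> K\<^sup>2 * w j b" using B(3)[of j b] by simp
  qed
  also have "\<dots> = (K ^ 4 * real (card R)) * (w j b * gibbs_Z w (R - {j}) ?S)"
    by (simp add: power4_eq_xxxx power2_eq_square)
  finally have *: "gibbs_Z w R S \<le> \<dots>" .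
  have "K ^ 4 * real (card R) > 0"
    using B(2) j fin card_gt_0_iff[of R] by (intro mult_pos_pos) auto
  then show ?thesis using * by (simp add: field_simps)
qed

text \<open>
Two distributions \<open>p\<close> and \<open>q\<close> on \<open>R\<close> that both dominate
\<open>1 / C\<close> times the uniform one can be coupled so that they agree with probability
\<open>1 / C\<close>. Agreement costs at most \<open>1\<close> and disagreement at most \<open>1 +
C\<close>; the constant is chosen such that \<open>(1 / C) * 1 + (1 - 1 / C) * (1 + C) = C\<close>,
so that the bound reproduces itself in an induction.
\<close>

lemma coupled_means_diff:
  fixes p q x y :: "nat \<Rightarrow> real" and C :: real
  assumes fin: "finite R" "R \<noteq> {}" and sum: "sum p R = 1" "sum q R = 1"
    and low: "\<And>k. k \<in> R \<Longrightarrow> p k \<ge> 1 / (C * card R)" "\<And>k. k \<in> R \<Longrightarrow> q k \<ge> 1 / (C * card R)"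
    and C: "C \<ge> 1"
    and diag: "\<And>k. k \<in> R \<Longrightarrow> x k - y k \<le> 1"
    and off: "\<And>j k. j \<in> R \<Longrightarrow> k \<in> R \<Longrightarrow> x j - y k \<le> 1 + C"
  shows "(\<Sum>k\<in>R. p k * x k) - (\<Sum>k\<in>R. q k * y k) \<le> C"
proof -
  (* The uniform part e is coupled diagonally, the remainders are compared with the maximum x m. *)
  define e where "e = 1 / (C * card R)"
  have cR: "card R > 0" using fin by (simp add: card_gt_0_iff)
  obtain m where m: "m \<in> R" "\<And>j. j \<in> R \<Longrightarrow> x j \<le> x m"
  proof -
    have "Max (x ` R) \<in> x ` R" using fin by (intro Max_in) auto
    then obtain m where "m \<in> R" "x m = Max (x ` R)" by auto
    then show ?thesis using fin(1) by (intro that[of m]) auto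
  qed
  have s: "(\<Sum>k\<in>R. p k - e) = 1 - 1 / C" "(\<Sum>k\<in>R. q k - e) = 1 - 1 / C"
    using sum cR C by (auto simp: sum_subtractf e_def)
  have 1: "(\<Sum>k\<in>R. (p k - e) * x k) \<le> (1 - 1 / C) * x m"
    unfolding s(1)[symmetric] sum_distrib_right
    by (intro sum_mono mult_left_mono m) (use low(1) in \<open>auto simp: e_def\<close>)
  have 2: "(\<Sum>k\<in>R. (q k - e) * y k) \<ge> (1 - 1 / C) * (x m - (1 + C))"
    unfolding s(2)[symmetric] sum_distrib_right
  proof (intro sum_mono mult_left_mono)
    fix k assume "k \<in> R"
    then show "x m - (1 + C) \<le> y k" using off[OF m(1), of k] by linarith
  qed (use low(2) in \<open>auto simp: e_def\<close>)
  have "(\<Sum>k\<in>R. e * (x k - y k)) \<le> (\<Sum>k\<in>R. e * 1)"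
    by (intro sum_mono mult_left_mono diag) (use C in \<open>auto simp: e_def\<close>)
  also have "\<dots> = 1 / C" using cR by (simp add: e_def)
  finally have 3: "(\<Sum>k\<in>R. e * (x k - y k)) \<le> 1 / C" .
  have "(\<Sum>k\<in>R. p k * x k) - (\<Sum>k\<in>R. q k * y k) =
     (\<Sum>k\<in>R. (p k - e) * x k) - (\<Sum>k\<in>R. (q k - e) * y k) + (\<Sum>k\<in>R. e * (x k - y k))"
    by (simp add: algebra_simps sum.distrib sum_subtractf)
  also have "\<dots> \<le> (1 - 1 / C) * x m - (1 - 1 / C) * (x m - (1 + C)) + 1 / C"
    using 1 2 3 by linarith
  also have "\<dots> = C" using C by (simp add: field_simps)
  finally show ?thesis .
qed

text \<open>
The Gibbs measures on matchings of \<open>R\<close> with \<open>S - {a}\<close> and with \<open>S -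
{b}\<close> have couplings with at most \<open>K^4\<close> differing pairs on average. It is stated
in the dual (Kantorovich) form, where no coupling has to be constructed. In the induction, reveal
the row matched with \<open>b\<close> in the first matching and the row matched with
\<open>a\<close> in the second one. If both rows agree, what is left has the same law on both sides.
If they are \<open>j \<noteq> k\<close>, what is left is the same problem with rows and columns
exchanged: the column set is common, and row \<open>j\<close> respectively \<open>k\<close> is
missing.
\<close>

lemma gibbs_coupling:
  assumes "bounded_weights K w" "finite R" "finite S" "card S = Suc (card R)"
    and "a \<in> S" "b \<in> S"
    and "\<And>M M'. M \<in> matchings R (S - {a}) \<Longrightarrow> M' \<in> matchings R (S - {b}) \<Longrightarrow>
          F M - G M' \<le> real (card (M - M'))"
  shows "gibbs_mean w R (S - {a}) F - gibbs_mean w R (S - {b}) G \<le> K ^ 4"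
  using assms
proof (induction "card R" arbitrary: R S a b F G w)
  case (0 R S a b F G w)
  have "a = b" using 0 by (metis One_nat_def card_1_singletonE singletonD)
  note bw = 0(2)
  have c: "card R = card (S - {a})" using 0 by simp
  have "gibbs_mean w R (S - {a}) F \<le> gibbs_mean w R (S - {a}) G"
  proof (rule gibbs_mean_mono[OF bw _ _ c])
    fix M assume "M \<in> matchings R (S - {a})"
    then show "F M \<le> G M" using 0(8)[of M M] \<open>a = b\<close> by simp
  qed (use 0 in auto)
  then show ?case using \<open>a = b\<close> bounded_weightsD(1)[OF bw] by (smt (verit) zero_le_power)
next
  case (Suc n R S a b F G w)
  note bw = Suc(3)
  note B = bounded_weightsD[OF bw]
  have K4: "K ^ 4 \<ge> 1" using B(1) by simp
  show ?case
  proof (cases "a = b")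
    case True
    have c: "card R = card (S - {a})" using Suc(2-7) by simp
    have "gibbs_mean w R (S - {a}) F \<le> gibbs_mean w R (S - {a}) G"
    proof (rule gibbs_mean_mono[OF bw _ _ c])
      fix M assume "M \<in> matchings R (S - {a})"
      then show "F M \<le> G M" using Suc(9)[of M M] True by simp
    qed (use Suc in auto)
    then show ?thesis using True K4 by simp
  next
    case False
    define S' where "S' = S - {a} - {b}"
    have S': "S - {b} - {a} = S'" "S - {a} - {b} = S'" by (auto simp: S'_def)
    have ca: "card R = card (S - {a})" "card R = card (S - {b})" using Suc(4-8) by auto
    have fin: "finite R" "finite S" "finite S'" using Suc(4,5) by (auto simp: S'_def)
    have cS': "Suc (card S') = card R" using Suc(2-8) False by (auto simp: S'_def)
    have cRk: "card (R - {k}) = card S'" if "k \<in> R" for k using cS' that fin by simp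
    let ?p = "\<lambda>k. w k b * gibbs_Z w (R - {k}) S' / gibbs_Z w R (S - {a})"
    let ?q = "\<lambda>k. w k a * gibbs_Z w (R - {k}) S' / gibbs_Z w R (S - {b})"
    let ?x = "\<lambda>k. gibbs_mean w (R - {k}) S' (\<lambda>N. F (insert (k, b) N))"
    let ?y = "\<lambda>k. gibbs_mean w (R - {k}) S' (\<lambda>N. G (insert (k, a) N))"
    have Zp: "gibbs_Z w R (S - {a}) > 0" "gibbs_Z w R (S - {b}) > 0"
      using gibbs_Z_pos[OF bw] ca fin by auto
    have eF: "gibbs_mean w R (S - {a}) F' =
      (\<Sum>k\<in>R. ?p k * gibbs_mean w (R - {k}) S' (\<lambda>N. F' (insert (k, b) N)))" for F'
      using gibbs_mean_expand_col[OF bw fin(1) _ ca(1), of b F'] fin(2) False Suc(8) S' by simp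
    have eG: "gibbs_mean w R (S - {b}) F' =
      (\<Sum>k\<in>R. ?q k * gibbs_mean w (R - {k}) S' (\<lambda>N. F' (insert (k, a) N)))" for F'
      using gibbs_mean_expand_col[OF bw fin(1) _ ca(2), of a F'] fin(2) False Suc(7) S' by simp
    have one: "gibbs_mean w (R - {k}) S' (\<lambda>_. 1) = 1" if "k \<in> R" for k
      by (rule gibbs_mean_1[OF bw]) (use fin cRk that in auto)
    have sp: "sum ?p R = 1"
      using eF[of "\<lambda>_. 1"] gibbs_mean_1[OF bw _ _ ca(1)] fin one by simp
    have sq: "sum ?q R = 1"
      using eG[of "\<lambda>_. 1"] gibbs_mean_1[OF bw _ _ ca(2)] fin one by simp
    have lp: "?p k \<ge> 1 / (K ^ 4 * card R)" if "k \<in> R" for k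
      using gibbs_marginal_lower[OF bw, of R "S - {a}" k b] fin ca that False Suc(8) S' Zp
      by (simp add: pos_le_divide_eq)
    have lq: "?q k \<ge> 1 / (K ^ 4 * card R)" if "k \<in> R" for k
      using gibbs_marginal_lower[OF bw, of R "S - {b}" k a] fin ca that False Suc(7) S' Zp
      by (simp add: pos_le_divide_eq)
    have fM: "finite M" if "M \<in> matchings (R - {k}) S'" for M k
      using that fin by (auto simp: matchings_def intro: finite_subset[of _ "R \<times> S'"])
    have FG: "F (insert (j, b) N) - G (insert (k, a) N') \<le> 1 + real (card (N - N'))"
      if "j \<in> R" "k \<in> R" "N \<in> matchings (R - {j}) S'" "N' \<in> matchings (R - {k}) S'" for j k N N'
    proof -
      have "insert (j, b) N \<in> matchings R (S - {a})" "insert (k, a) N' \<in> matchings R (S - {b})"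
        using insert_in_matchings[of j R b "S - {a}" N] insert_in_matchings[of k R a "S - {b}" N']
          that Suc(7,8) False S' by auto
      then have "F (insert (j, b) N) - G (insert (k, a) N') \<le> card (insert (j, b) N - insert (k, a) N')"
        using Suc(9) by blast
      also have "card (insert (j, b) N - insert (k, a) N') \<le> card (insert (j, b) (N - N'))"
        using fM that by (intro card_mono) auto
      also have "\<dots> \<le> Suc (card (N - N'))" by (rule card_insert_le_m1) auto
      finally show ?thesis by simp
    qed
    (* Same row on both sides: the remaining laws coincide, only the pair with row k differs. *)
    have diag: "?x k - ?y k \<le> 1" if k: "k \<in> R" for k
    proof -
      have "?x k \<le> gibbs_mean w (R - {k}) S' (\<lambda>N. G (insert (k, a) N) + 1)"
      proof (rule gibbs_mean_mono[OF bw _ _ cRk[OF k]])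
        fix N assume "N \<in> matchings (R - {k}) S'"
        from FG[OF k k this this] show "F (insert (k, b) N) \<le> G (insert (k, a) N) + 1" by simp
      qed (use fin in auto)
      then show ?thesis using gibbs_mean_add_const[OF bw] cRk k fin by simp
    qed
    (* Different rows: transposed, this is an instance of the induction hypothesis. The shift by -1
       pays for the revealed pair. *)
    have off: "?x j - ?y k \<le> 1 + K ^ 4" if jk: "j \<in> R" "k \<in> R" for j k
    proof -
      have "gibbs_mean (\<lambda>j i. w i j) S' (R - {j}) (\<lambda>N. F (insert (j, b) (converse N)) + (-1)) -
            gibbs_mean (\<lambda>j i. w i j) S' (R - {k}) (\<lambda>N. G (insert (k, a) (converse N))) \<le> K ^ 4"
      proof (rule Suc(1)[OF _ bounded_weights_transpose[OF bw]])
        show "n = card S'" using Suc(2) cS' by simp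
        fix M M' assume M: "M \<in> matchings S' (R - {j})" "M' \<in> matchings S' (R - {k})"
        then have "converse M \<in> matchings (R - {j}) S'" "converse M' \<in> matchings (R - {k}) S'"
          by (auto simp: matchings_converse[of S'])
        from FG[OF jk this] have "F (insert (j, b) (M\<inverse>)) - G (insert (k, a) (M'\<inverse>))
           \<le> 1 + real (card (M\<inverse> - M'\<inverse>))" .
        also have "M\<inverse> - M'\<inverse> = prod.swap ` (M - M')" by force
        also have "card \<dots> = card (M - M')" by (rule card_image) auto
        finally show "F (insert (j, b) (M\<inverse>)) + (-1) - G (insert (k, a) (M'\<inverse>)) \<le> card (M - M')"
          by simp
      qed (use fin cS' jk in auto)
      moreover have "gibbs_mean (\<lambda>j i. w i j) S' (R - {j}) (\<lambda>N. F (insert (j, b) (converse N)) + (-1))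
          = ?x j + (-1)"
        using gibbs_mean_transpose[of w "R - {j}" S' "\<lambda>N. F (insert (j, b) N) + (-1)"]
          gibbs_mean_add_const[OF bw, of "R - {j}" S' "\<lambda>N. F (insert (j, b) N)" "-1"] fin cRk jk by simp
      ultimately show ?thesis
        using gibbs_mean_transpose[of w "R - {k}" S' "\<lambda>N. G (insert (k, a) N)"] by simp
    qed
    show ?thesis
      unfolding eF[of F] eG[of G]
      by (rule coupled_means_diff[OF _ _ sp sq lp lq K4 diag off]) (use fin Suc(2) in auto)
  qed
qed

lemma variance_range:
  fixes p x :: "'a \<Rightarrow> real"
  assumes "finite I" "sum p I = 1" "\<And>s. s \<in> I \<Longrightarrow> p s \<ge> 0"
    and "\<And>s t. s \<in> I \<Longrightarrow> t \<in> I \<Longrightarrow> x s - x t \<le> D"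
  shows "(\<Sum>s\<in>I. p s * (x s)\<^sup>2) - (\<Sum>s\<in>I. p s * x s)\<^sup>2 \<le> D\<^sup>2"
proof -
  define m where "m = (\<Sum>s\<in>I. p s * x s)"
  have "\<bar>x s - m\<bar> \<le> D" if s: "s \<in> I" for s
  proof -
    have "x s - m = (\<Sum>t\<in>I. p t * (x s - x t))"
      using assms(2) by (simp add: right_diff_distrib sum_subtractf m_def flip: sum_distrib_right)
    also have "\<bar>\<dots>\<bar> \<le> (\<Sum>t\<in>I. \<bar>p t * (x s - x t)\<bar>)" by (rule sum_abs)
    also have "\<dots> \<le> (\<Sum>t\<in>I. p t * D)"
    proof (intro sum_mono)
      fix t assume t: "t \<in> I"
      have "\<bar>x s - x t\<bar> \<le> D" using assms(4)[OF s t] assms(4)[OF t s] by linarith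
      then show "\<bar>p t * (x s - x t)\<bar> \<le> p t * D"
        using assms(3)[OF t] by (simp add: abs_mult mult_left_mono)
    qed
    also have "\<dots> = D" using assms(2) by (simp flip: sum_distrib_right)
    finally show ?thesis .
  qed
  then have "(\<Sum>s\<in>I. p s * (x s - m)\<^sup>2) \<le> (\<Sum>s\<in>I. p s * D\<^sup>2)"
    by (intro sum_mono mult_left_mono assms(3)) (metis abs_ge_zero power2_abs power_mono)
  also have "\<dots> = D\<^sup>2" using assms(2) by (simp flip: sum_distrib_right)
  finally have "(\<Sum>s\<in>I. p s * (x s - m)\<^sup>2) \<le> D\<^sup>2" .
  moreover have "(\<Sum>s\<in>I. p s * (x s - m)\<^sup>2) =
    (\<Sum>s\<in>I. p s * (x s)\<^sup>2) - 2 * m * (\<Sum>s\<in>I. p s * x s) + m\<^sup>2 * sum p I"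
    by (simp add: power2_diff algebra_simps sum.distrib sum_subtractf sum_distrib_left
        flip: sum_distrib_right)
  ultimately show ?thesis using assms(2) by (simp add: m_def power2_eq_square)
qed

text \<open>
The law of total variance, applied to the value of one row at a time. Changing that value moves the
conditional mean by at most \<open>L * (1 + K ^ 4)\<close>: the row itself contributes
\<open>L\<close>, and the other rows contribute \<open>L * K ^ 4\<close> by the coupling lemma.
\<close>

theorem gibbs_variance:
  assumes "bounded_weights K w" "finite R" "finite S" "card R = card S" "L \<ge> 0"
    and "\<And>M M'. M \<in> matchings R S \<Longrightarrow> M' \<in> matchings R S \<Longrightarrow>
          F M - F M' \<le> L * real (card (M - M'))"
  shows "gibbs_mean w R S (\<lambda>M. (F M)\<^sup>2) - (gibbs_mean w R S F)\<^sup>2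
     \<le> real (card R) * (L * (1 + K ^ 4))\<^sup>2"
  using assms
proof (induction "card R" arbitrary: R S F)
  case (0 R S F)
  then have "R = {}" "S = {}" by auto
  then have "matchings R S = {{}}" by (auto simp: matchings_def)
  then show ?case using 0 by (simp add: gibbs_mean_def gibbs_sum_def)
next
  case (Suc n R S F)
  note bw = Suc(3)
  obtain i where i: "i \<in> R" using Suc by fastforce
  have fin: "finite R" "finite S" and c: "card R = card S" using Suc by auto
  note L = Suc(7) and Lip = Suc(8)
  let ?p = "\<lambda>s. w i s * gibbs_Z w (R - {i}) (S - {s}) / gibbs_Z w R S"
  let ?m = "\<lambda>s \<Phi>. gibbs_mean w (R - {i}) (S - {s}) (\<lambda>N. \<Phi> (insert (i, s) N))"
  note ex = gibbs_mean_expand_row[OF bw fin c i]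
  have cs: "card (R - {i}) = card (S - {s})" if "s \<in> S" for s using that fin i c by simp
  have p0: "?p s \<ge> 0" if "s \<in> S" for s
    using gibbs_Z_pos[OF bw, of R S] gibbs_Z_pos[OF bw, of "R - {i}" "S - {s}"] fin c cs[OF that]
      bounded_weightsD(3)[OF bw, of i s] by simp
  have sp: "sum ?p S = 1"
    using ex[of "\<lambda>_. 1"] gibbs_mean_1[OF bw fin c] gibbs_mean_1[OF bw, of "R - {i}"] cs fin by simp
  have ins: "insert (i, s) N \<in> matchings R S" if "s \<in> S" "N \<in> matchings (R - {i}) (S - {s})" for s N
    using insert_in_matchings[OF i that] .
  have fM: "finite M" if "M \<in> matchings (R - {i}) (S - {s})" for M s
    using that fin by (auto simp: matchings_def intro: finite_subset[of _ "R \<times> S"])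
  have lipc: "F (insert (i, s) N) - F (insert (i, t) N') \<le> L * (1 + real (card (N - N')))"
    if "s \<in> S" "t \<in> S" "N \<in> matchings (R - {i}) (S - {s})" "N' \<in> matchings (R - {i}) (S - {t})" for s t N N'
  proof -
    have "F (insert (i, s) N) - F (insert (i, t) N') \<le> L * card (insert (i, s) N - insert (i, t) N')"
      using Lip ins that by blast
    also have "card (insert (i, s) N - insert (i, t) N') \<le> card (insert (i, s) (N - N'))"
      using fM that by (intro card_mono) auto
    also have "\<dots> \<le> Suc (card (N - N'))" by (rule card_insert_le_m1) auto
    finally show ?thesis using L by (simp add: mult_left_mono)
  qed
  have step: "?m s (\<lambda>M. (F M)\<^sup>2) \<le> n * (L * (1 + K ^ 4))\<^sup>2 + (?m s F)\<^sup>2" if s: "s \<in> S" for s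
  proof -
    have "?m s (\<lambda>M. (F M)\<^sup>2) - (?m s F)\<^sup>2 \<le> card (R - {i}) * (L * (1 + K ^ 4))\<^sup>2"
    proof (rule Suc(1)[OF _ bw _ _ _ L])
      fix M M' assume M: "M \<in> matchings (R - {i}) (S - {s})" "M' \<in> matchings (R - {i}) (S - {s})"
      have "F (insert (i, s) M) - F (insert (i, s) M') \<le> L * card (insert (i, s) M - insert (i, s) M')"
        using Lip ins s M by blast
      also have "card (insert (i, s) M - insert (i, s) M') \<le> card (M - M')"
        using fM M by (intro card_mono) auto
      finally show "F (insert (i, s) M) - F (insert (i, s) M') \<le> L * card (M - M')"
        using L by (simp add: mult_left_mono)
    qed (use Suc i fin cs[OF s] in auto)
    moreover have "card (R - {i}) = n" using Suc(2) i fin by simp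
    ultimately show ?thesis by simp
  qed
  have rng: "?m s F - ?m t F \<le> L * (1 + K ^ 4)" if st: "s \<in> S" "t \<in> S" for s t
  proof (cases "L = 0")
    case True
    have eq: "F M = F M'" if "M \<in> matchings R S" "M' \<in> matchings R S" for M M'
      using Lip[OF that] Lip[OF that(2,1)] True by simp
    obtain M0 where M0: "M0 \<in> matchings R S"
      using gibbs_Z_pos[OF bw fin c] by (force simp: gibbs_sum_def)
    have "?m s F = F M0" if s: "s \<in> S" for s
    proof -
      have "?m s F \<le> gibbs_mean w (R - {i}) (S - {s}) (\<lambda>N. 0 + F M0)"
        by (rule gibbs_mean_mono[OF bw]) (use fin cs[OF s] eq[OF ins[OF s] M0] in auto)
      moreover have "?m s F \<ge> gibbs_mean w (R - {i}) (S - {s}) (\<lambda>N. 0 + F M0)"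
        by (rule gibbs_mean_mono[OF bw]) (use fin cs[OF s] eq[OF ins[OF s] M0] in auto)
      ultimately show ?thesis
        using gibbs_mean_add_const[OF bw, of "R - {i}" "S - {s}" "\<lambda>_. 0" "F M0"] fin cs[OF s]
        by (simp add: gibbs_mean_def gibbs_sum_def)
    qed
    then show ?thesis using st True by simp
  next
    case False
    then have L0: "L > 0" using L by simp
    have scale: "gibbs_mean w R' S' (\<lambda>N. G N / L) = gibbs_mean w R' S' G / L" for R' S' G
      by (simp add: gibbs_mean_def gibbs_sum_def sum_divide_distrib mult.commute)
    (* The coupling lemma applies to F / L; the shift by -1 pays for the row i itself. *)
    have "gibbs_mean w (R - {i}) (S - {s}) (\<lambda>N. F (insert (i, s) N) / L + (-1))
        - gibbs_mean w (R - {i}) (S - {t}) (\<lambda>N. F (insert (i, t) N) / L) \<le> K ^ 4"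
    proof (rule gibbs_coupling[OF bw])
      fix M M' assume "M \<in> matchings (R - {i}) (S - {s})" "M' \<in> matchings (R - {i}) (S - {t})"
      from lipc[OF st this]
      have "(F (insert (i, s) M) - F (insert (i, t) M')) / L \<le> 1 + real (card (M - M'))"
        using L0 by (simp add: pos_divide_le_eq mult.commute)
      then show "F (insert (i, s) M) / L + (-1) - F (insert (i, t) M') / L \<le> card (M - M')"
        by (simp add: diff_divide_distrib)
    qed (use fin c i st card_Suc_Diff1[OF fin(1) i] in auto)
    then have "(?m s F - ?m t F) / L \<le> 1 + K ^ 4"
      using gibbs_mean_add_const[OF bw, of "R - {i}" "S - {s}" "\<lambda>N. F (insert (i, s) N) / L" "-1"]
        fin cs[OF st(1)] by (simp add: scale diff_divide_distrib)
    then show ?thesis using L0 by (simp add: pos_divide_le_eq mult.commute)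
  qed
  have "gibbs_mean w R S (\<lambda>M. (F M)\<^sup>2) \<le> (\<Sum>s\<in>S. ?p s * (n * (L * (1 + K ^ 4))\<^sup>2 + (?m s F)\<^sup>2))"
    unfolding ex[of "\<lambda>M. (F M)\<^sup>2"] by (intro sum_mono mult_left_mono step p0)
  also have "\<dots> = n * (L * (1 + K ^ 4))\<^sup>2 * sum ?p S + (\<Sum>s\<in>S. ?p s * (?m s F)\<^sup>2)"
    unfolding distrib_left sum.distrib sum_distrib_left by (simp only: mult.commute)
  also have "\<dots> \<le> n * (L * (1 + K ^ 4))\<^sup>2 + ((gibbs_mean w R S F)\<^sup>2 + (L * (1 + K ^ 4))\<^sup>2)"
  proof -
    have "(\<Sum>s\<in>S. ?p s * (?m s F)\<^sup>2) - (\<Sum>s\<in>S. ?p s * ?m s F)\<^sup>2 \<le> (L * (1 + K ^ 4))\<^sup>2"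
      by (rule variance_range[OF fin(2) sp p0 rng])
    then show ?thesis unfolding ex[of F] sp by simp
  qed
  finally show ?case unfolding Suc(2)[symmetric] by (simp add: algebra_simps)
qed

section \<open>The permutation model and transposition swaps\<close>

definition graph_on :: "nat \<Rightarrow> (nat \<Rightarrow> nat) \<Rightarrow> (nat \<times> nat) set" where
  "graph_on n \<pi> = (\<lambda>i. (i, \<pi> i)) ` {1..n}"

lemma bij_betw_graph_on: "bij_betw (graph_on n) (perms n) (matchings {1..n} {1..n})"
proof (rule bij_betw_imageI)
  have ex: "\<exists>!j. (i, j) \<in> graph_on n \<pi> \<and> j = \<pi> i" if "i \<in> {1..n}" for i \<pi>
    using that by (auto simp: graph_on_def)
  show "inj_on (graph_on n) (perms n)"
  proof (rule inj_onI)
    fix \<pi> \<sigma> assume a: "\<pi> \<in> perms n" "\<sigma> \<in> perms n" "graph_on n \<pi> = graph_on n \<sigma>"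
    show "\<pi> = \<sigma>"
    proof
      fix i
      show "\<pi> i = \<sigma> i"
      proof (cases "i \<in> {1..n}")
        case True
        then have "(i, \<pi> i) \<in> graph_on n \<pi>" unfolding graph_on_def by blast
        then have "(i, \<pi> i) \<in> graph_on n \<sigma>" unfolding a(3) .
        then show ?thesis by (auto simp: graph_on_def)
      next
        case False
        then show ?thesis using a by (auto simp: perms_def permutes_def)
      qed
    qed
  qed
  show "graph_on n ` perms n = matchings {1..n} {1..n}"
  proof (intro equalityI subsetI)
    fix M assume "M \<in> graph_on n ` perms n"
    then obtain \<pi> where \<pi>: "\<pi> permutes {1..n}" "M = graph_on n \<pi>" by (auto simp: perms_def)
    have "\<exists>!i. (i, j) \<in> M" if j: "j \<in> {1..n}" for j
    proof -
      obtain i where i: "i \<in> {1..n}" "\<pi> i = j" using permutes_image[OF \<pi>(1)] j by (metis imageE)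
      show ?thesis
        by (rule ex1I[of _ i]) (use i \<pi> permutes_inj[OF \<pi>(1)] in \<open>auto simp: graph_on_def dest: injD\<close>)
    qed
    moreover have "\<exists>!j. (i, j) \<in> M" if "i \<in> {1..n}" for i
      unfolding \<pi>(2) graph_on_def using that by (intro ex1I[of _ "\<pi> i"]) blast+
    moreover have "M \<subseteq> {1..n} \<times> {1..n}"
      unfolding \<pi>(2) graph_on_def image_subset_iff
      using permutes_in_image[OF \<pi>(1)] by blast
    ultimately show "M \<in> matchings {1..n} {1..n}" by (simp add: matchings_def)
  next
    fix M assume M: "M \<in> matchings {1..n} {1..n}"
    define \<pi> where "\<pi> i = (if i \<in> {1..n} then THE j. (i, j) \<in> M else i)" for i
    have row: "\<exists>!j. (i, j) \<in> M" if "i \<in> {1..n}" for i using M that by (simp add: matchings_def)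
    have col: "\<exists>!i. (i, j) \<in> M" if "j \<in> {1..n}" for j using M that by (simp add: matchings_def)
    have sub: "M \<subseteq> {1..n} \<times> {1..n}" using M by (simp add: matchings_def)
    have in_M: "(i, \<pi> i) \<in> M" if "i \<in> {1..n}" for i
      using theI'[OF row[OF that]] that by (simp add: \<pi>_def)
    have eq_\<pi>: "j = \<pi> i" if "(i, j) \<in> M" for i j
      using row[of i] in_M[of i] that sub by blast
    have "bij_betw \<pi> {1..n} {1..n}"
    proof (rule bij_betw_imageI)
      show "inj_on \<pi> {1..n}"
        by (rule inj_onI) (metis SigmaD2 col in_M sub subsetD)
      show "\<pi> ` {1..n} = {1..n}"
      proof (intro equalityI subsetI)
        fix x assume "x \<in> \<pi> ` {1..n}" then show "x \<in> {1..n}" using in_M sub by blast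
      next
        fix x assume "x \<in> {1..n}"
        then obtain i where i: "(i, x) \<in> M" using col by blast
        then have "i \<in> {1..n}" using sub by blast
        then show "x \<in> \<pi> ` {1..n}" using eq_\<pi>[OF i] by blast
      qed
    qed
    then have "\<pi> permutes {1..n}" by (rule bij_imp_permutes) (auto simp: \<pi>_def)
    moreover have "M = graph_on n \<pi>"
      using in_M eq_\<pi> sub by (fastforce simp: graph_on_def)
    ultimately show "M \<in> graph_on n ` perms n" by (auto simp: perms_def)
  qed
qed

lemma card_graph_diff: "card (graph_on n \<pi> - graph_on n \<sigma>) = card {i\<in>{1..n}. \<pi> i \<noteq> \<sigma> i}"
proof -
  have "graph_on n \<pi> - graph_on n \<sigma> = (\<lambda>i. (i, \<pi> i)) ` {i\<in>{1..n}. \<pi> i \<noteq> \<sigma> i}"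
    by (auto simp: graph_on_def)
  moreover have "inj_on (\<lambda>i. (i, \<pi> i)) {i\<in>{1..n}. \<pi> i \<noteq> \<sigma> i}" by (auto simp: inj_on_def)
  ultimately show ?thesis by (simp add: card_image)
qed

definition hamming :: "nat \<Rightarrow> (nat \<Rightarrow> nat) \<Rightarrow> (nat \<Rightarrow> nat) \<Rightarrow> real" where
  "hamming n \<pi> \<sigma> = real (card {i\<in>{1..n}. \<pi> i \<noteq> \<sigma> i})"

definition hamming_lipschitz :: "nat \<Rightarrow> real \<Rightarrow> ((nat \<Rightarrow> nat) \<Rightarrow> real) \<Rightarrow> bool" where
  "hamming_lipschitz n L F \<longleftrightarrow> 0 \<le> L \<and>
     (\<forall>\<pi>\<in>perms n. \<forall>\<sigma>\<in>perms n. F \<pi> - F \<sigma> \<le> L * hamming n \<pi> \<sigma>)"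

lemma permsD:
  assumes "\<pi> \<in> perms n" "i \<in> {1..n}" shows "\<pi> i \<in> {1..n}"
  using assms unfolding perms_def by (simp only: mem_Collect_eq permutes_in_image)

lemma perms_swap:
  assumes "\<pi> \<in> perms n" "i \<in> {1..n}" "j \<in> {1..n}"
  shows "\<pi> \<circ> Transposition.transpose i j \<in> perms n"
  using permutes_compose[OF permutes_swap_id[OF assms(2,3)]] assms(1) by (simp add: perms_def)

text \<open>
Every statistic of this development is a sum of bounded terms, each of which looks at the
permutation only on its support. Changing one position affects the terms whose support contains it,
of which there are at most \<open>N\<close>.
\<close>

lemma local_sum_lipschitz:
  fixes \<phi> :: "(nat \<Rightarrow> nat) \<Rightarrow> 't \<Rightarrow> real"
  assumes I: "finite I" and D: "0 \<le> D" "0 \<le> N"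
    and bd: "\<And>\<pi> t. \<pi> \<in> perms n \<Longrightarrow> t \<in> I \<Longrightarrow> \<bar>\<phi> \<pi> t\<bar> \<le> D"
    and supp: "\<And>t. t \<in> I \<Longrightarrow> supp t \<subseteq> {1..n}"
    and loc: "\<And>\<pi> \<sigma> t. \<pi> \<in> perms n \<Longrightarrow> \<sigma> \<in> perms n \<Longrightarrow> t \<in> I \<Longrightarrow>
      (\<And>m. m \<in> supp t \<Longrightarrow> \<pi> m = \<sigma> m) \<Longrightarrow> \<phi> \<pi> t = \<phi> \<sigma> t"
    and N: "\<And>m. m \<in> {1..n} \<Longrightarrow> real (card {t\<in>I. m \<in> supp t}) \<le> N"
  shows "hamming_lipschitz n (2 * D * N) (\<lambda>\<pi>. \<Sum>t\<in>I. \<phi> \<pi> t)"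
  unfolding hamming_lipschitz_def
proof (intro conjI ballI)
  fix \<pi> \<sigma> assume \<pi>: "\<pi> \<in> perms n" and \<sigma>: "\<sigma> \<in> perms n"
  let ?X = "{i\<in>{1..n}. \<pi> i \<noteq> \<sigma> i}"
  let ?J = "\<Union>m\<in>?X. {t\<in>I. m \<in> supp t}"
  have "(\<Sum>t\<in>I. \<phi> \<pi> t) - (\<Sum>t\<in>I. \<phi> \<sigma> t) = (\<Sum>t\<in>I. \<phi> \<pi> t - \<phi> \<sigma> t)"
    by (simp add: sum_subtractf)
  also have "\<dots> = (\<Sum>t\<in>?J. \<phi> \<pi> t - \<phi> \<sigma> t)"
  proof (rule sum.mono_neutral_right[OF I])
    show "\<forall>t\<in>I - ?J. \<phi> \<pi> t - \<phi> \<sigma> t = 0"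
    proof
      fix t assume t: "t \<in> I - ?J"
      have "\<phi> \<pi> t = \<phi> \<sigma> t"
        by (rule loc[OF \<pi> \<sigma>]) (use t supp[of t] in blast)+
      then show "\<phi> \<pi> t - \<phi> \<sigma> t = 0" by simp
    qed
  qed auto
  also have "\<dots> \<le> (\<Sum>t\<in>?J. 2 * D)"
  proof (rule sum_mono)
    fix t assume "t \<in> ?J"
    then have "t \<in> I" by auto
    then show "\<phi> \<pi> t - \<phi> \<sigma> t \<le> 2 * D" using bd[OF \<pi>, of t] bd[OF \<sigma>, of t] by linarith
  qed
  also have "\<dots> = 2 * D * real (card ?J)" by simp
  also have "real (card ?J) \<le> real (\<Sum>m\<in>?X. card {t\<in>I. m \<in> supp t})"
    by (intro of_nat_mono card_UN_le) auto
  also have "\<dots> \<le> (\<Sum>m\<in>?X. N)" unfolding of_nat_sum by (intro sum_mono N) auto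
  also have "\<dots> = N * hamming n \<pi> \<sigma>" by (simp add: hamming_def)
  finally show "(\<Sum>t\<in>I. \<phi> \<pi> t) - (\<Sum>t\<in>I. \<phi> \<sigma> t) \<le> 2 * D * N * hamming n \<pi> \<sigma>"
    using D by (simp add: mult_left_mono mult.assoc)
qed (use D in auto)

lemma hamming_nonneg: "0 \<le> hamming n \<pi> \<sigma>" by (simp add: hamming_def)

lemma hamming_lipschitz_scale:
  assumes "hamming_lipschitz n L F" "0 \<le> c" "c * L \<le> L'"
  shows "hamming_lipschitz n L' (\<lambda>\<pi>. c * F \<pi>)"
  unfolding hamming_lipschitz_def
proof (intro conjI ballI)
  have "0 \<le> c * L" using assms by (simp add: hamming_lipschitz_def)
  then show "0 \<le> L'" using assms by linarith
  fix \<pi> \<sigma> assume "\<pi> \<in> perms n" "\<sigma> \<in> perms n"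
  then have "c * (F \<pi> - F \<sigma>) \<le> c * (L * hamming n \<pi> \<sigma>)"
    using assms by (intro mult_left_mono) (auto simp: hamming_lipschitz_def)
  also have "\<dots> = (c * L) * hamming n \<pi> \<sigma>" by simp
  also have "\<dots> \<le> L' * hamming n \<pi> \<sigma>" using assms(3) hamming_nonneg by (intro mult_right_mono)
  finally show "c * F \<pi> - c * F \<sigma> \<le> L' * hamming n \<pi> \<sigma>" by (simp add: algebra_simps)
qed

lemma finite_edges: "finite (edges n)"
  by (rule finite_subset[of _ "{1..n} \<times> {1..n}"]) (auto simp: edges_def)

lemma card_edges_le: "real (card (edges n)) \<le> real n ^ 2"
proof -
  have "card (edges n) \<le> card ({1..n} \<times> {1..n})"
    by (rule card_mono) (auto simp: edges_def)
  then have "real (card (edges n)) \<le> real (n * n)" by (intro of_nat_mono) simp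
  then show ?thesis by (simp add: power2_eq_square)
qed

lemma finite_adjacent_edges: "finite (adjacent_edges n)"
  by (rule finite_subset[of _ "edges n \<times> edges n"])
    (auto simp: adjacent_edges_def finite_edges)

definition ends :: "nat \<times> nat \<Rightarrow> nat set" where "ends e = {fst e, snd e}"

lemma edges_at_vertex: "real (card {e\<in>edges n. m \<in> ends e}) \<le> 2 * real n"
proof -
  have "{e\<in>edges n. m \<in> ends e} \<subseteq> Pair m ` {1..n} \<union> (\<lambda>i. (i, m)) ` {1..n}"
    by (auto simp: edges_def ends_def)
  then have "card {e\<in>edges n. m \<in> ends e} \<le> card (Pair m ` {1..n} \<union> (\<lambda>i. (i, m)) ` {1..n})"
    by (intro card_mono) auto
  also have "\<dots> \<le> card (Pair m ` {1..n}) + card ((\<lambda>i. (i, m)) ` {1..n})" by (rule card_Un_le)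
  also have "\<dots> \<le> n + n" by (intro add_mono order.trans[OF card_image_le]) auto
  finally show ?thesis by linarith
qed

text \<open>
A pair of adjacent edges is determined by a triple of vertices and by one of four patterns, and at
most \<open>3 n\<^sup>2\<close> triples contain \<open>m\<close>.
\<close>

lemma adjacent_at_vertex:
  assumes "m \<in> {1..n}"
  shows "real (card {p\<in>adjacent_edges n. m \<in> ends (fst p) \<union> ends (snd p)}) \<le> 12 * real n ^ 2"
proof -
  let ?V = "{1..n} :: nat set"
  let ?T = "(\<lambda>(a, b). (m, a, b)) ` (?V \<times> ?V) \<union> (\<lambda>(a, b). (a, m, b)) ` (?V \<times> ?V)
     \<union> (\<lambda>(a, b). (a, b, m)) ` (?V \<times> ?V)"
  let ?g = "[\<lambda>(i, j, k). ((i, j), (i, k)), \<lambda>(i, j, k). ((i, j), (k, i)),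
     \<lambda>(i, j, k). ((j, i), (i, k)), \<lambda>(i, j, k). ((j, i), (k, i))]
     :: (nat \<times> nat \<times> nat \<Rightarrow> (nat \<times> nat) \<times> (nat \<times> nat)) list"
  have cV: "card (h ` (?V \<times> ?V)) \<le> n ^ 2" for h :: "nat \<times> nat \<Rightarrow> nat \<times> nat \<times> nat"
    by (rule order.trans[OF card_image_le]) (auto simp: power2_eq_square)
  have finT: "finite ?T" by auto
  have cT: "card ?T \<le> 3 * n ^ 2"
    using cV[of "\<lambda>(a, b). (m, a, b)"] cV[of "\<lambda>(a, b). (a, m, b)"] cV[of "\<lambda>(a, b). (a, b, m)"]
      card_Un_le[of "(\<lambda>(a, b). (m, a, b)) ` (?V \<times> ?V)" "(\<lambda>(a, b). (a, m, b)) ` (?V \<times> ?V)"]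
      card_Un_le[of "(\<lambda>(a, b). (m, a, b)) ` (?V \<times> ?V) \<union> (\<lambda>(a, b). (a, m, b)) ` (?V \<times> ?V)"
         "(\<lambda>(a, b). (a, b, m)) ` (?V \<times> ?V)"]
    by linarith
  have inT: "(i, j, k) \<in> ?T" if "i \<in> ?V" "j \<in> ?V" "k \<in> ?V" "m = i \<or> m = j \<or> m = k" for i j k
    using that by (auto simp: image_iff)
  have sub: "{p\<in>adjacent_edges n. m \<in> ends (fst p) \<union> ends (snd p)} \<subseteq> (\<Union>g\<in>set ?g. g ` ?T)"
  proof
    fix p assume p: "p \<in> {p\<in>adjacent_edges n. m \<in> ends (fst p) \<union> ends (snd p)}"
    obtain i j k l where eq: "p = ((i, j), (k, l))" by (metis surj_pair)
    have V: "i \<in> ?V" "j \<in> ?V" "k \<in> ?V" "l \<in> ?V" and c: "card ({i, j} \<inter> {k, l}) = 1"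
      and m: "m = i \<or> m = j \<or> m = k \<or> m = l"
      using p unfolding eq by (auto simp: adjacent_edges_def edges_def ends_def)
    have "{i, j} \<inter> {k, l} \<noteq> {}" using c by (metis card.empty zero_neq_one)
    then have "i = k \<or> i = l \<or> j = k \<or> j = l" by auto
    have gI: "p \<in> (\<Union>g\<in>set ?g. g ` ?T)" if "g \<in> set ?g" "t \<in> ?T" "p = g t" for g t
      using that by blast
    from \<open>i = k \<or> i = l \<or> j = k \<or> j = l\<close>
    show "p \<in> (\<Union>g\<in>set ?g. g ` ?T)"
    proof (elim disjE)
      assume *: "i = k"
      show ?thesis
        by (rule gI[of "\<lambda>(i, j, k). ((i, j), (i, k))", OF _ inT[OF V(1,2,4)]]) (use m eq * in auto)
    next
      assume *: "i = l"
      show ?thesis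
        by (rule gI[of "\<lambda>(i, j, k). ((i, j), (k, i))", OF _ inT[OF V(1,2,3)]]) (use m eq * in auto)
    next
      assume *: "j = k"
      show ?thesis
        by (rule gI[of "\<lambda>(i, j, k). ((j, i), (i, k))", OF _ inT[OF V(2,1,4)]]) (use m eq * in auto)
    next
      assume *: "j = l"
      show ?thesis
        by (rule gI[of "\<lambda>(i, j, k). ((j, i), (k, i))", OF _ inT[OF V(2,1,3)]]) (use m eq * in auto)
    qed
  qed
  have "card {p\<in>adjacent_edges n. m \<in> ends (fst p) \<union> ends (snd p)} \<le> card (\<Union>g\<in>set ?g. g ` ?T)"
    by (rule card_mono[OF _ sub]) (use finT in blast)
  also have "\<dots> \<le> (\<Sum>g\<in>set ?g. card (g ` ?T))" by (rule card_UN_le) blast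
  also have "\<dots> \<le> (\<Sum>g\<in>set ?g. 3 * n ^ 2)"
    by (intro sum_mono order.trans[OF card_image_le cT] finT)
  also have "\<dots> = card (set ?g) * (3 * n ^ 2)" by simp
  also have "\<dots> \<le> 4 * (3 * n ^ 2)"
    by (intro mult_right_mono order.trans[OF card_length]) auto
  finally show ?thesis by (simp add: of_nat_le_iff[where 'a=real, symmetric] del: of_nat_le_iff)
qed

locale perm_gibbs =
  fixes f :: "real \<times> real \<Rightarrow> real ^ 'l" and \<theta> :: "real ^ 'l" and B :: real
  assumes bound: "p \<in> unit_square \<Longrightarrow> norm (f p) \<le> B"
begin

lemma B_nonneg: "0 \<le> B"
  using bound[of "(0, 0)"] norm_ge_zero[of "f (0, 0)"] by (simp del: norm_ge_zero)

definition prob :: "nat \<Rightarrow> (nat \<Rightarrow> nat) \<Rightarrow> real" where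
  "prob n \<pi> = exp (\<theta> \<bullet> suff_stat f n \<pi> - log_partition f n \<theta>)"

definition E :: "nat \<Rightarrow> ((nat \<Rightarrow> nat) \<Rightarrow> 'b::real_normed_vector) \<Rightarrow> 'b" where
  "E n F = (\<Sum>\<pi>\<in>perms n. prob n \<pi> *\<^sub>R F \<pi>)"

text \<open>
Off the grid the weight is set to \<open>1\<close>, which lies between the required bounds.
\<close>

definition weight :: "nat \<Rightarrow> nat \<Rightarrow> nat \<Rightarrow> real" where
  "weight n i j = (if i \<in> {1..n} \<and> j \<in> {1..n} then exp (\<theta> \<bullet> f (real i / real n, real j / real n)) else 1)"

definition K :: real where "K = exp (norm \<theta> * B)"

lemma grid: "i \<in> {1..n} \<Longrightarrow> j \<in> {1..n} \<Longrightarrow> (real i / real n, real j / real n) \<in> unit_square"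
  by auto

lemma weights: "bounded_weights K (weight n)"
proof -
  have *: "\<bar>\<theta> \<bullet> f (real i / real n, real j / real n)\<bar> \<le> norm \<theta> * B" if "i \<in> {1..n}" "j \<in> {1..n}" for i j
    using Cauchy_Schwarz_ineq2[of \<theta> "f (real i / real n, real j / real n)"]
      mult_left_mono[OF bound[OF grid[OF that]], of "norm \<theta>"] by simp
  have "exp (- (norm \<theta> * B)) \<le> weight n i j \<and> weight n i j \<le> K" for i j
    using *[of i j] B_nonneg by (auto simp: weight_def K_def abs_le_iff)
  then show ?thesis
    using B_nonneg by (auto simp: bounded_weights_def K_def exp_minus inverse_eq_divide)
qed

lemma weight_prod:
  assumes "\<pi> \<in> perms n"
  shows "(\<Prod>(i, j)\<in>graph_on n \<pi>. weight n i j) = exp (\<theta> \<bullet> suff_stat f n \<pi>)"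
proof -
  have inj: "inj_on (\<lambda>i. (i, \<pi> i)) {1..n}" by (auto simp: inj_on_def)
  have "(\<Prod>(i, j)\<in>graph_on n \<pi>. weight n i j) = (\<Prod>i\<in>{1..n}. weight n i (\<pi> i))"
    unfolding graph_on_def prod.reindex[OF inj] by simp
  also have "\<dots> = (\<Prod>i\<in>{1..n}. exp (\<theta> \<bullet> f (real i / real n, real (\<pi> i) / real n)))"
    by (intro prod.cong refl) (use permsD[OF assms] in \<open>simp add: weight_def\<close>)
  finally show ?thesis by (simp add: suff_stat_def inner_sum_right exp_sum)
qed

lemma E_eq_gibbs_mean:
  "E n F = gibbs_mean (weight n) {1..n} {1..n} (\<lambda>M. F (inv_into (perms n) (graph_on n) M))"
proof -
  have inj: "inj_on (graph_on n) (perms n)" and im: "matchings {1..n} {1..n} = graph_on n ` perms n"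
    using bij_betw_graph_on[of n] by (auto simp: bij_betw_def)
  have *: "gibbs_sum (weight n) {1..n} {1..n} (\<lambda>M. G (inv_into (perms n) (graph_on n) M))
     = (\<Sum>\<pi>\<in>perms n. exp (\<theta> \<bullet> suff_stat f n \<pi>) * G \<pi>)" for G
    unfolding gibbs_sum_def im sum.reindex[OF inj]
    by (intro sum.cong refl) (simp add: weight_prod inv_into_f_f[OF inj])
  have Z: "(\<Sum>\<pi>\<in>perms n. exp (\<theta> \<bullet> suff_stat f n \<pi>)) > 0"
    using finite_perms id_in_perms by (intro sum_pos) auto
  show ?thesis
    unfolding gibbs_mean_def *[of F] *[of "\<lambda>_. 1"]
    using Z by (simp add: E_def prob_def exp_diff log_partition_def sum_divide_distrib)
qed

lemma prob_pos: "prob n \<pi> > 0" by (simp add: prob_def)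

lemma E_const: "E n (\<lambda>_. c) = c"
proof -
  have "sum (prob n) (perms n) = 1"
    using gibbs_mean_1[OF weights, of "{1..n}" "{1..n}" n] E_eq_gibbs_mean[of n "\<lambda>_. 1"]
    by (simp add: E_def)
  then show ?thesis by (simp add: E_def flip: scaleR_left.sum)
qed

lemma E_add: "E n (\<lambda>\<pi>. F \<pi> + G \<pi>) = E n F + E n G"
  by (simp add: E_def scaleR_add_right sum.distrib)

lemma E_diff: "E n (\<lambda>\<pi>. F \<pi> - G \<pi>) = E n F - E n G"
  by (simp add: E_def scaleR_diff_right sum_subtractf)

lemma E_sum: "E n (\<lambda>\<pi>. \<Sum>i\<in>I. F i \<pi>) = (\<Sum>i\<in>I. E n (F i))"
  unfolding E_def scaleR_sum_right by (rule sum.swap)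

lemma E_cmult: "E n (\<lambda>\<pi>. c * F \<pi>) = c * E n F" for F :: "_ \<Rightarrow> 'b::real_normed_algebra"
  by (simp add: E_def sum_distrib_left)

lemma E_scaleR: "E n (\<lambda>\<pi>. c *\<^sub>R F \<pi>) = c *\<^sub>R E n F"
  by (simp add: E_def scaleR_sum_right mult.commute)

lemma E_mono: "(\<And>\<pi>. \<pi> \<in> perms n \<Longrightarrow> F \<pi> \<le> G \<pi>) \<Longrightarrow> E n F \<le> (E n G :: real)"
  unfolding E_def real_scaleR_def
  by (intro sum_mono mult_left_mono less_imp_le[OF prob_pos])

lemma E_cong: "(\<And>\<pi>. \<pi> \<in> perms n \<Longrightarrow> F \<pi> = G \<pi>) \<Longrightarrow> E n F = E n G"
  by (simp add: E_def)

lemma norm_E_le: "norm (E n F) \<le> E n (\<lambda>\<pi>. norm (F \<pi>))"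
  unfolding E_def
  by (rule order.trans[OF norm_sum]) (simp add: abs_of_pos[OF prob_pos])

lemma E_variance_eq:
  fixes F :: "_ \<Rightarrow> real"
  shows "E n (\<lambda>\<pi>. (F \<pi> - E n F)\<^sup>2) = E n (\<lambda>\<pi>. (F \<pi>)\<^sup>2) - (E n F)\<^sup>2"
proof -
  have "E n (\<lambda>\<pi>. (F \<pi> - E n F)\<^sup>2)
     = E n (\<lambda>\<pi>. (F \<pi>)\<^sup>2 - 2 * E n F * F \<pi> + (E n F)\<^sup>2)"
    by (rule E_cong) (simp add: power2_diff)
  also have "\<dots> = E n (\<lambda>\<pi>. (F \<pi>)\<^sup>2) - 2 * E n F * E n F + (E n F)\<^sup>2"
    by (simp add: E_add E_diff E_cmult E_const)
  finally show ?thesis by (simp add: power2_eq_square)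
qed

text \<open>
The transfer of \<open>gibbs_variance\<close> to permutations, identified with matchings through
their graphs.
\<close>

lemma E_variance:
  assumes "hamming_lipschitz n L F"
  shows "E n (\<lambda>\<pi>. (F \<pi> - E n F)\<^sup>2) \<le> real n * (L * (1 + K ^ 4))\<^sup>2"
proof -
  let ?\<iota> = "inv_into (perms n) (graph_on n)"
  have inj: "inj_on (graph_on n) (perms n)" and im: "matchings {1..n} {1..n} = graph_on n ` perms n"
    using bij_betw_graph_on[of n] by (auto simp: bij_betw_def)
  have "gibbs_mean (weight n) {1..n} {1..n} (\<lambda>M. (F (?\<iota> M))\<^sup>2)
      - (gibbs_mean (weight n) {1..n} {1..n} (\<lambda>M. F (?\<iota> M)))\<^sup>2
      \<le> real (card {1..n}) * (L * (1 + K ^ 4))\<^sup>2"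
  proof (rule gibbs_variance[OF weights])
    fix M M' assume "M \<in> matchings {1..n} {1..n}" "M' \<in> matchings {1..n} {1..n}"
    then obtain \<pi> \<sigma> where *: "\<pi> \<in> perms n" "M = graph_on n \<pi>" "\<sigma> \<in> perms n" "M' = graph_on n \<sigma>"
      unfolding im by auto
    then show "F (?\<iota> M) - F (?\<iota> M') \<le> L * real (card (M - M'))"
      using assms unfolding hamming_lipschitz_def hamming_def by (simp add: inv_into_f_f[OF inj] card_graph_diff)
  qed (use assms in \<open>auto simp: hamming_lipschitz_def\<close>)
  then show ?thesis
    unfolding E_variance_eq unfolding E_eq_gibbs_mean by simp
qed

text \<open>
The joint law of two values \<open>\<pi> i\<close> and \<open>\<pi> j\<close> dominates a multiple
of the uniform law on distinct pairs. This follows from two applications of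
\<open>gibbs_marginal_lower\<close>.
\<close>

lemma E_pair_lower:
  assumes ij: "i \<in> {1..n}" "j \<in> {1..n}" "i \<noteq> j" and \<phi>: "\<And>a b. 0 \<le> \<phi> a b"
  shows "(\<Sum>a\<in>{1..n}. \<Sum>b\<in>{1..n} - {a}. \<phi> a b) / (K ^ 8 * real n ^ 2) \<le> E n (\<lambda>\<pi>. \<phi> (\<pi> i) (\<pi> j))"
proof -
  let ?V = "{1..n}" and ?w = "weight n"
  let ?\<iota> = "inv_into (perms n) (graph_on n)"
  define \<Phi> where "\<Phi> M = (\<Sum>a\<in>?V. \<Sum>b\<in>?V. if (i, a) \<in> M \<and> (j, b) \<in> M then \<phi> a b else 0)"
    for M :: "(nat \<times> nat) set"
  have inj: "inj_on (graph_on n) (perms n)" and im: "matchings {1..n} {1..n} = graph_on n ` perms n"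
    using bij_betw_graph_on[of n] by (auto simp: bij_betw_def)
  note bw = weights[of n]
  have K0: "K > 0" by (simp add: K_def)
  have n0: "n > 0" using ij by auto
  have \<Phi>: "\<Phi> (graph_on n \<pi>) = \<phi> (\<pi> i) (\<pi> j)" if "\<pi> \<in> perms n" for \<pi>
  proof -
    have "\<Phi> (graph_on n \<pi>) = (\<Sum>a\<in>?V. \<Sum>b\<in>?V. if a = \<pi> i then if b = \<pi> j then \<phi> a b else 0 else 0)"
      unfolding \<Phi>_def by (intro sum.cong refl) (use ij in \<open>auto simp: graph_on_def\<close>)
    also have "\<dots> = (\<Sum>a\<in>?V. if a = \<pi> i then (\<Sum>b\<in>?V. if b = \<pi> j then \<phi> a b else 0) else 0)"
      by (intro sum.cong refl) auto
    finally show ?thesis using permsD[OF that ij(1)] permsD[OF that ij(2)] by simp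
  qed
  have \<Phi>0: "\<Phi> M \<ge> 0" for M unfolding \<Phi>_def by (intro sum_nonneg) (simp add: \<phi>)
  have Zp: "gibbs_Z ?w ?V ?V > 0" by (rule gibbs_Z_pos[OF bw]) auto
  have E: "E n (\<lambda>\<pi>. \<phi> (\<pi> i) (\<pi> j)) = gibbs_sum ?w ?V ?V \<Phi> / gibbs_Z ?w ?V ?V"
  proof -
    have "gibbs_sum ?w ?V ?V (\<lambda>M. \<phi> (?\<iota> M i) (?\<iota> M j)) = gibbs_sum ?w ?V ?V \<Phi>"
      unfolding gibbs_sum_def im
      by (intro sum.cong refl arg_cong2[where f="(*)"]) (use \<Phi> inv_into_f_f[OF inj] in force)
    then show ?thesis unfolding E_eq_gibbs_mean gibbs_mean_def by simp
  qed
  have "(\<Sum>a\<in>?V. \<Sum>b\<in>?V - {a}. \<phi> a b) * (1 / (K ^ 8 * real n ^ 2) * gibbs_Z ?w ?V ?V)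
     = (\<Sum>a\<in>?V. \<Sum>b\<in>?V - {a}. 1 / (K ^ 8 * real n ^ 2) * gibbs_Z ?w ?V ?V * \<phi> a b)"
    by (simp add: sum_distrib_right sum_distrib_left sum_divide_distrib mult.commute mult.left_commute)
  also have "\<dots> \<le> (\<Sum>a\<in>?V. \<Sum>b\<in>?V - {a}. ?w i a * (?w j b * gibbs_Z ?w (?V - {i} - {j}) (?V - {a} - {b})) * \<phi> a b)"
  proof (intro sum_mono mult_right_mono \<phi>)
    fix a b assume a: "a \<in> ?V" and b: "b \<in> ?V - {a}"
    have Z1: "gibbs_Z ?w (?V - {i}) (?V - {a}) > 0" by (rule gibbs_Z_pos[OF bw]) (use ij a in auto)
    have "1 / (K ^ 4 * real (card ?V)) * gibbs_Z ?w ?V ?V \<le> ?w i a * gibbs_Z ?w (?V - {i}) (?V - {a})"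
      by (rule gibbs_marginal_lower[OF bw]) (use ij a in auto)
    moreover have "1 / (K ^ 4 * real (card (?V - {i}))) * gibbs_Z ?w (?V - {i}) (?V - {a})
        \<le> ?w j b * gibbs_Z ?w (?V - {i} - {j}) (?V - {a} - {b})"
      by (rule gibbs_marginal_lower[OF bw]) (use ij a b in auto)
    moreover have "1 / (K ^ 4 * real n) \<le> 1 / (K ^ 4 * real (card (?V - {i})))"
    proof (rule divide_left_mono)
      have "card (?V - {i}) > 0" using ij by (auto simp: card_gt_0_iff)
      then show "0 < K ^ 4 * real n * (K ^ 4 * real (card (?V - {i})))" using K0 n0
        by (intro mult_pos_pos) auto
      show "K ^ 4 * real (card (?V - {i})) \<le> K ^ 4 * real n"
        using K0 ij by (intro mult_left_mono of_nat_mono) auto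
    qed simp
    ultimately have s1: "1 / (K ^ 4 * real n) * gibbs_Z ?w ?V ?V \<le> ?w i a * gibbs_Z ?w (?V - {i}) (?V - {a})"
      and s2: "1 / (K ^ 4 * real n) * gibbs_Z ?w (?V - {i}) (?V - {a})
        \<le> ?w j b * gibbs_Z ?w (?V - {i} - {j}) (?V - {a} - {b})"
      using mult_right_mono[of "1 / (K ^ 4 * real n)" _ "gibbs_Z ?w (?V - {i}) (?V - {a})"] Z1
      by (force, smt (verit))
    have "1 / (K ^ 8 * real n ^ 2) * gibbs_Z ?w ?V ?V
      = 1 / (K ^ 4 * real n) * (1 / (K ^ 4 * real n) * gibbs_Z ?w ?V ?V)"
      by (simp add: power2_eq_square flip: power_add)
    also have "\<dots> \<le> 1 / (K ^ 4 * real n) * (?w i a * gibbs_Z ?w (?V - {i}) (?V - {a}))"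
      using K0 by (intro mult_left_mono s1) auto
    also have "\<dots> = ?w i a * (1 / (K ^ 4 * real n) * gibbs_Z ?w (?V - {i}) (?V - {a}))" by simp
    also have "\<dots> \<le> ?w i a * (?w j b * gibbs_Z ?w (?V - {i} - {j}) (?V - {a} - {b}))"
      using bounded_weightsD(3)[OF bw, of i a] by (intro mult_left_mono s2) auto
    finally show "1 / (K ^ 8 * real n ^ 2) * gibbs_Z ?w ?V ?V \<le> \<dots>" .
  qed
  also have "\<dots> \<le> (\<Sum>a\<in>?V. ?w i a * (\<Sum>b\<in>?V - {a}. ?w j b *
     gibbs_sum ?w (?V - {i} - {j}) (?V - {a} - {b}) (\<lambda>N. \<Phi> (insert (i, a) (insert (j, b) N)))))"
    unfolding sum_distrib_left
  proof (intro sum_mono)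
    fix a b assume a: "a \<in> ?V" and b: "b \<in> ?V - {a}"
    let ?g = "\<lambda>F. gibbs_sum ?w (?V - {i} - {j}) (?V - {a} - {b}) F"
    have "?g (\<lambda>_. 1) * \<phi> a b = ?g (\<lambda>_. \<phi> a b)" by (simp add: gibbs_sum_def sum_distrib_right)
    also have "\<dots> \<le> ?g (\<lambda>N. \<Phi> (insert (i, a) (insert (j, b) N)))"
    proof (rule gibbs_sum_mono[OF bw])
      fix N
      let ?M = "insert (i, a) (insert (j, b) N)"
      have "\<phi> a b = (if (i, a) \<in> ?M \<and> (j, b) \<in> ?M then \<phi> a b else 0)" by simp
      also have "\<dots> \<le> (\<Sum>b\<in>?V. if (i, a) \<in> ?M \<and> (j, b) \<in> ?M then \<phi> a b else 0)"
        using b \<phi> by (intro member_le_sum[of b ?V "\<lambda>b. if (i, a) \<in> ?M \<and> (j, b) \<in> ?M then \<phi> a b else 0"]) auto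
      also have "\<dots> \<le> \<Phi> ?M"
        unfolding \<Phi>_def using a \<phi>
        by (intro member_le_sum[of a ?V "\<lambda>a. \<Sum>b\<in>?V. if (i, a) \<in> ?M \<and> (j, b) \<in> ?M then \<phi> a b else 0"])
          (auto intro!: sum_nonneg)
      finally show "\<phi> a b \<le> \<Phi> ?M" .
    qed
    finally have "?g (\<lambda>_. 1) * \<phi> a b \<le> ?g (\<lambda>N. \<Phi> (insert (i, a) (insert (j, b) N)))" .
    then have "?w i a * ?w j b * (?g (\<lambda>_. 1) * \<phi> a b)
       \<le> ?w i a * ?w j b * ?g (\<lambda>N. \<Phi> (insert (i, a) (insert (j, b) N)))"
      by (rule mult_left_mono)
        (use bounded_weightsD(3)[OF bw, of i a] bounded_weightsD(3)[OF bw, of j b] in simp)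
    then show "?w i a * (?w j b * ?g (\<lambda>_. 1)) * \<phi> a b
       \<le> ?w i a * (?w j b * ?g (\<lambda>N. \<Phi> (insert (i, a) (insert (j, b) N))))"
      by (simp add: mult.assoc)
  qed
  also have "\<dots> = (\<Sum>a\<in>?V. ?w i a * gibbs_sum ?w (?V - {i}) (?V - {a}) (\<lambda>N. \<Phi> (insert (i, a) N)))"
  proof (intro sum.cong refl arg_cong2[where f="(*)"])
    fix a assume "a \<in> ?V"
    show "(\<Sum>b\<in>?V - {a}. ?w j b *
     gibbs_sum ?w (?V - {i} - {j}) (?V - {a} - {b}) (\<lambda>N. \<Phi> (insert (i, a) (insert (j, b) N))))
     = gibbs_sum ?w (?V - {i}) (?V - {a}) (\<lambda>N. \<Phi> (insert (i, a) N))"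
      by (rule gibbs_sum_expand_row[symmetric]) (use ij in auto)
  qed
  also have "\<dots> = gibbs_sum ?w ?V ?V \<Phi>"
    by (rule gibbs_sum_expand_row[symmetric]) (use ij in auto)
  finally have "(\<Sum>a\<in>?V. \<Sum>b\<in>?V - {a}. \<phi> a b) / (K ^ 8 * real n ^ 2) * gibbs_Z ?w ?V ?V
     \<le> gibbs_sum ?w ?V ?V \<Phi>" by simp
  then show ?thesis unfolding E using Zp by (simp add: pos_le_divide_eq)
qed

abbreviation y :: "nat \<Rightarrow> (nat \<Rightarrow> nat) \<Rightarrow> nat \<times> nat \<Rightarrow> real ^ 'l" where
  "y \<equiv> y_diff f"

definition \<sigma> :: "real \<Rightarrow> real" where "\<sigma> x = 1 / (1 + exp x)"

lemma \<sigma>_bounds: "0 < \<sigma> x" "\<sigma> x < 1"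
  by (auto simp: \<sigma>_def add_pos_pos)

lemma norm_y_le:
  assumes "\<pi> \<in> perms n" "e \<in> edges n"
  shows "norm (y n \<pi> e) \<le> 4 * B"
proof -
  obtain i j where e: "e = (i, j)" by (cases e)
  have ij: "i \<in> {1..n}" "j \<in> {1..n}" using assms(2) e by (auto simp: edges_def)
  note V = ij permsD[OF assms(1) ij(1)] permsD[OF assms(1) ij(2)]
  have *: "norm (a + b - c - d) \<le> norm a + norm b + norm c + norm d" for a b c d :: "real ^ 'l"
    by (smt (verit) norm_triangle_ineq norm_triangle_ineq4)
  show ?thesis
    unfolding e y_diff_def prod.case
    by (rule order.trans[OF *])
      (use bound[OF grid[OF V(1,3)]] bound[OF grid[OF V(2,4)]] bound[OF grid[OF V(1,4)]]
        bound[OF grid[OF V(2,3)]] in linarith)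
qed

text \<open>
This is where \<open>y\<close> comes from: it is the change of the sufficient statistic under a
transposition.
\<close>

lemma suff_stat_swap:
  assumes "i \<in> {1..n}" "j \<in> {1..n}" "i \<noteq> j"
  shows "suff_stat f n (\<pi> \<circ> Transposition.transpose i j) = suff_stat f n \<pi> - y n \<pi> (i, j)"
proof -
  let ?F = "\<lambda>\<pi> k. f (real k / real n, real (\<pi> k) / real n)"
  have split: "suff_stat f n \<rho> = ?F \<rho> i + (?F \<rho> j + sum (?F \<rho>) ({1..n} - {i} - {j}))" for \<rho>
    unfolding suff_stat_def using assms by (simp add: sum.remove[of _ i] sum.remove[of _ j])
  have "sum (?F (\<pi> \<circ> Transposition.transpose i j)) ({1..n} - {i} - {j}) = sum (?F \<pi>) ({1..n} - {i} - {j})"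
    by (intro sum.cong refl) (auto simp: Transposition.transpose_def)
  then show ?thesis
    unfolding split[of "\<pi> \<circ> Transposition.transpose i j"] split[of \<pi>] by (simp add: y_diff_def)
qed

lemma y_swap: "y n (\<pi> \<circ> Transposition.transpose i j) (i, j) = - y n \<pi> (i, j)"
  by (simp add: y_diff_def)

lemma E_swap:
  assumes "i \<in> {1..n}" "j \<in> {1..n}" "i \<noteq> j"
  shows "E n (\<lambda>\<pi>. F (\<pi> \<circ> Transposition.transpose i j)) = E n (\<lambda>\<pi>. exp (- (\<theta> \<bullet> y n \<pi> (i, j))) *\<^sub>R F \<pi>)"
proof -
  have "E n (\<lambda>\<pi>. F (\<pi> \<circ> Transposition.transpose i j))
     = (\<Sum>\<pi>\<in>perms n. prob n (\<pi> \<circ> Transposition.transpose i j) *\<^sub>R F \<pi>)"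
    unfolding E_def
    by (rule sum.reindex_bij_witness[of _ "\<lambda>\<pi>. \<pi> \<circ> Transposition.transpose i j" "\<lambda>\<pi>. \<pi> \<circ> Transposition.transpose i j"])
      (use assms in \<open>auto simp: comp_assoc perms_swap transpose_comp_involutory\<close>)
  also have "\<dots> = E n (\<lambda>\<pi>. exp (- (\<theta> \<bullet> y n \<pi> (i, j))) *\<^sub>R F \<pi>)"
    unfolding E_def
  proof (intro sum.cong refl)
    fix \<pi>
    show "prob n (\<pi> \<circ> Transposition.transpose i j) *\<^sub>R F \<pi> = prob n \<pi> *\<^sub>R exp (- (\<theta> \<bullet> y n \<pi> (i, j))) *\<^sub>R F \<pi>"
      unfolding prob_def suff_stat_swap[OF assms]
      by (simp add: inner_diff_right algebra_simps flip: exp_add)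
  qed
  finally show ?thesis .
qed

text \<open>
The contribution of the pair \<open>e\<close> to the score at the true parameter, in the direction
\<open>v\<close>.
\<close>

definition h :: "nat \<Rightarrow> real ^ 'l \<Rightarrow> (nat \<Rightarrow> nat) \<Rightarrow> nat \<times> nat \<Rightarrow> real" where
  "h n v \<pi> e = (v \<bullet> y n \<pi> e) * \<sigma> (\<theta> \<bullet> y n \<pi> e)"

abbreviation swap :: "nat \<times> nat \<Rightarrow> (nat \<Rightarrow> nat) \<Rightarrow> nat \<Rightarrow> nat" where
  "swap e \<pi> \<equiv> \<pi> \<circ> Transposition.transpose (fst e) (snd e)"

text \<open>
Reindexing the expectation by the swap of \<open>e\<close> costs the density factor \<open>exp (-
x)\<close> with \<open>x = \<theta> \<bullet> y n \<pi> e\<close>, and \<open>exp (- x) * \<sigma>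
(- x) = \<sigma> x\<close>, while \<open>v \<bullet> y n \<pi> e\<close> changes sign. So the
expectation of \<open>h n v \<pi> e\<close> against \<open>\<phi> \<circ> swap e\<close> is minus
the one against \<open>\<phi>\<close>.
\<close>

lemma stein_identity:
  assumes "e \<in> edges n"
  shows "E n (\<lambda>\<pi>. h n v \<pi> e *\<^sub>R \<phi> \<pi>) = (1 / 2) *\<^sub>R E n (\<lambda>\<pi>. h n v \<pi> e *\<^sub>R (\<phi> \<pi> - \<phi> (swap e \<pi>)))"
proof -
  obtain i j where e: "e = (i, j)" by (cases e)
  have ij: "i \<in> {1..n}" "j \<in> {1..n}" "i \<noteq> j" using assms e by (auto simp: edges_def)
  have *: "exp (- x) * \<sigma> (- x) = \<sigma> x" for x
    by (simp add: \<sigma>_def exp_minus field_simps add_pos_pos)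
  have "E n (\<lambda>\<pi>. h n v \<pi> e *\<^sub>R \<phi> (swap e \<pi>))
    = E n (\<lambda>\<pi>. h n v (swap e (swap e \<pi>)) e *\<^sub>R \<phi> (swap e \<pi>))"
    by (simp add: comp_assoc transpose_comp_involutory)
  also have "\<dots> = E n (\<lambda>\<pi>. exp (- (\<theta> \<bullet> y n \<pi> e)) *\<^sub>R (h n v (swap e \<pi>) e *\<^sub>R \<phi> \<pi>))"
    using E_swap[OF ij, of "\<lambda>\<pi>. h n v (swap e \<pi>) e *\<^sub>R \<phi> \<pi>"] by (simp add: e)
  also have "\<dots> = E n (\<lambda>\<pi>. - (h n v \<pi> e *\<^sub>R \<phi> \<pi>))"
  proof (rule E_cong)
    fix \<pi>
    have "exp (- (\<theta> \<bullet> y n \<pi> e)) * h n v (swap e \<pi>) e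
      = - ((v \<bullet> y n \<pi> e) * (exp (- (\<theta> \<bullet> y n \<pi> e)) * \<sigma> (- (\<theta> \<bullet> y n \<pi> e))))"
      by (simp add: e h_def y_swap)
    also have "\<dots> = - h n v \<pi> e" unfolding * by (simp add: h_def)
    finally show "exp (- (\<theta> \<bullet> y n \<pi> e)) *\<^sub>R (h n v (swap e \<pi>) e *\<^sub>R \<phi> \<pi>) = - (h n v \<pi> e *\<^sub>R \<phi> \<pi>)"
      by simp
  qed
  also have "\<dots> = - E n (\<lambda>\<pi>. h n v \<pi> e *\<^sub>R \<phi> \<pi>)" by (simp add: E_def sum_negf)
  finally have "E n (\<lambda>\<pi>. h n v \<pi> e *\<^sub>R \<phi> (swap e \<pi>)) = - E n (\<lambda>\<pi>. h n v \<pi> e *\<^sub>R \<phi> \<pi>)" .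
  then show ?thesis
    by (simp add: scaleR_diff_right E_diff flip: scaleR_2)
qed

lemma abs_h_le:
  assumes "\<pi> \<in> perms n" "e \<in> edges n"
  shows "\<bar>h n v \<pi> e\<bar> \<le> norm v * (4 * B)"
proof -
  have "\<bar>v \<bullet> y n \<pi> e\<bar> \<le> norm v * (4 * B)"
    using Cauchy_Schwarz_ineq2[of v "y n \<pi> e"] mult_left_mono[OF norm_y_le[OF assms], of "norm v"] by simp
  then have "\<bar>v \<bullet> y n \<pi> e\<bar> * \<bar>\<sigma> (\<theta> \<bullet> y n \<pi> e)\<bar> \<le> norm v * (4 * B) * 1"
    using \<sigma>_bounds[of "\<theta> \<bullet> y n \<pi> e"] B_nonneg by (intro mult_mono) auto
  then show ?thesis by (simp add: h_def abs_mult)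
qed

lemma y_local:
  fixes \<pi> \<rho> :: "nat \<Rightarrow> nat"
  shows "(\<And>m. m \<in> ends e \<Longrightarrow> \<pi> m = \<rho> m) \<Longrightarrow> y n \<pi> e = y n \<rho> e"
  by (cases e) (simp add: y_diff_def ends_def)

lemma edge_sum_lipschitz:
  assumes "0 \<le> D" "\<And>\<pi> e. \<pi> \<in> perms n \<Longrightarrow> e \<in> edges n \<Longrightarrow> \<bar>G (y n \<pi> e)\<bar> \<le> D"
  shows "hamming_lipschitz n (4 * D * real n) (\<lambda>\<pi>. \<Sum>e\<in>edges n. G (y n \<pi> e))"
proof -
  have "hamming_lipschitz n (2 * D * (2 * real n)) (\<lambda>\<pi>. \<Sum>e\<in>edges n. G (y n \<pi> e))"
  proof (rule local_sum_lipschitz[where supp = ends])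
    fix \<pi> \<rho> :: "nat \<Rightarrow> nat" and e assume "\<And>m. m \<in> ends e \<Longrightarrow> \<pi> m = \<rho> m"
    then show "G (y n \<pi> e) = G (y n \<rho> e)" by (simp add: y_local[of e \<pi> \<rho>])
  qed (use assms edges_at_vertex finite_edges in \<open>auto simp: edges_def ends_def\<close>)
  then show ?thesis by (simp add: mult.assoc)
qed

lemma adjacent_sum_lipschitz:
  fixes G :: "(nat \<Rightarrow> nat) \<Rightarrow> nat \<times> nat \<Rightarrow> nat \<times> nat \<Rightarrow> real"
  assumes "0 \<le> D" "\<And>\<pi> e e'. \<pi> \<in> perms n \<Longrightarrow> e \<in> edges n \<Longrightarrow> e' \<in> edges n \<Longrightarrow> \<bar>G \<pi> e e'\<bar> \<le> D"
    and "\<And>\<pi> \<rho> e e'. (\<And>m. m \<in> ends e \<union> ends e' \<Longrightarrow> \<pi> m = \<rho> m) \<Longrightarrow> G \<pi> e e' = G \<rho> e e'"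
  shows "hamming_lipschitz n (24 * D * real n ^ 2) (\<lambda>\<pi>. \<Sum>(e, e')\<in>adjacent_edges n. G \<pi> e e')"
proof -
  have "hamming_lipschitz n (2 * D * (12 * real n ^ 2))
    (\<lambda>\<pi>. \<Sum>p\<in>adjacent_edges n. G \<pi> (fst p) (snd p))"
  proof (rule local_sum_lipschitz[where supp = "\<lambda>p. ends (fst p) \<union> ends (snd p)"])
    fix m assume "m \<in> {1..n}"
    then show "real (card {t \<in> adjacent_edges n. m \<in> ends (fst t) \<union> ends (snd t)}) \<le> 12 * (real n)\<^sup>2"
      by (rule adjacent_at_vertex)
  next
    fix \<pi> p assume "\<pi> \<in> perms n" "p \<in> adjacent_edges n"
    then show "\<bar>G \<pi> (fst p) (snd p)\<bar> \<le> D"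
      by (intro assms(2)) (auto simp: adjacent_edges_def)
  next
    fix p assume "p \<in> adjacent_edges n"
    then show "ends (fst p) \<union> ends (snd p) \<subseteq> {1..n}"
      by (auto simp: adjacent_edges_def edges_def ends_def)
  next
    fix \<pi> \<rho> :: "nat \<Rightarrow> nat" and p
    assume "\<And>m. m \<in> ends (fst p) \<union> ends (snd p) \<Longrightarrow> \<pi> m = \<rho> m"
    then show "G \<pi> (fst p) (snd p) = G \<rho> (fst p) (snd p)" by (rule assms(3))
  qed (use assms(1) finite_adjacent_edges in auto)
  then show ?thesis by (simp add: case_prod_unfold mult.assoc)
qed

end

section \<open>Nondegeneracy of the score\<close>

definition cross_diff :: "(real \<times> real \<Rightarrow> real ^ 'l) \<Rightarrow> real \<Rightarrow> real \<Rightarrow> real \<Rightarrow> real \<Rightarrow> real ^ 'l" where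
  "cross_diff f x x' z z' = f (x, z) + f (x', z') - f (x, z') - f (x', z)"

lemma norm_add_diff_diff_le:
  "norm (a + b - c - d) \<le> norm a + norm b + norm c + norm (d :: 'a :: real_normed_vector)"
  using norm_triangle_ineq4[of "a + b - c" d] norm_triangle_ineq4[of "a + b" c] norm_triangle_ineq[of a b]
  by linarith

lemma class_C_continuous:
  assumes "\<forall>r. (\<lambda>x. f x $ r) \<in> class_C"
  shows "continuous_on unit_square (f :: real \<times> real \<Rightarrow> real ^ 'l)"
proof -
  have "continuous_on unit_square (\<lambda>x. \<chi> r. f x $ r)"
    using assms by (intro continuous_on_vec_lambda) (auto simp: class_C_def)
  then show ?thesis by (simp add: vec_lambda_eta)
qed

text \<open>
If the second difference of \<open>F = v \<bullet> f\<close> vanished everywhere, then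
\<open>F\<close> would be a sum of a function of the first and a function of the second coordinate.
Integrating out one coordinate after the other, the vanishing marginals of the class
\<open>class_C\<close> would give \<open>F = 0\<close>, against linear independence.
\<close>

lemma cross_diff_nonzero:
  assumes C: "\<forall>r. (\<lambda>x. f x $ r) \<in> class_C" and li: "ae_lin_indep f" and v: "v \<noteq> 0"
  obtains x x' z z' where "x \<in> {0..1}" "x' \<in> {0..1}" "z \<in> {0..1}" "z' \<in> {0..1}"
    "v \<bullet> cross_diff f x x' z z' \<noteq> 0"
proof -
  let ?F = "\<lambda>p. v \<bullet> f p"
  have cont: "continuous_on unit_square (\<lambda>p. f p $ r)" for r
    using C by (auto simp: class_C_def)
  have contv: "continuous_on {0..1} (\<lambda>z. f (x, z) $ r)" "continuous_on {0..1} (\<lambda>z. f (z, x) $ r)"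
    if "x \<in> {0..1}" for x r
    by (rule continuous_on_compose2[OF cont]; use that in \<open>auto intro!: continuous_intros\<close>)+
  have m1: "((\<lambda>z. ?F (x, z)) has_integral 0) {0..1}" if x: "x \<in> {0..1}" for x
  proof -
    have "((\<lambda>z. \<Sum>r\<in>UNIV. v $ r * f (x, z) $ r) has_integral (\<Sum>r\<in>UNIV. v $ r * 0)) {0..1}"
    proof (intro has_integral_sum has_integral_mult_right)
      fix r
      have "integral {0..1} (\<lambda>z. f (x, z) $ r) = 0" using C x by (auto simp: class_C_def)
      then show "((\<lambda>z. f (x, z) $ r) has_integral 0) {0..1}"
        using integrable_integral[OF integrable_continuous_real[OF contv(1)[OF x, of r]]] by simp
    qed auto
    then show ?thesis by (simp add: inner_vec_def)
  qed
  have m2: "((\<lambda>z. ?F (z, x)) has_integral 0) {0..1}" if x: "x \<in> {0..1}" for x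
  proof -
    have "((\<lambda>z. \<Sum>r\<in>UNIV. v $ r * f (z, x) $ r) has_integral (\<Sum>r\<in>UNIV. v $ r * 0)) {0..1}"
    proof (intro has_integral_sum has_integral_mult_right)
      fix r
      have "integral {0..1} (\<lambda>z. f (z, x) $ r) = 0" using C x by (auto simp: class_C_def)
      then show "((\<lambda>z. f (z, x) $ r) has_integral 0) {0..1}"
        using integrable_integral[OF integrable_continuous_real[OF contv(2)[OF x, of r]]] by simp
    qed auto
    then show ?thesis by (simp add: inner_vec_def)
  qed
  have const: "((\<lambda>_. c) has_integral c) {0..1::real}" for c :: real
    using has_integral_const_real[of c 0 1] by simp
  have "\<exists>x\<in>{0..1}. \<exists>x'\<in>{0..1}. \<exists>z\<in>{0..1}. \<exists>z'\<in>{0..1}. v \<bullet> cross_diff f x x' z z' \<noteq> 0"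
  proof (rule ccontr)
    assume none: "\<not> ?thesis"
    have eq: "?F (x, z) = ?F (x, z') + ?F (x', z) - ?F (x', z')"
      if "x \<in> {0..1}" "x' \<in> {0..1}" "z \<in> {0..1}" "z' \<in> {0..1}" for x x' z z'
    proof -
      have "v \<bullet> cross_diff f x x' z z' = 0" using none that by blast
      then show ?thesis by (simp add: cross_diff_def inner_add_right inner_diff_right)
    qed
    have 1: "?F (x, z) = ?F (x', z)" if "x \<in> {0..1}" "x' \<in> {0..1}" "z \<in> {0..1}" for x x' z
    proof -
      have i0: "((\<lambda>z'. ?F (x, z') + ?F (x', z) - ?F (x', z')) has_integral (0 + ?F (x', z) - 0)) {0..1}"
        by (intro has_integral_add has_integral_diff m1 const that)
      have "((\<lambda>z'. ?F (x, z)) has_integral (0 + ?F (x', z) - 0)) {0..1::real}"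
        by (rule has_integral_eq[OF _ i0]) (rule eq[symmetric, OF that])
      from has_integral_unique[OF const this] show ?thesis by simp
    qed
    have "?F (x, z) = 0" if "x \<in> {0..1}" "z \<in> {0..1}" for x z
    proof -
      have "((\<lambda>x'. ?F (x, z)) has_integral 0) {0..1::real}"
        by (rule has_integral_eq[OF _ m2[OF that(2)]]) (rule 1[OF _ that])
      from has_integral_unique[OF const this] show ?thesis .
    qed
    then have "AE p in lebesgue_on unit_square. v \<bullet> f p = 0"
      by (intro AE_I2) (auto simp: space_restrict_space)
    then show False using li v by (auto simp: ae_lin_indep_def)
  qed
  then show ?thesis using that by blast
qed

text \<open>
Up to the normalisation \<open>n^4\<close>, a Riemann sum for the integral of the squared second
difference of \<open>v \<bullet> f\<close>.
\<close>

definition grid_gap :: "(real \<times> real \<Rightarrow> real ^ 'l) \<Rightarrow> nat \<Rightarrow> real ^ 'l \<Rightarrow> real" where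
  "grid_gap f n v = (\<Sum>i\<in>{1..n}. \<Sum>j\<in>{1..n}. \<Sum>a\<in>{1..n}. \<Sum>b\<in>{1..n}.
     (v \<bullet> cross_diff f (real i / n) (real j / n) (real a / n) (real b / n))\<^sup>2)"

lemma grid_count:
  assumes "0 \<le> l" "l < u" "u \<le> 1" "2 / (u - l) \<le> real n"
  shows "real (card {i\<in>{1..n}. real i / n \<in> {l..u}}) \<ge> real n * (u - l) / 2"
proof -
  have n: "real n * (u - l) \<ge> 2" using assms by (simp add: field_simps)
  then have n0: "n > 0" by (cases n) auto
  have un: "0 \<le> l * n" "0 \<le> u * n" using assms by auto
  (* These are n * (u - l) points up to a rounding error 1, which is at most half of that number. *)
  have "{nat \<lfloor>l * n\<rfloor><..nat \<lfloor>u * n\<rfloor>} \<subseteq> {i\<in>{1..n}. real i / n \<in> {l..u}}"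
  proof
    fix i assume i: "i \<in> {nat \<lfloor>l * n\<rfloor><..nat \<lfloor>u * n\<rfloor>}"
    then have "l * n < i" "real i \<le> u * n" using un by (auto simp: nat_less_iff le_nat_iff) linarith+
    moreover have "u * n \<le> n" using assms by (simp add: mult_left_le_one_le)
    ultimately have "i \<le> n" "i \<ge> 1" using un by linarith+
    then show "i \<in> {i\<in>{1..n}. real i / n \<in> {l..u}}"
      using \<open>l * n < i\<close> \<open>real i \<le> u * n\<close> n0 by (auto simp: field_simps)
  qed
  then have "card {nat \<lfloor>l * n\<rfloor><..nat \<lfloor>u * n\<rfloor>} \<le> card {i\<in>{1..n}. real i / n \<in> {l..u}}"
    by (intro card_mono) auto
  then have "real (nat \<lfloor>u * n\<rfloor>) - real (nat \<lfloor>l * n\<rfloor>) \<le> card {i\<in>{1..n}. real i / n \<in> {l..u}}"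
    by simp
  moreover have "real (nat \<lfloor>u * n\<rfloor>) \<ge> u * n - 1" "real (nat \<lfloor>l * n\<rfloor>) \<le> l * n" using un by linarith+
  ultimately show ?thesis using n by (simp add: algebra_simps)
qed

text \<open>
By continuity a nonzero second difference stays away from zero on a box around the point, and for
directions close to \<open>v\<close>. The box contains a positive fraction of all quadruples of grid
points.
\<close>

lemma grid_gap_local:
  assumes C: "\<forall>r. (\<lambda>x. f x $ r) \<in> class_C" and li: "ae_lin_indep f" and v: "v \<noteq> 0"
  obtains r c N where "r > 0" "c > 0"
    "\<And>u n. u \<in> ball v r \<Longrightarrow> n \<ge> N \<Longrightarrow> grid_gap f n u \<ge> c * real n ^ 4"
proof -
  have cont: "continuous_on unit_square f" using C by (rule class_C_continuous)
  have comp: "compact unit_square" by (intro compact_Times compact_Icc)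
  obtain B where B: "\<And>p. p \<in> unit_square \<Longrightarrow> norm (f p) \<le> B"
    using compact_imp_bounded[OF compact_continuous_image[OF cont comp]] by (auto simp: bounded_iff)
  have B0: "B \<ge> 0" using B[of "(0, 0)"] norm_ge_zero[of "f (0, 0)"] by (simp del: norm_ge_zero)
  obtain x1 x2 x3 x4 where x: "x1 \<in> {0..1}" "x2 \<in> {0..1}" "x3 \<in> {0..1}" "x4 \<in> {0..1}"
    and nz: "v \<bullet> cross_diff f x1 x2 x3 x4 \<noteq> 0"
    using cross_diff_nonzero[OF C li v] by metis
  (* One third is lost to moving the four points, one third to moving the direction. *)
  define \<epsilon> where "\<epsilon> = \<bar>v \<bullet> cross_diff f x1 x2 x3 x4\<bar> / 3"
  have \<epsilon>: "\<epsilon> > 0" using nz by (simp add: \<epsilon>_def)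
  have v0: "norm v > 0" using v by simp
  obtain \<delta> where \<delta>: "\<delta> > 0" and uc: "\<And>p q. p \<in> unit_square \<Longrightarrow> q \<in> unit_square \<Longrightarrow> dist q p < \<delta> \<Longrightarrow>
      dist (f q) (f p) < \<epsilon> / (4 * norm v)"
    using compact_uniformly_continuous[OF cont comp, unfolded uniformly_continuous_on_def, rule_format,
      of "\<epsilon> / (4 * norm v)"] \<epsilon> v0 by (metis (no_types, lifting) divide_pos_pos mult_pos_pos zero_less_numeral)
  define l where "l x = max 0 (x - \<delta> / 3)" for x
  define u where "u x = min 1 (x + \<delta> / 3)" for x
  have lu: "0 \<le> l x" "l x < u x" "u x \<le> 1" if "x \<in> {0..1}" for x
    using that \<delta> by (auto simp: l_def u_def)
  have near: "\<bar>t - x\<bar> \<le> \<delta> / 3" "0 \<le> t" "t \<le> 1" if "t \<in> {l x..u x}" for t x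
    using that unfolding l_def u_def atLeastAtMost_iff by linarith+
  define r where "r = \<epsilon> / (4 * B + 1)"
  have r: "r > 0" using \<epsilon> B0 by (simp add: r_def)
  have nc: "norm (cross_diff f t1 t2 t3 t4) \<le> 4 * B"
    if "t1 \<in> {0..1}" "t2 \<in> {0..1}" "t3 \<in> {0..1}" "t4 \<in> {0..1}" for t1 t2 t3 t4
  proof -
    note * = norm_add_diff_diff_le
    have "norm (f (t1, t3)) \<le> B" "norm (f (t2, t4)) \<le> B" "norm (f (t1, t4)) \<le> B" "norm (f (t2, t3)) \<le> B"
      using that by (auto intro!: B)
    then show ?thesis unfolding cross_diff_def using *[of "f (t1, t3)" "f (t2, t4)" "f (t1, t4)" "f (t2, t3)"]
      by linarith
  qed
  have low: "\<bar>w \<bullet> cross_diff f t1 t2 t3 t4\<bar> \<ge> \<epsilon>"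
    if w: "w \<in> ball v r" and t: "t1 \<in> {l x1..u x1}" "t2 \<in> {l x2..u x2}" "t3 \<in> {l x3..u x3}" "t4 \<in> {l x4..u x4}"
    for w t1 t2 t3 t4
  proof -
    have d: "norm (f (s, t) - f (x, z)) \<le> \<epsilon> / (4 * norm v)"
      if "s \<in> {l x..u x}" "t \<in> {l z..u z}" "x \<in> {0..1}" "z \<in> {0..1}" for s t x z
    proof -
      have "dist (s, t) (x, z) \<le> \<bar>s - x\<bar> + \<bar>t - z\<bar>"
        using sqrt_sum_squares_le_sum_abs[of "s - x" "t - z"] by (simp add: dist_Pair_Pair dist_real_def)
      also have "\<dots> < \<delta>" using near(1)[OF that(1)] near(1)[OF that(2)] \<delta> by linarith
      finally have "dist (f (s, t)) (f (x, z)) < \<epsilon> / (4 * norm v)"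
        using near(2,3)[OF that(1)] near(2,3)[OF that(2)] that(3,4) by (intro uc) auto
      then show ?thesis by (simp add: dist_norm)
    qed
    let ?a = "f (t1, t3) - f (x1, x3)" and ?b = "f (t2, t4) - f (x2, x4)"
      and ?c = "f (t1, t4) - f (x1, x4)" and ?d = "f (t2, t3) - f (x2, x3)"
    note * = norm_add_diff_diff_le
    have "cross_diff f t1 t2 t3 t4 - cross_diff f x1 x2 x3 x4 = ?a + ?b - ?c - ?d"
      by (simp add: cross_diff_def)
    moreover have "norm (?a + ?b - ?c - ?d) \<le> 4 * (\<epsilon> / (4 * norm v))"
      using *[of ?a ?b ?c ?d] d[OF t(1,3) x(1,3)] d[OF t(2,4) x(2,4)] d[OF t(1,4) x(1,4)]
        d[OF t(2,3) x(2,3)] by linarith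
    ultimately have "norm (cross_diff f t1 t2 t3 t4 - cross_diff f x1 x2 x3 x4) \<le> \<epsilon> / norm v" by simp
    then have "norm v * norm (cross_diff f t1 t2 t3 t4 - cross_diff f x1 x2 x3 x4) \<le> \<epsilon>"
      using v0 by (simp add: field_simps)
    then have 1: "\<bar>v \<bullet> (cross_diff f t1 t2 t3 t4 - cross_diff f x1 x2 x3 x4)\<bar> \<le> \<epsilon>"
      using Cauchy_Schwarz_ineq2 order.trans by blast
    have "norm (w - v) * norm (cross_diff f t1 t2 t3 t4) \<le> r * (4 * B)"
      using w near(2,3)[OF t(1)] near(2,3)[OF t(2)] near(2,3)[OF t(3)] near(2,3)[OF t(4)] r
      by (intro mult_mono nc) (auto simp: dist_norm norm_minus_commute)
    also have "\<dots> \<le> \<epsilon>" using \<epsilon> B0 by (simp add: r_def field_simps)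
    finally have 2: "\<bar>(w - v) \<bullet> cross_diff f t1 t2 t3 t4\<bar> \<le> \<epsilon>"
      using Cauchy_Schwarz_ineq2 order.trans by blast
    have "\<bar>v \<bullet> cross_diff f x1 x2 x3 x4\<bar> = 3 * \<epsilon>" by (simp add: \<epsilon>_def)
    then show ?thesis using 1 2 by (simp add: inner_diff_left inner_diff_right)
  qed
  define m where "m x = u x - l x" for x
  have m: "m x > 0" if "x \<in> {0..1}" for x using lu[OF that] by (simp add: m_def)
  define N where "N = nat \<lceil>2 / m x1\<rceil> + nat \<lceil>2 / m x2\<rceil> + nat \<lceil>2 / m x3\<rceil> + nat \<lceil>2 / m x4\<rceil>"
  define c where "c = \<epsilon>\<^sup>2 * (m x1 / 2) * (m x2 / 2) * (m x3 / 2) * (m x4 / 2)"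
  have c: "c > 0" using \<epsilon> m x by (simp add: c_def)
  show ?thesis
  proof (rule that[OF r c])
    fix w n assume w: "w \<in> ball v r" and n: "n \<ge> N"
    define I where "I x = {i\<in>{1..n}. real i / n \<in> {l x..u x}}" for x
    have cI: "real (card (I x1)) \<ge> real n * (m x1 / 2)" "real (card (I x2)) \<ge> real n * (m x2 / 2)"
      "real (card (I x3)) \<ge> real n * (m x3 / 2)" "real (card (I x4)) \<ge> real n * (m x4 / 2)"
    proof -
      have *: "real n * (m x / 2) \<le> card (I x)" if "x \<in> {0..1}" "nat \<lceil>2 / m x\<rceil> \<le> n" for x
      proof -
        have "2 / m x \<le> n" using that by linarith
        then show ?thesis
          using grid_count[OF lu[OF that(1)], of n] unfolding I_def m_def by simp
      qed
      show "real (card (I x1)) \<ge> real n * (m x1 / 2)" "real (card (I x2)) \<ge> real n * (m x2 / 2)"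
        "real (card (I x3)) \<ge> real n * (m x3 / 2)" "real (card (I x4)) \<ge> real n * (m x4 / 2)"
        using n unfolding N_def by (intro * x; linarith)+
    qed
    let ?t = "\<lambda>i j a b. (w \<bullet> cross_diff f (real i / n) (real j / n) (real a / n) (real b / n))\<^sup>2"
    have sub: "I x \<subseteq> {1..n}" for x by (auto simp: I_def)
    have "c * real n ^ 4 = (real n * (m x1 / 2)) * ((real n * (m x2 / 2)) * ((real n * (m x3 / 2)) * ((real n * (m x4 / 2)) * \<epsilon>\<^sup>2)))"
      by (simp add: c_def power4_eq_xxxx)
    also have "\<dots> \<le> card (I x1) * (card (I x2) * (card (I x3) * (card (I x4) * \<epsilon>\<^sup>2)))"
      using m[OF x(1)] m[OF x(2)] m[OF x(3)] m[OF x(4)]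
      by (intro mult_mono cI mult_nonneg_nonneg) (simp_all add: less_imp_le)
    also have "\<dots> = (\<Sum>i\<in>I x1. \<Sum>j\<in>I x2. \<Sum>a\<in>I x3. \<Sum>b\<in>I x4. \<epsilon>\<^sup>2)" by simp
    also have "\<dots> \<le> (\<Sum>i\<in>I x1. \<Sum>j\<in>I x2. \<Sum>a\<in>I x3. \<Sum>b\<in>I x4. ?t i j a b)"
    proof (intro sum_mono)
      fix i j a b assume "i \<in> I x1" "j \<in> I x2" "a \<in> I x3" "b \<in> I x4"
      then have "\<epsilon> \<le> \<bar>w \<bullet> cross_diff f (real i / n) (real j / n) (real a / n) (real b / n)\<bar>"
        by (intro low w) (auto simp: I_def)
      then show "\<epsilon>\<^sup>2 \<le> ?t i j a b" using \<epsilon> by (metis less_imp_le power2_abs power_mono)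
    qed
    also have "\<dots> \<le> (\<Sum>i\<in>{1..n}. \<Sum>j\<in>{1..n}. \<Sum>a\<in>{1..n}. \<Sum>b\<in>{1..n}. ?t i j a b)"
    proof -
      have s: "(\<Sum>i\<in>I x. p i) \<le> (\<Sum>i\<in>{1..n}. q i)"
        if "\<And>i. p i \<le> q i" "\<And>i. 0 \<le> q i" for x and p q :: "nat \<Rightarrow> real"
        by (rule order.trans[OF sum_mono sum_mono2[OF _ sub]]) (use that in auto)
      show ?thesis by (intro s sum_nonneg) simp_all
    qed
    finally show "c * real n ^ 4 \<le> grid_gap f n w" by (simp add: grid_gap_def)
  qed
qed

text \<open>
Compactness of the unit sphere makes the local bounds uniform in the direction; homogeneity extends
them to all vectors.
\<close>

lemma grid_gap_lower:
  assumes C: "\<forall>r. (\<lambda>x. f x $ r) \<in> class_C" and li: "ae_lin_indep f"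
  obtains c N where "c > 0" "\<And>v n. n \<ge> N \<Longrightarrow> grid_gap f n v \<ge> c * real n ^ 4 * (norm v)\<^sup>2"
proof -
  have "\<forall>v\<in>sphere 0 1. \<exists>r c N. r > 0 \<and> c > 0 \<and> (\<forall>u n. u \<in> ball v r \<longrightarrow> n \<ge> N \<longrightarrow> grid_gap f n u \<ge> c * real n ^ 4)"
  proof
    fix v :: "real ^ 'a" assume "v \<in> sphere 0 1"
    then have "v \<noteq> 0" by auto
    from grid_gap_local[OF C li this] show "\<exists>r c N. r > 0 \<and> c > 0 \<and>
      (\<forall>u n. u \<in> ball v r \<longrightarrow> n \<ge> N \<longrightarrow> grid_gap f n u \<ge> c * real n ^ 4)" by metis
  qed
  then obtain r c N where R: "\<And>v. v \<in> sphere 0 1 \<Longrightarrow> r v > 0 \<and> c v > 0"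
    and low: "\<And>v u n. v \<in> sphere 0 1 \<Longrightarrow> u \<in> ball v (r v) \<Longrightarrow> n \<ge> N v \<Longrightarrow> grid_gap f n u \<ge> c v * real n ^ 4"
    by metis
  have "compact (sphere (0::real^'a) 1)" by simp
  then obtain T where T: "T \<subseteq> sphere 0 1" "finite T" "sphere (0::real^'a) 1 \<subseteq> (\<Union>v\<in>T. ball v (r v))"
    by (rule compactE_image[of _ "sphere 0 1" "\<lambda>v. ball v (r v)"]) (use R in force)+
  (* Inserting 1 and 0 avoids a case distinction on whether the cover T is empty. *)
  define c' where "c' = Min (insert 1 (c ` T))"
  define N' where "N' = Max (insert 0 (N ` T))"
  have c': "c' > 0" unfolding c'_def using T R by (subst Min_gr_iff) auto
  have unit: "grid_gap f n u \<ge> c' * real n ^ 4" if u: "norm u = 1" and n: "n \<ge> N'" for u n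
  proof -
    have "u \<in> sphere 0 1" using u by simp
    then obtain v where v: "v \<in> T" "u \<in> ball v (r v)" using T(3) by blast
    have "N v \<le> N'" unfolding N'_def using T(2) v by (intro Max_ge) auto
    then have "grid_gap f n u \<ge> c v * real n ^ 4" using low v T n by (meson order.trans subsetD)
    moreover have "c' \<le> c v" unfolding c'_def using T(2) v by (intro Min_le) auto
    ultimately show ?thesis by (meson mult_right_mono order.trans zero_le_power of_nat_0_le_iff)
  qed
  show ?thesis
  proof (rule that[OF c'])
    fix v :: "real ^ 'a" and n assume n: "n \<ge> N'"
    have scale: "grid_gap f n (k *\<^sub>R u) = k\<^sup>2 * grid_gap f n u" for k u
      by (simp add: grid_gap_def sum_distrib_left power_mult_distrib)
    show "grid_gap f n v \<ge> c' * real n ^ 4 * (norm v)\<^sup>2"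
    proof (cases "v = 0")
      case True then show ?thesis by (simp add: grid_gap_def)
    next
      case False
      have "grid_gap f n v = (norm v)\<^sup>2 * grid_gap f n (v /\<^sub>R norm v)"
        using scale[of "norm v" "v /\<^sub>R norm v"] False by simp
      also have "\<dots> \<ge> (norm v)\<^sup>2 * (c' * real n ^ 4)"
        using unit[of "v /\<^sub>R norm v" n] n False by (intro mult_left_mono) auto
      finally show ?thesis by (simp add: mult_ac)
    qed
  qed
qed

lemma sum_square_edges:
  fixes F :: "nat \<Rightarrow> nat \<Rightarrow> real"
  assumes "\<And>i j. F i j = F j i" "\<And>i. F i i = 0"
  shows "(\<Sum>i\<in>{1..n}. \<Sum>j\<in>{1..n}. F i j) = 2 * (\<Sum>(i, j)\<in>edges n. F i j)"
proof -
  let ?V = "{1..n}" and ?D = "(\<lambda>i. (i, i)) ` {1..n}"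
  have eq: "?V \<times> ?V = edges n \<union> (prod.swap ` edges n \<union> ?D)"
    by (auto simp: edges_def image_iff)
  have "(\<Sum>i\<in>?V. \<Sum>j\<in>?V. F i j) = (\<Sum>(i, j)\<in>?V \<times> ?V. F i j)"
    by (simp add: sum.cartesian_product)
  also have "\<dots> = (\<Sum>(i, j)\<in>edges n. F i j) + ((\<Sum>(i, j)\<in>prod.swap ` edges n. F i j) + (\<Sum>(i, j)\<in>?D. F i j))"
  proof -
    have 1: "finite (prod.swap ` edges n)" "finite ?D" "prod.swap ` edges n \<inter> ?D = {}"
      "edges n \<inter> (prod.swap ` edges n \<union> ?D) = {}"
      using finite_edges[of n] by (auto simp: edges_def)
    then have 2: "finite (prod.swap ` edges n \<union> ?D)" by blast
    show ?thesis
      unfolding eq sum.union_disjoint[OF finite_edges 2 1(4)] sum.union_disjoint[OF 1(1-3)] ..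
  qed
  also have "(\<Sum>(i, j)\<in>?D. F i j) = 0" by (intro sum.neutral) (auto simp: assms(2))
  also have "(\<Sum>(i, j)\<in>prod.swap ` edges n. F i j) = (\<Sum>(i, j)\<in>edges n. F i j)"
    by (subst sum.reindex) (auto simp: case_prod_unfold assms(1) inj_on_def)
  finally show ?thesis by simp
qed

context perm_gibbs begin

definition U :: "nat \<Rightarrow> real ^ 'l \<Rightarrow> (nat \<Rightarrow> nat) \<Rightarrow> real" where
  "U n v \<pi> = (\<Sum>e\<in>edges n. h n v \<pi> e)"

lemma E_h: "e \<in> edges n \<Longrightarrow> E n (\<lambda>\<pi>. h n v \<pi> e) = 0"
  using stein_identity[of e n v "\<lambda>_. 1 :: real"] E_const[of n "0::real"] by simp

lemma E_U: "E n (U n v) = 0"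
  unfolding U_def using E_sum[of n "\<lambda>e \<pi>. h n v \<pi> e" "edges n"] by (simp add: E_h)

lemma E_Cauchy_Schwarz:
  fixes F G :: "_ \<Rightarrow> real"
  shows "(E n (\<lambda>\<pi>. F \<pi> * G \<pi>))\<^sup>2 \<le> E n (\<lambda>\<pi>. (F \<pi>)\<^sup>2) * E n (\<lambda>\<pi>. (G \<pi>)\<^sup>2)"
proof -
  let ?s = "\<lambda>\<pi>. sqrt (prob n \<pi>)"
  have s: "?s \<pi> * ?s \<pi> = prob n \<pi>" for \<pi> using prob_pos[of n \<pi>] by simp
  (* The square root of the density splits the weight evenly between the two factors. *)
  have "(\<Sum>\<pi>\<in>perms n. (?s \<pi> * F \<pi>) * (?s \<pi> * G \<pi>))\<^sup>2
    \<le> (\<Sum>\<pi>\<in>perms n. (?s \<pi> * F \<pi>)\<^sup>2) * (\<Sum>\<pi>\<in>perms n. (?s \<pi> * G \<pi>)\<^sup>2)"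
    by (rule Cauchy_Schwarz_ineq_sum)
  moreover have "(?s \<pi> * F \<pi>) * (?s \<pi> * G \<pi>) = prob n \<pi> * (F \<pi> * G \<pi>)" for \<pi>
    using s[of \<pi>] by (metis (no_types, lifting) mult.assoc mult.commute)
  moreover have "(?s \<pi> * H \<pi>)\<^sup>2 = prob n \<pi> * (H \<pi>)\<^sup>2" for \<pi> and H :: "_ \<Rightarrow> real"
    using prob_pos[of n \<pi>] by (simp add: power_mult_distrib)
  ultimately show ?thesis by (simp add: E_def)
qed

lemma suff_stat_lipschitz: "hamming_lipschitz n (2 * (norm v * B)) (\<lambda>\<pi>. v \<bullet> suff_stat f n \<pi>)"
proof -
  let ?t = "\<lambda>\<pi> i. v \<bullet> f (real i / real n, real (\<pi> i) / real n)"
  have "hamming_lipschitz n (2 * (norm v * B) * 1) (\<lambda>\<pi>. \<Sum>i\<in>{1..n}. ?t \<pi> i)"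
  proof (rule local_sum_lipschitz[where supp = "\<lambda>i. {i}"])
    fix \<pi> i assume \<pi>: "\<pi> \<in> perms n" and i: "i \<in> {1..n}"
    show "\<bar>?t \<pi> i\<bar> \<le> norm v * B"
      using Cauchy_Schwarz_ineq2 mult_left_mono[OF bound[OF grid[OF i permsD[OF \<pi> i]]], of "norm v"]
      by (meson norm_ge_zero order.trans)
  next
    fix m :: nat assume "m \<in> {1..n}"
    have "{t \<in> {1..n}. m \<in> {t}} \<subseteq> {m}" by auto
    then have "card {t \<in> {1..n}. m \<in> {t}} \<le> card {m}" by (intro card_mono) auto
    then show "real (card {t \<in> {1..n}. m \<in> {t}}) \<le> 1" by simp
  qed (use B_nonneg in auto)
  then show ?thesis by (simp add: suff_stat_def inner_sum_right)
qed

text \<open>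
The Stein identity with \<open>\<phi> = v \<bullet> T\<close>: the difference \<open>\<phi> - \<phi>
\<circ> swap e\<close> is \<open>v \<bullet> y n \<pi> e\<close>, so that the covariance of the
score with the sufficient statistic is a sum of nonnegative terms.
\<close>

lemma E_U_suff_stat:
  "E n (\<lambda>\<pi>. U n v \<pi> * (v \<bullet> suff_stat f n \<pi>))
   = (1 / 2) * (\<Sum>e\<in>edges n. E n (\<lambda>\<pi>. (v \<bullet> y n \<pi> e)\<^sup>2 * \<sigma> (\<theta> \<bullet> y n \<pi> e)))"
proof -
  have "E n (\<lambda>\<pi>. U n v \<pi> * (v \<bullet> suff_stat f n \<pi>))
    = (\<Sum>e\<in>edges n. E n (\<lambda>\<pi>. h n v \<pi> e *\<^sub>R (v \<bullet> suff_stat f n \<pi>)))"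
    unfolding U_def sum_distrib_right by (simp add: E_sum)
  also have "\<dots> = (\<Sum>e\<in>edges n. (1 / 2) *\<^sub>R E n (\<lambda>\<pi>. (v \<bullet> y n \<pi> e)\<^sup>2 * \<sigma> (\<theta> \<bullet> y n \<pi> e)))"
  proof (intro sum.cong refl)
    fix e assume e: "e \<in> edges n"
    obtain i j where ij: "e = (i, j)" by (cases e)
    have V: "i \<in> {1..n}" "j \<in> {1..n}" "i \<noteq> j" using e ij by (auto simp: edges_def)
    have "E n (\<lambda>\<pi>. h n v \<pi> e *\<^sub>R (v \<bullet> suff_stat f n \<pi> - v \<bullet> suff_stat f n (swap e \<pi>)))
      = E n (\<lambda>\<pi>. (v \<bullet> y n \<pi> e)\<^sup>2 * \<sigma> (\<theta> \<bullet> y n \<pi> e))"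
      by (rule E_cong) (simp add: ij suff_stat_swap[OF V] h_def inner_diff_right power2_eq_square)
    then show "E n (\<lambda>\<pi>. h n v \<pi> e *\<^sub>R (v \<bullet> suff_stat f n \<pi>))
      = (1 / 2) *\<^sub>R E n (\<lambda>\<pi>. (v \<bullet> y n \<pi> e)\<^sup>2 * \<sigma> (\<theta> \<bullet> y n \<pi> e))"
      using stein_identity[OF e, of v "\<lambda>\<pi>. v \<bullet> suff_stat f n \<pi>"] by simp
  qed
  finally show ?thesis by (simp add: sum_distrib_left)
qed

text \<open>
The joint law of \<open>(\<pi> i, \<pi> j)\<close> is at least a multiple of the uniform one, so the
sum over pairs dominates the deterministic sum over all quadruples.
\<close>

lemma edge_square_lower:
  assumes "n > 0"
  shows "(\<Sum>e\<in>edges n. E n (\<lambda>\<pi>. (v \<bullet> y n \<pi> e)\<^sup>2)) \<ge> grid_gap f n v / (2 * K ^ 8 * real n ^ 2)"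
proof -
  let ?V = "{1..n}"
  let ?t = "\<lambda>i j a b. (v \<bullet> cross_diff f (real i / n) (real j / n) (real a / n) (real b / n))\<^sup>2"
  define Q where "Q i j = (\<Sum>a\<in>?V. \<Sum>b\<in>?V. ?t i j a b)" for i j
  have neg: "cross_diff f (real j / n) (real i / n) a b = - cross_diff f (real i / n) (real j / n) a b" for i j a b
    by (simp add: cross_diff_def)
  have "grid_gap f n v = 2 * (\<Sum>(i, j)\<in>edges n. Q i j)"
    unfolding grid_gap_def Q_def[symmetric]
  proof (rule sum_square_edges)
    fix i j show "Q i j = Q j i"
      unfolding Q_def by (intro sum.cong refl) (simp add: neg[of i j])
  next
    fix i show "Q i i = 0" unfolding Q_def by (simp add: cross_diff_def)
  qed
  then have "grid_gap f n v / (2 * K ^ 8 * real n ^ 2) = (\<Sum>(i, j)\<in>edges n. Q i j / (K ^ 8 * real n ^ 2))"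
    by (simp add: sum_divide_distrib case_prod_unfold sum_distrib_left)
  also have "\<dots> \<le> (\<Sum>e\<in>edges n. E n (\<lambda>\<pi>. (v \<bullet> y n \<pi> e)\<^sup>2))"
  proof (rule sum_mono)
    fix e assume e: "e \<in> edges n"
    obtain i j where ij: "e = (i, j)" by (cases e)
    have V: "i \<in> {1..n}" "j \<in> {1..n}" "i \<noteq> j" using e ij by (auto simp: edges_def)
    have "Q i j = (\<Sum>a\<in>?V. \<Sum>b\<in>?V - {a}. ?t i j a b)"
      unfolding Q_def by (intro sum.cong refl sum.mono_neutral_right) (auto simp: cross_diff_def)
    then have "Q i j / (K ^ 8 * real n ^ 2) \<le> E n (\<lambda>\<pi>. ?t i j (\<pi> i) (\<pi> j))"
      using E_pair_lower[OF V, of "?t i j"] by simp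
    also have "\<dots> = E n (\<lambda>\<pi>. (v \<bullet> y n \<pi> e)\<^sup>2)" by (simp add: ij y_diff_def cross_diff_def)
    finally show "(case e of (i, j) \<Rightarrow> Q i j / (K ^ 8 * real n ^ 2)) \<le> \<dots>" by (simp add: ij)
  qed
  finally show ?thesis .
qed

lemma \<sigma>_antimono: "x \<le> x' \<Longrightarrow> \<sigma> x' \<le> \<sigma> x"
  by (auto simp: \<sigma>_def add_pos_pos intro!: divide_left_mono mult_pos_pos)

lemma theta_y_le:
  assumes "\<pi> \<in> perms n" "e \<in> edges n"
  shows "\<bar>v \<bullet> y n \<pi> e\<bar> \<le> norm v * (4 * B)"
  using Cauchy_Schwarz_ineq2[of v "y n \<pi> e"] mult_left_mono[OF norm_y_le[OF assms], of "norm v"] by simp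

lemma E_sq_nonneg: "E n (\<lambda>\<pi>. (F \<pi>)\<^sup>2) \<ge> (0::real)"
  using E_mono[of n "\<lambda>_. 0::real" "\<lambda>\<pi>. (F \<pi>)\<^sup>2"] E_const[of n "0::real"] by simp

text \<open>
Cauchy-Schwarz for the score and the sufficient statistic: their covariance is at least of order
\<open>n\<^sup>2\<close>, whereas the sufficient statistic has variance \<open>O(n)\<close> by
concentration. So the variance of the score is at least of order \<open>n ^ 3\<close>.
\<close>

lemma score_variance_lower:
  assumes C: "\<forall>r. (\<lambda>x. f x $ r) \<in> class_C" and li: "ae_lin_indep f"
  obtains c N where "c > 0" "\<And>v n. n \<ge> N \<Longrightarrow> E n (\<lambda>\<pi>. (U n v \<pi>)\<^sup>2) \<ge> c * real n ^ 3 * (norm v)\<^sup>2"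
    "\<And>v n. n \<ge> N \<Longrightarrow> (\<Sum>e\<in>edges n. E n (\<lambda>\<pi>. (v \<bullet> y n \<pi> e)\<^sup>2)) \<ge> c * real n ^ 2 * (norm v)\<^sup>2"
proof -
  obtain c0 N where c0: "c0 > 0" and gap: "\<And>v n. n \<ge> N \<Longrightarrow> grid_gap f n v \<ge> c0 * real n ^ 4 * (norm v)\<^sup>2"
    using grid_gap_lower[OF C li] by metis
  have K0: "K > 0" by (simp add: K_def)
  define c1 where "c1 = c0 / (2 * K ^ 8)"
  have c1: "c1 > 0" using c0 K0 by (simp add: c1_def)
  define s where "s = \<sigma> (norm \<theta> * (4 * B))"
  have s: "s > 0" by (simp add: s_def \<sigma>_bounds)
  (* The summand 1 makes D positive even when B = 0. *)
  define D where "D = (2 * B * (1 + K ^ 4))\<^sup>2 + 1"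
  have D: "D > 0" by (auto simp: D_def intro!: add_nonneg_pos)
  define c2 where "c2 = (s * c1 / 2)\<^sup>2 / D"
  have c2: "c2 > 0" using s c1 D by (simp add: c2_def)
  have sq: "(\<Sum>e\<in>edges n. E n (\<lambda>\<pi>. (v \<bullet> y n \<pi> e)\<^sup>2)) \<ge> c1 * real n ^ 2 * (norm v)\<^sup>2"
    if n: "n \<ge> max 1 N" for n v
  proof -
    have "c1 * real n ^ 2 * (norm v)\<^sup>2 = (c0 * real n ^ 4 * (norm v)\<^sup>2) / (2 * K ^ 8 * real n ^ 2)"
      using n by (simp add: c1_def power2_eq_square power4_eq_xxxx)
    also have "\<dots> \<le> grid_gap f n v / (2 * K ^ 8 * real n ^ 2)"
      using gap[of n v] n K0 by (intro divide_right_mono) auto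
    also have "\<dots> \<le> (\<Sum>e\<in>edges n. E n (\<lambda>\<pi>. (v \<bullet> y n \<pi> e)\<^sup>2))"
      using n by (intro edge_square_lower) auto
    finally show ?thesis .
  qed
  have UU: "E n (\<lambda>\<pi>. (U n v \<pi>)\<^sup>2) \<ge> c2 * real n ^ 3 * (norm v)\<^sup>2" if n: "n \<ge> max 1 N" for n v
  proof (cases "v = 0")
    case True
    then show ?thesis using E_sq_nonneg by simp
  next
    case False
    let ?T = "\<lambda>\<pi>. v \<bullet> suff_stat f n \<pi>"
    have "(s * c1 / 2) * real n ^ 2 * (norm v)\<^sup>2 \<le> (1 / 2) * (\<Sum>e\<in>edges n. s * E n (\<lambda>\<pi>. (v \<bullet> y n \<pi> e)\<^sup>2))"
      using mult_left_mono[OF sq[OF n, of v], of "s / 2"] s by (simp add: mult_ac flip: sum_distrib_left)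
    also have "\<dots> \<le> (1 / 2) * (\<Sum>e\<in>edges n. E n (\<lambda>\<pi>. (v \<bullet> y n \<pi> e)\<^sup>2 * \<sigma> (\<theta> \<bullet> y n \<pi> e)))"
    proof (intro mult_left_mono sum_mono)
      fix e assume e: "e \<in> edges n"
      have "s * E n (\<lambda>\<pi>. (v \<bullet> y n \<pi> e)\<^sup>2) = E n (\<lambda>\<pi>. s * (v \<bullet> y n \<pi> e)\<^sup>2)" by (simp add: E_cmult)
      also have "\<dots> \<le> E n (\<lambda>\<pi>. (v \<bullet> y n \<pi> e)\<^sup>2 * \<sigma> (\<theta> \<bullet> y n \<pi> e))"
      proof (rule E_mono)
        fix \<pi> assume "\<pi> \<in> perms n"
        then have "s \<le> \<sigma> (\<theta> \<bullet> y n \<pi> e)"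
          unfolding s_def using theta_y_le[of \<pi> n e \<theta>] e by (intro \<sigma>_antimono) auto
        then show "s * (v \<bullet> y n \<pi> e)\<^sup>2 \<le> (v \<bullet> y n \<pi> e)\<^sup>2 * \<sigma> (\<theta> \<bullet> y n \<pi> e)"
          using mult_left_mono[of s "\<sigma> (\<theta> \<bullet> y n \<pi> e)" "(v \<bullet> y n \<pi> e)\<^sup>2"] by (simp add: mult.commute)
      qed
      finally show "s * E n (\<lambda>\<pi>. (v \<bullet> y n \<pi> e)\<^sup>2) \<le> \<dots>" .
    qed simp
    also have "\<dots> = E n (\<lambda>\<pi>. U n v \<pi> * ?T \<pi>)" by (simp add: E_U_suff_stat)
    also have "\<dots> = E n (\<lambda>\<pi>. U n v \<pi> * (?T \<pi> - E n ?T))"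
      using E_cmult[of n "E n ?T" "U n v"] by (simp add: right_diff_distrib E_diff E_U mult.commute)
    finally have low: "(s * c1 / 2) * real n ^ 2 * (norm v)\<^sup>2 \<le> E n (\<lambda>\<pi>. U n v \<pi> * (?T \<pi> - E n ?T))" .
    have "((s * c1 / 2) * real n ^ 2 * (norm v)\<^sup>2)\<^sup>2 \<le> (E n (\<lambda>\<pi>. U n v \<pi> * (?T \<pi> - E n ?T)))\<^sup>2"
      using low s c1 by (intro power_mono) auto
    also have "\<dots> \<le> E n (\<lambda>\<pi>. (U n v \<pi>)\<^sup>2) * E n (\<lambda>\<pi>. (?T \<pi> - E n ?T)\<^sup>2)" by (rule E_Cauchy_Schwarz)
    also have "\<dots> \<le> E n (\<lambda>\<pi>. (U n v \<pi>)\<^sup>2) * (real n * (norm v)\<^sup>2 * D)"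
    proof (intro mult_left_mono E_sq_nonneg)
      have "E n (\<lambda>\<pi>. (?T \<pi> - E n ?T)\<^sup>2) \<le> real n * (2 * (norm v * B) * (1 + K ^ 4))\<^sup>2"
        by (rule E_variance[OF suff_stat_lipschitz])
      also have "\<dots> = real n * (norm v)\<^sup>2 * (2 * B * (1 + K ^ 4))\<^sup>2" by (simp add: power_mult_distrib)
      also have "\<dots> \<le> real n * (norm v)\<^sup>2 * D" by (intro mult_left_mono) (auto simp: D_def)
      finally show "E n (\<lambda>\<pi>. (?T \<pi> - E n ?T)\<^sup>2) \<le> real n * (norm v)\<^sup>2 * D" .
    qed
    finally have "((s * c1 / 2) * real n ^ 2 * (norm v)\<^sup>2)\<^sup>2 / (real n * (norm v)\<^sup>2 * D) \<le> E n (\<lambda>\<pi>. (U n v \<pi>)\<^sup>2)"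
      using n False D by (subst pos_divide_le_eq) (auto intro!: mult_pos_pos)
    also have "((s * c1 / 2) * real n ^ 2 * (norm v)\<^sup>2)\<^sup>2 / (real n * (norm v)\<^sup>2 * D) = c2 * real n ^ 3 * (norm v)\<^sup>2"
      using n False D by (simp add: c2_def field_simps power2_eq_square power3_eq_cube)
    finally show ?thesis .
  qed
  show ?thesis
  proof (rule that[of "min c1 c2" "max 1 N"])
    fix v :: "real ^ 'l" and n assume n: "n \<ge> max 1 N"
    have "min c1 c2 * real n ^ 3 * (norm v)\<^sup>2 \<le> c2 * real n ^ 3 * (norm v)\<^sup>2"
      by (intro mult_right_mono) auto
    then show "min c1 c2 * real n ^ 3 * (norm v)\<^sup>2 \<le> E n (\<lambda>\<pi>. (U n v \<pi>)\<^sup>2)" using UU[OF n, of v] by linarith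
    have "min c1 c2 * real n ^ 2 * (norm v)\<^sup>2 \<le> c1 * real n ^ 2 * (norm v)\<^sup>2"
      by (intro mult_right_mono) auto
    then show "min c1 c2 * real n ^ 2 * (norm v)\<^sup>2 \<le> (\<Sum>e\<in>edges n. E n (\<lambda>\<pi>. (v \<bullet> y n \<pi> e)\<^sup>2))"
      using sq[OF n, of v] by linarith
  qed (use c1 c2 in auto)
qed

end

section \<open>Central limit theorem for the score\<close>

text \<open>
Solve \<open>\<psi>' = - s \<psi>\<close> approximately with the integrating factor \<open>exp
(s\<^sup>2 / 2)\<close>.
\<close>

lemma gaussian_ode_bound:
  fixes \<psi> \<psi>' :: "real \<Rightarrow> complex"
  assumes 0: "\<psi> 0 = 1" and d: "\<And>s. (\<psi> has_vector_derivative \<psi>' s) (at s)"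
    and b: "\<And>s. \<bar>s\<bar> \<le> \<bar>t\<bar> \<Longrightarrow> norm (\<psi>' s + s *\<^sub>R \<psi> s) \<le> a"
  shows "norm (\<psi> t - complex_of_real (exp (- (t\<^sup>2) / 2))) \<le> a * \<bar>t\<bar>"
proof -
  define D where "D s = exp (s\<^sup>2 / 2) *\<^sub>R \<psi> s" for s
  define I where "I = {-\<bar>t\<bar>..\<bar>t\<bar>}"
  have D': "(D has_vector_derivative exp (s\<^sup>2 / 2) *\<^sub>R (\<psi>' s + s *\<^sub>R \<psi> s)) (at s within I)" for s
  proof -
    have e: "((\<lambda>s. exp (s\<^sup>2 / 2)) has_real_derivative exp (s\<^sup>2 / 2) * s) (at s)"
      by (auto intro!: derivative_eq_intros simp: power2_eq_square)
    show ?thesis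
      unfolding D_def
      by (rule has_vector_derivative_at_within)
        (use has_vector_derivative_scaleR[OF e d[of s]] in \<open>simp add: scaleR_add_right\<close>)
  qed
  have a: "a \<ge> 0" using b[of 0] by (rule order.trans[OF norm_ge_zero]) simp
  have "norm (D t - D 0) \<le> (exp (t\<^sup>2 / 2) * a) * norm (t - 0)"
  proof (rule differentiable_bound[where S = I])
    show "convex I" by (simp add: I_def)
    fix s assume s: "s \<in> I"
    show "(D has_derivative (\<lambda>x. x *\<^sub>R (exp (s\<^sup>2 / 2) *\<^sub>R (\<psi>' s + s *\<^sub>R \<psi> s)))) (at s within I)"
      using D'[of s] unfolding has_vector_derivative_def .
    have sb: "\<bar>s\<bar> \<le> \<bar>t\<bar>" using s by (auto simp: I_def)
    then have "s\<^sup>2 \<le> t\<^sup>2" by (simp add: abs_le_square_iff)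
    then have "norm (exp (s\<^sup>2 / 2) *\<^sub>R (\<psi>' s + s *\<^sub>R \<psi> s)) \<le> exp (t\<^sup>2 / 2) * a"
      using b[OF sb] by (auto intro!: mult_mono)
    then show "onorm (\<lambda>x. x *\<^sub>R (exp (s\<^sup>2 / 2) *\<^sub>R (\<psi>' s + s *\<^sub>R \<psi> s))) \<le> exp (t\<^sup>2 / 2) * a"
    proof (intro onorm_le)
      fix x :: real
      have "norm (x *\<^sub>R (exp (s\<^sup>2 / 2) *\<^sub>R (\<psi>' s + s *\<^sub>R \<psi> s))) = norm x * norm (exp (s\<^sup>2 / 2) *\<^sub>R (\<psi>' s + s *\<^sub>R \<psi> s))"
        by (simp only: norm_scaleR real_norm_def)
      also have "\<dots> \<le> norm x * (exp (t\<^sup>2 / 2) * a)"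
        by (intro mult_left_mono norm_ge_zero) fact
      finally show "norm (x *\<^sub>R (exp (s\<^sup>2 / 2) *\<^sub>R (\<psi>' s + s *\<^sub>R \<psi> s))) \<le> exp (t\<^sup>2 / 2) * a * norm x"
        by (simp only: mult.commute)
    qed
  qed (auto simp: I_def)
  then have "norm (D t - 1) \<le> exp (t\<^sup>2 / 2) * (a * \<bar>t\<bar>)" by (simp add: D_def 0 mult.assoc)
  moreover have eq: "\<psi> t - complex_of_real (exp (- (t\<^sup>2) / 2)) = exp (- (t\<^sup>2) / 2) *\<^sub>R (D t - 1)"
    by (simp add: D_def right_diff_distrib exp_minus scaleR_conv_of_real flip: mult.assoc)
  ultimately have "norm (\<psi> t - complex_of_real (exp (- (t\<^sup>2) / 2)))
      \<le> exp (- (t\<^sup>2) / 2) * (exp (t\<^sup>2 / 2) * (a * \<bar>t\<bar>))"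
    unfolding eq norm_scaleR abs_exp_cancel by (intro mult_left_mono) auto
  also have "\<dots> = a * \<bar>t\<bar>" by (simp add: exp_minus)
  finally show ?thesis .
qed

lemma isCont_cdf_std_normal: "isCont (cdf std_normal_distribution) x"
proof -
  interpret real_distribution std_normal_distribution by (rule real_dist_normal_dist)
  have "{x} \<in> null_sets lborel" by (rule finite_imp_null_set_lborel) simp
  then have "{x} \<in> null_sets std_normal_distribution"
    using absolutely_continuousI_density[of std_normal_density lborel]
    by (auto simp: absolutely_continuous_def)
  then have "measure std_normal_distribution {x} = 0" by (simp add: measure_def null_setsD1)
  then show ?thesis by (simp add: isCont_cdf)
qed

lemma iexp_first_order: "norm (1 - iexp (- x) - \<i> * x) \<le> x\<^sup>2 / 2"
proof -
  have "norm (iexp (- x) - (1 + \<i> * (- x))) \<le> x\<^sup>2 / 2"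
    using iexp_approx1[of "- x" 1] by (simp add: numeral_2_eq_2)
  moreover have "norm (1 - iexp (- x) - \<i> * x) = norm (iexp (- x) - (1 + \<i> * (- x)))"
    by (subst norm_minus_cancel[symmetric]) (simp add: algebra_simps)
  ultimately show ?thesis by simp
qed

lemma hamming_lipschitz_add:
  assumes "hamming_lipschitz n L F" "hamming_lipschitz n L' G"
  shows "hamming_lipschitz n (L + L') (\<lambda>\<pi>. F \<pi> + G \<pi>)"
  unfolding hamming_lipschitz_def
proof (intro conjI ballI)
  show "0 \<le> L + L'" using assms by (simp add: hamming_lipschitz_def)
  fix \<pi> \<sigma> assume "\<pi> \<in> perms n" "\<sigma> \<in> perms n"
  then have "F \<pi> - F \<sigma> \<le> L * hamming n \<pi> \<sigma>" "G \<pi> - G \<sigma> \<le> L' * hamming n \<pi> \<sigma>"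
    using assms by (auto simp: hamming_lipschitz_def)
  then show "F \<pi> + G \<pi> - (F \<sigma> + G \<sigma>) \<le> (L + L') * hamming n \<pi> \<sigma>" by (simp add: algebra_simps)
qed

lemma hamming_lipschitz_mono:
  assumes "hamming_lipschitz n L F" "L \<le> L'"
  shows "hamming_lipschitz n L' F"
proof -
  have "hamming_lipschitz n L' (\<lambda>\<pi>. 1 * F \<pi>)"
    by (rule hamming_lipschitz_scale[OF assms(1)]) (use assms(2) in simp_all)
  then show ?thesis by simp
qed

lemma hamming_swap_le: "hamming n \<pi> (\<pi> \<circ> Transposition.transpose i j) \<le> 2"
proof -
  have "{k\<in>{1..n}. \<pi> k \<noteq> (\<pi> \<circ> Transposition.transpose i j) k} \<subseteq> {i, j}"
    by (auto simp: Transposition.transpose_def)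
  then have "card {k\<in>{1..n}. \<pi> k \<noteq> (\<pi> \<circ> Transposition.transpose i j) k} \<le> card {i, j}"
    by (intro card_mono) auto
  also have "\<dots> \<le> 2" by (simp add: card_insert_if)
  finally show ?thesis unfolding hamming_def by linarith
qed

lemma hamming_commute: "hamming n \<pi> \<sigma> = hamming n \<sigma> \<pi>"
proof -
  have "{i\<in>{1..n}. \<pi> i \<noteq> \<sigma> i} = {i\<in>{1..n}. \<sigma> i \<noteq> \<pi> i}" by auto
  then show ?thesis by (simp only: hamming_def)
qed

lemma edge_swap_in_perms:
  assumes "\<pi> \<in> perms n" "e \<in> edges n"
  shows "\<pi> \<circ> Transposition.transpose (fst e) (snd e) \<in> perms n"
  using assms(2) by (intro perms_swap[OF assms(1)]) (auto simp: edges_def)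

lemma edges_pair_cases:
  assumes "e \<in> edges n" "e' \<in> edges n" "ends e \<inter> ends e' \<noteq> {}" "e \<noteq> e'"
  shows "(e, e') \<in> adjacent_edges n"
proof -
  obtain i j k l where [simp]: "e = (i, j)" "e' = (k, l)" by (metis surj_pair)
  have ij: "i < j" "k < l" and ne: "\<not> (i = k \<and> j = l)" using assms by (auto simp: edges_def)
  have "{i, j} \<inter> {k, l} \<noteq> {}" using assms(3) by (simp add: ends_def)
  then consider "i = k" | "i = l" | "j = k" | "j = l" by auto
  then have "\<exists>m. {i, j} \<inter> {k, l} = {m}"
  proof cases
    case 1 then have "{i, j} \<inter> {k, l} = {i}" using ij ne by auto then show ?thesis by blast
  next
    case 2 then have "{i, j} \<inter> {k, l} = {i}" using ij ne by auto then show ?thesis by blast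
  next
    case 3 then have "{i, j} \<inter> {k, l} = {j}" using ij ne by auto then show ?thesis by blast
  next
    case 4 then have "{i, j} \<inter> {k, l} = {j}" using ij ne by auto then show ?thesis by blast
  qed
  then have "card ({i, j} \<inter> {k, l}) = 1" by auto
  then show ?thesis using assms by (simp add: adjacent_edges_def)
qed

text \<open>
Two edges are equal, adjacent or disjoint.
\<close>

lemma sum_edge_pairs:
  fixes G :: "nat \<times> nat \<Rightarrow> nat \<times> nat \<Rightarrow> real"
  assumes "\<And>e e'. e \<in> edges n \<Longrightarrow> e' \<in> edges n \<Longrightarrow> ends e \<inter> ends e' = {} \<Longrightarrow> G e e' = 0"
  shows "(\<Sum>e\<in>edges n. \<Sum>e'\<in>edges n. G e e') = (\<Sum>e\<in>edges n. G e e) + (\<Sum>(e, e')\<in>adjacent_edges n. G e e')"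
proof -
  let ?D = "(\<lambda>e. (e, e)) ` edges n"
  have sub: "?D \<union> adjacent_edges n \<subseteq> edges n \<times> edges n" by (auto simp: adjacent_edges_def)
  have disj: "?D \<inter> adjacent_edges n = {}"
    by (auto simp: adjacent_edges_def edges_def card_insert_if)
  have "(\<Sum>e\<in>edges n. \<Sum>e'\<in>edges n. G e e') = (\<Sum>(e, e')\<in>edges n \<times> edges n. G e e')"
    by (simp add: sum.cartesian_product)
  also have "\<dots> = (\<Sum>(e, e')\<in>?D \<union> adjacent_edges n. G e e')"
  proof (rule sum.mono_neutral_right[OF _ sub])
    show "\<forall>p\<in>edges n \<times> edges n - (?D \<union> adjacent_edges n). (case p of (e, e') \<Rightarrow> G e e') = 0"
    proof
      fix p assume p: "p \<in> edges n \<times> edges n - (?D \<union> adjacent_edges n)"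
      obtain e e' where [simp]: "p = (e, e')" by (cases p)
      have "ends e \<inter> ends e' = {}" using edges_pair_cases[of e n e'] p by auto
      then show "(case p of (e, e') \<Rightarrow> G e e') = 0" using assms p by auto
    qed
  qed (auto simp: finite_edges)
  also have "\<dots> = (\<Sum>(e, e')\<in>?D. G e e') + (\<Sum>(e, e')\<in>adjacent_edges n. G e e')"
    by (rule sum.union_disjoint) (auto simp: finite_edges finite_adjacent_edges disj)
  also have "(\<Sum>(e, e')\<in>?D. G e e') = (\<Sum>e\<in>edges n. G e e)"
    by (subst sum.reindex) (auto simp: inj_on_def)
  finally show ?thesis .
qed

context perm_gibbs begin

definition h_bound :: "real ^ 'l \<Rightarrow> real" where "h_bound v = norm v * (4 * B)"

lemma h_bound_nonneg: "0 \<le> h_bound v" using B_nonneg by (simp add: h_bound_def)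

lemma h_le: "\<pi> \<in> perms n \<Longrightarrow> e \<in> edges n \<Longrightarrow> \<bar>h n v \<pi> e\<bar> \<le> h_bound v"
  unfolding h_bound_def by (rule abs_h_le)

lemma h_local:
  fixes \<pi> \<rho> :: "nat \<Rightarrow> nat"
  assumes "\<And>m. m \<in> ends e \<Longrightarrow> \<pi> m = \<rho> m"
  shows "h n v \<pi> e = h n v \<rho> e"
  using y_local[of e \<pi> \<rho> n, OF assms] by (simp only: h_def)

lemma U_lipschitz: "hamming_lipschitz n (4 * h_bound v * real n) (U n v)"
proof -
  have eq: "U n v = (\<lambda>\<pi>. \<Sum>e\<in>edges n. (v \<bullet> y n \<pi> e) * \<sigma> (\<theta> \<bullet> y n \<pi> e))"
    by (rule ext) (simp only: U_def h_def)
  show ?thesis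
    unfolding eq
    by (rule edge_sum_lipschitz[OF h_bound_nonneg]) (use h_le in \<open>simp only: h_def\<close>)
qed

lemma U_swap_diff:
  assumes "\<pi> \<in> perms n" "e \<in> edges n"
  shows "\<bar>U n v \<pi> - U n v (swap e \<pi>)\<bar> \<le> 8 * h_bound v * real n"
proof -
  let ?L = "4 * h_bound v * real n"
  have s: "swap e \<pi> \<in> perms n" by (rule edge_swap_in_perms[OF assms])
  have "U n v \<pi> - U n v (swap e \<pi>) \<le> ?L * hamming n \<pi> (swap e \<pi>)"
    "U n v (swap e \<pi>) - U n v \<pi> \<le> ?L * hamming n (swap e \<pi>) \<pi>"
    using U_lipschitz[of n v] s assms(1) by (auto simp: hamming_lipschitz_def)
  moreover have "?L * hamming n \<pi> (swap e \<pi>) \<le> ?L * 2"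
    using h_bound_nonneg by (intro mult_left_mono hamming_swap_le) auto
  moreover have "?L * 2 = 8 * h_bound v * real n" by simp
  ultimately show ?thesis unfolding hamming_commute[of n "swap e \<pi>"] by linarith
qed

text \<open>
Twice the conditional variance that Stein's method produces for the score. Its mean is twice the
variance of the score, and it concentrates because only edges meeting \<open>e\<close> contribute to
the difference at \<open>e\<close>.
\<close>

definition stein_var :: "nat \<Rightarrow> real ^ 'l \<Rightarrow> (nat \<Rightarrow> nat) \<Rightarrow> real" where
  "stein_var n v \<pi> = (\<Sum>e\<in>edges n. h n v \<pi> e * (U n v \<pi> - U n v (swap e \<pi>)))"

lemma stein_var_lipschitz: "hamming_lipschitz n (56 * (h_bound v)\<^sup>2 * real n ^ 2) (stein_var n v)"
proof -
  define g where "g \<pi> e e' = h n v \<pi> e * (h n v \<pi> e' - h n v (swap e \<pi>) e')" for \<pi> e e'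
  have disj: "g \<pi> e e' = 0" if "ends e \<inter> ends e' = {}" for \<pi> e e'
  proof -
    have "h n v \<pi> e' = h n v (swap e \<pi>) e'"
      by (rule h_local) (use that in \<open>auto simp: ends_def Transposition.transpose_def\<close>)
    then show ?thesis by (simp add: g_def)
  qed
  have eq: "stein_var n v = (\<lambda>\<pi>. (\<Sum>e\<in>edges n. g \<pi> e e) + (\<Sum>(e, e')\<in>adjacent_edges n. g \<pi> e e'))"
  proof
    fix \<pi>
    have "stein_var n v \<pi> = (\<Sum>e\<in>edges n. \<Sum>e'\<in>edges n. g \<pi> e e')"
      by (simp add: stein_var_def U_def g_def sum_subtractf sum_distrib_left right_diff_distrib)
    also have "\<dots> = (\<Sum>e\<in>edges n. g \<pi> e e) + (\<Sum>(e, e')\<in>adjacent_edges n. g \<pi> e e')"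
      by (rule sum_edge_pairs) (use disj in auto)
    finally show "stein_var n v \<pi> = \<dots>" .
  qed
  have gb: "\<bar>g \<pi> e e'\<bar> \<le> 2 * (h_bound v)\<^sup>2" if "\<pi> \<in> perms n" "e \<in> edges n" "e' \<in> edges n" for \<pi> e e'
  proof -
    have "\<bar>h n v \<pi> e' - h n v (swap e \<pi>) e'\<bar> \<le> 2 * h_bound v"
      using h_le[OF that(1,3), of v] h_le[OF edge_swap_in_perms[OF that(1,2)] that(3), of v] by linarith
    then have "\<bar>h n v \<pi> e\<bar> * \<bar>h n v \<pi> e' - h n v (swap e \<pi>) e'\<bar> \<le> h_bound v * (2 * h_bound v)"
      using h_le[OF that(1,2), of v] h_bound_nonneg by (intro mult_mono) auto
    then show ?thesis by (simp add: g_def abs_mult power2_eq_square)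
  qed
  have loc: "g \<pi> e e' = g \<rho> e e'" if "\<And>m. m \<in> ends e \<union> ends e' \<Longrightarrow> \<pi> m = \<rho> m"
    for \<pi> \<rho> :: "nat \<Rightarrow> nat" and e e'
  proof -
    have "h n v \<pi> e = h n v \<rho> e" "h n v \<pi> e' = h n v \<rho> e'"
      "h n v (swap e \<pi>) e' = h n v (swap e \<rho>) e'"
      by (rule h_local; use that in \<open>auto simp: ends_def Transposition.transpose_def\<close>)+
    then show ?thesis by (simp add: g_def)
  qed
  have 1: "hamming_lipschitz n (24 * (2 * (h_bound v)\<^sup>2) * real n ^ 2) (\<lambda>\<pi>. \<Sum>(e, e')\<in>adjacent_edges n. g \<pi> e e')"
    by (rule adjacent_sum_lipschitz[OF _ gb loc]) auto
  have 2: "hamming_lipschitz n (2 * (2 * (h_bound v)\<^sup>2) * (2 * real n)) (\<lambda>\<pi>. \<Sum>e\<in>edges n. g \<pi> e e)"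
  proof (rule local_sum_lipschitz[where supp = ends, OF finite_edges])
    fix e assume "e \<in> edges n"
    then show "ends e \<subseteq> {1..n}" by (auto simp: edges_def ends_def)
  next
    fix \<pi> \<rho> :: "nat \<Rightarrow> nat" and e assume "\<And>m. m \<in> ends e \<Longrightarrow> \<pi> m = \<rho> m"
    then show "g \<pi> e e = g \<rho> e e" by (intro loc) auto
  qed (use gb edges_at_vertex in simp_all)
  have "real n \<le> real n ^ 2" by (cases n) (auto simp: power2_eq_square)
  then have "(h_bound v)\<^sup>2 * real n \<le> (h_bound v)\<^sup>2 * real n ^ 2" by (intro mult_left_mono) auto
  then show ?thesis
    unfolding eq by (intro hamming_lipschitz_mono[OF hamming_lipschitz_add[OF 2 1]]) (simp add: mult_ac)
qed

lemma E_stein_var: "E n (stein_var n v) = 2 * E n (\<lambda>\<pi>. (U n v \<pi>)\<^sup>2)"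
proof -
  have "E n (\<lambda>\<pi>. (U n v \<pi>)\<^sup>2) = (\<Sum>e\<in>edges n. E n (\<lambda>\<pi>. h n v \<pi> e *\<^sub>R U n v \<pi>))"
    unfolding power2_eq_square by (subst U_def) (simp add: sum_distrib_right E_sum)
  also have "\<dots> = (\<Sum>e\<in>edges n. (1 / 2) *\<^sub>R E n (\<lambda>\<pi>. h n v \<pi> e *\<^sub>R (U n v \<pi> - U n v (swap e \<pi>))))"
    by (intro sum.cong refl stein_identity)
  also have "\<dots> = E n (stein_var n v) / 2"
    unfolding stein_var_def[abs_def] by (simp add: E_sum sum_divide_distrib)
  finally show ?thesis by simp
qed

lemma E_abs_le_sqrt: "E n (\<lambda>\<pi>. \<bar>F \<pi>\<bar>) \<le> sqrt (E n (\<lambda>\<pi>. (F \<pi>)\<^sup>2))" for F :: "_ \<Rightarrow> real"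
proof -
  have "(E n (\<lambda>\<pi>. \<bar>F \<pi>\<bar>))\<^sup>2 \<le> E n (\<lambda>\<pi>. (F \<pi>)\<^sup>2)"
    using E_Cauchy_Schwarz[of n "\<lambda>\<pi>. \<bar>F \<pi>\<bar>" "\<lambda>_. 1"] E_const[of n "1::real"] by simp
  then show ?thesis by (rule real_le_rsqrt)
qed

definition score_char :: "nat \<Rightarrow> real ^ 'l \<Rightarrow> real \<Rightarrow> complex" where
  "score_char n v s = E n (\<lambda>\<pi>. iexp (s * (U n v \<pi> / sqrt (E n (\<lambda>\<pi>. (U n v \<pi>)\<^sup>2)))))"

text \<open>
Let \<open>W\<close> be the standardised score and \<open>\<Delta>\<close> its change under the swap
of \<open>e\<close>, which is of order \<open>n^(-1/2)\<close>. The derivative of the characteristic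
function is \<open>E (\<i> W exp (\<i> s W))\<close>. The Stein identity turns it into a sum over
pairs of \<open>exp (\<i> s W) * (1 - exp (- \<i> s \<Delta>))\<close>, and the linear term of the
last factor yields \<open>- s G exp (\<i> s W)\<close>, where \<open>G\<close> is the normalised
\<open>stein_var\<close> with mean one. The first error in the bound is the standard deviation of
\<open>G\<close>, the second one is the quadratic remainder.
\<close>

lemma score_char_bound:
  fixes v :: "real ^ 'l" and t :: real and n :: nat
  defines "S \<equiv> E n (\<lambda>\<pi>. (U n v \<pi>)\<^sup>2)"
  assumes S: "S > 0"
  shows "norm (score_char n v t - complex_of_real (exp (- (t\<^sup>2) / 2)))
    \<le> (\<bar>t\<bar> * (sqrt (real n) * (28 * (h_bound v)\<^sup>2 * real n ^ 2 / S * (1 + K ^ 4)))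
        + t\<^sup>2 * (16 * (h_bound v) ^ 3 * real n ^ 4 / (S * sqrt S))) * \<bar>t\<bar>"
proof -
  define W where "W \<pi> = U n v \<pi> / sqrt S" for \<pi>
  define \<psi>' where "\<psi>' s = E n (\<lambda>\<pi>. (\<i> * W \<pi>) * iexp (s * W \<pi>))" for s
  define G where "G \<pi> = 1 / (2 * S) * stein_var n v \<pi>" for \<pi>
  have char_eq: "score_char n v s = E n (\<lambda>\<pi>. iexp (s * W \<pi>))" for s
    by (simp add: score_char_def W_def S_def)
  have sS: "sqrt S > 0" "sqrt S * sqrt S = S" using S by auto
  have deriv: "(score_char n v has_vector_derivative \<psi>' s) (at s)" for s
  proof -
    have "((\<lambda>s. iexp (s * w)) has_vector_derivative (\<i> * w) * iexp (s * w)) (at s)" for w :: real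
    proof -
      have "((\<lambda>z. exp (\<i> * (z * w))) has_field_derivative exp (\<i> * (complex_of_real s * w)) * (\<i> * w)) (at (complex_of_real s))"
        by (auto intro!: derivative_eq_intros)
      from has_vector_derivative_real_field[OF this] show ?thesis by (simp add: mult.commute)
    qed
    then show ?thesis
      unfolding char_eq[abs_def] \<psi>'_def E_def
      by (intro has_vector_derivative_sum bounded_linear.has_vector_derivative[OF bounded_linear_scaleR_right])
  qed
  have EG: "E n G = 1" unfolding G_def E_cmult E_stein_var using S by (simp add: S_def)
  define g where "g = 28 * (h_bound v)\<^sup>2 * real n ^ 2 / S"
  have "hamming_lipschitz n g G"
    unfolding G_def g_def
    by (rule hamming_lipschitz_scale[OF stein_var_lipschitz]) (use S in \<open>simp_all add: mult_ac\<close>)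
  from E_variance[OF this] have "E n (\<lambda>\<pi>. (G \<pi> - 1)\<^sup>2) \<le> real n * (g * (1 + K ^ 4))\<^sup>2"
    by (simp add: EG)
  from real_sqrt_le_mono[OF this]
  have "sqrt (E n (\<lambda>\<pi>. (G \<pi> - 1)\<^sup>2)) \<le> sqrt (real n) * \<bar>g * (1 + K ^ 4)\<bar>"
    by (simp only: real_sqrt_mult real_sqrt_abs)
  moreover have "g * (1 + K ^ 4) \<ge> 0" using S by (simp add: g_def K_def)
  ultimately have VG: "E n (\<lambda>\<pi>. \<bar>G \<pi> - 1\<bar>) \<le> sqrt (real n) * (g * (1 + K ^ 4))"
    using E_abs_le_sqrt[of n "\<lambda>\<pi>. G \<pi> - 1"] by linarith
  define R where "R = 16 * (h_bound v) ^ 3 * real n ^ 4 / (S * sqrt S)"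
  have R0: "R \<ge> 0" using S h_bound_nonneg by (simp add: R_def)
  have main: "norm (\<psi>' s + s *\<^sub>R score_char n v s) \<le> \<bar>s\<bar> * (sqrt (real n) * (g * (1 + K ^ 4))) + s\<^sup>2 * R" for s
  proof -
    define \<Delta> where "\<Delta> \<pi> e = W \<pi> - W (swap e \<pi>)" for \<pi> e
    (* The remainder of the first-order expansion of the factor that the swap contributes. *)
    define r where "r \<pi> e = 1 - iexp (- (s * \<Delta> \<pi> e)) - \<i> * complex_of_real (s * \<Delta> \<pi> e)" for \<pi> e
    have "\<psi>' s = (\<i> / sqrt S) * (\<Sum>e\<in>edges n. E n (\<lambda>\<pi>. h n v \<pi> e *\<^sub>R iexp (s * W \<pi>)))"
    proof -
      have "\<psi>' s = E n (\<lambda>\<pi>. (\<i> / sqrt S) * (\<Sum>e\<in>edges n. h n v \<pi> e *\<^sub>R iexp (s * W \<pi>)))"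
        unfolding \<psi>'_def
        by (rule E_cong) (simp add: W_def U_def scaleR_conv_of_real flip: sum_distrib_right)
      then show ?thesis by (simp only: E_cmult E_sum)
    qed
    also have "\<dots> = (\<i> / sqrt S) * (\<Sum>e\<in>edges n. (1 / 2) *\<^sub>R E n (\<lambda>\<pi>. h n v \<pi> e *\<^sub>R (iexp (s * W \<pi>) - iexp (s * W (swap e \<pi>)))))"
    proof -
      have "(\<Sum>e\<in>edges n. E n (\<lambda>\<pi>. h n v \<pi> e *\<^sub>R iexp (s * W \<pi>)))
        = (\<Sum>e\<in>edges n. (1 / 2) *\<^sub>R E n (\<lambda>\<pi>. h n v \<pi> e *\<^sub>R (iexp (s * W \<pi>) - iexp (s * W (swap e \<pi>)))))"
      proof (rule sum.cong[OF refl])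
        fix e assume "e \<in> edges n"
        then show "E n (\<lambda>\<pi>. h n v \<pi> e *\<^sub>R iexp (s * W \<pi>))
          = (1 / 2) *\<^sub>R E n (\<lambda>\<pi>. h n v \<pi> e *\<^sub>R (iexp (s * W \<pi>) - iexp (s * W (swap e \<pi>))))"
          by (rule stein_identity)
      qed
      then show ?thesis by (rule arg_cong)
    qed
    also have "\<dots> = E n (\<lambda>\<pi>. \<Sum>e\<in>edges n. (\<i> * h n v \<pi> e / (2 * sqrt S)) * (iexp (s * W \<pi>) - iexp (s * W (swap e \<pi>))))"
      unfolding E_sum sum_distrib_left
    proof (rule sum.cong[OF refl])
      fix e
      let ?d = "\<lambda>\<pi>. iexp (s * W \<pi>) - iexp (s * W (swap e \<pi>))"
      have "(\<i> / sqrt S) * ((1 / 2) *\<^sub>R E n (\<lambda>\<pi>. h n v \<pi> e *\<^sub>R ?d \<pi>))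
        = (\<i> / (2 * sqrt S)) * E n (\<lambda>\<pi>. h n v \<pi> e *\<^sub>R ?d \<pi>)"
        by (simp add: scaleR_conv_of_real)
      also have "\<dots> = E n (\<lambda>\<pi>. (\<i> / (2 * sqrt S)) * (h n v \<pi> e *\<^sub>R ?d \<pi>))"
        by (rule E_cmult[symmetric])
      also have "\<dots> = E n (\<lambda>\<pi>. (\<i> * h n v \<pi> e / (2 * sqrt S)) * ?d \<pi>)"
      proof (rule E_cong)
        fix \<pi>
        show "(\<i> / (2 * sqrt S)) * (h n v \<pi> e *\<^sub>R ?d \<pi>) = (\<i> * h n v \<pi> e / (2 * sqrt S)) * ?d \<pi>"
          unfolding scaleR_conv_of_real by (simp add: mult.assoc)
      qed
      finally show "(\<i> / sqrt S) * ((1 / 2) *\<^sub>R E n (\<lambda>\<pi>. h n v \<pi> e *\<^sub>R ?d \<pi>))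
        = E n (\<lambda>\<pi>. (\<i> * h n v \<pi> e / (2 * sqrt S)) * ?d \<pi>)" .
    qed
    also have "\<dots> = E n (\<lambda>\<pi>. - (s * G \<pi>) * iexp (s * W \<pi>)
        + (\<Sum>e\<in>edges n. (\<i> * h n v \<pi> e / (2 * sqrt S)) * (iexp (s * W \<pi>) * r \<pi> e)))"
    proof (rule E_cong)
      fix \<pi>
      have a: "iexp (s * W \<pi>) - iexp (s * W (swap e \<pi>)) = iexp (s * W \<pi>) * (\<i> * complex_of_real (s * \<Delta> \<pi> e)) + iexp (s * W \<pi>) * r \<pi> e" for e
      proof -
        have "iexp (s * W (swap e \<pi>)) = iexp (s * W \<pi>) * iexp (- (s * \<Delta> \<pi> e))"
          by (simp add: \<Delta>_def algebra_simps flip: exp_add)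
        then show ?thesis by (simp add: r_def algebra_simps)
      qed
      have b: "(\<Sum>e\<in>edges n. (\<i> * h n v \<pi> e / (2 * sqrt S)) * (iexp (s * W \<pi>) * (\<i> * complex_of_real (s * \<Delta> \<pi> e))))
          = - (s * G \<pi>) * iexp (s * W \<pi>)"
      proof -
        have "(\<i> * h n v \<pi> e / (2 * sqrt S)) * (iexp (s * W \<pi>) * (\<i> * complex_of_real (s * \<Delta> \<pi> e)))
          = complex_of_real (- s * (1 / (2 * S) * (h n v \<pi> e * (U n v \<pi> - U n v (swap e \<pi>))))) * iexp (s * W \<pi>)" for e
        proof -
          have "(\<i> * h n v \<pi> e / (2 * sqrt S)) * (iexp (s * W \<pi>) * (\<i> * complex_of_real (s * \<Delta> \<pi> e)))
            = (\<i> * \<i>) * complex_of_real (s * (h n v \<pi> e * (\<Delta> \<pi> e / (2 * sqrt S)))) * iexp (s * W \<pi>)"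
            by (simp add: mult_ac)
          also have "\<Delta> \<pi> e / (2 * sqrt S) = 1 / (2 * S) * (U n v \<pi> - U n v (swap e \<pi>))"
            using sS by (simp add: \<Delta>_def W_def field_simps)
          finally show ?thesis by (simp add: mult_ac)
        qed
        then have "(\<Sum>e\<in>edges n. (\<i> * h n v \<pi> e / (2 * sqrt S)) * (iexp (s * W \<pi>) * (\<i> * complex_of_real (s * \<Delta> \<pi> e))))
          = complex_of_real (\<Sum>e\<in>edges n. - s * (1 / (2 * S) * (h n v \<pi> e * (U n v \<pi> - U n v (swap e \<pi>))))) * iexp (s * W \<pi>)"
          by (simp only: of_real_sum sum_distrib_right)
        also have "(\<Sum>e\<in>edges n. - s * (1 / (2 * S) * (h n v \<pi> e * (U n v \<pi> - U n v (swap e \<pi>))))) = - (s * G \<pi>)"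
          unfolding G_def stein_var_def by (simp only: sum_distrib_left mult_minus_left sum_negf)
        finally show ?thesis by simp
      qed
      show "(\<Sum>e\<in>edges n. (\<i> * h n v \<pi> e / (2 * sqrt S)) * (iexp (s * W \<pi>) - iexp (s * W (swap e \<pi>))))
        = - (s * G \<pi>) * iexp (s * W \<pi>) + (\<Sum>e\<in>edges n. (\<i> * h n v \<pi> e / (2 * sqrt S)) * (iexp (s * W \<pi>) * r \<pi> e))"
        unfolding a distrib_left sum.distrib b ..
    qed
    finally have "\<psi>' s + s *\<^sub>R score_char n v s = E n (\<lambda>\<pi>. - (s * G \<pi>) * iexp (s * W \<pi>)
        + (\<Sum>e\<in>edges n. (\<i> * h n v \<pi> e / (2 * sqrt S)) * (iexp (s * W \<pi>) * r \<pi> e)) + s *\<^sub>R iexp (s * W \<pi>))"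
      unfolding char_eq by (simp only: E_add E_scaleR)
    then have "norm (\<psi>' s + s *\<^sub>R score_char n v s) = norm (E n (\<lambda>\<pi>. - (s * G \<pi>) * iexp (s * W \<pi>)
        + (\<Sum>e\<in>edges n. (\<i> * h n v \<pi> e / (2 * sqrt S)) * (iexp (s * W \<pi>) * r \<pi> e)) + s *\<^sub>R iexp (s * W \<pi>)))"
      by (rule arg_cong)
    also have "\<dots> \<le> E n (\<lambda>\<pi>. \<bar>s\<bar> * \<bar>G \<pi> - 1\<bar> + s\<^sup>2 * R)"
    proof (rule order.trans[OF norm_E_le E_mono])
      have three: "norm (a1 + a2 + a3) \<le> x1 + x2"
        if "a1 + a3 = x" "norm x = x1" "norm a2 \<le> x2" for a1 a2 a3 x :: complex and x1 x2
      proof -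
        have eq3: "a1 + a2 + a3 = x + a2" unfolding that(1)[symmetric] by (simp only: add_ac)
        show ?thesis unfolding eq3 using norm_triangle_ineq[of x a2] that(2,3) by linarith
      qed
      fix \<pi> assume \<pi>: "\<pi> \<in> perms n"
      have 1: "- (s * G \<pi>) * iexp (s * W \<pi>) + s *\<^sub>R iexp (s * W \<pi>) = complex_of_real (- s * (G \<pi> - 1)) * iexp (s * W \<pi>)"
        by (simp add: scaleR_conv_of_real algebra_simps)
      have rb: "norm ((\<i> * h n v \<pi> e / (2 * sqrt S)) * (iexp (s * W \<pi>) * r \<pi> e)) \<le> s\<^sup>2 * (16 * (h_bound v) ^ 3 * real n ^ 2 / (S * sqrt S))"
        if e: "e \<in> edges n" for e
      proof -
        have "\<bar>\<Delta> \<pi> e\<bar> = \<bar>U n v \<pi> - U n v (swap e \<pi>)\<bar> / sqrt S"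
          using sS by (simp add: \<Delta>_def W_def flip: diff_divide_distrib)
        also have "\<dots> \<le> 8 * h_bound v * real n / sqrt S"
          using U_swap_diff[OF \<pi> e] sS by (intro divide_right_mono) auto
        finally have "\<bar>\<Delta> \<pi> e\<bar> \<le> 8 * h_bound v * real n / sqrt S" .
        then have "(\<Delta> \<pi> e)\<^sup>2 \<le> (8 * h_bound v * real n / sqrt S)\<^sup>2"
          by (metis abs_ge_zero power2_abs power_mono)
        also have "\<dots> = 64 * (h_bound v)\<^sup>2 * real n ^ 2 / S" using S by (simp add: power_divide power_mult_distrib)
        finally have \<Delta>2: "(\<Delta> \<pi> e)\<^sup>2 \<le> 64 * (h_bound v)\<^sup>2 * real n ^ 2 / S" .
        have "norm (r \<pi> e) \<le> (s * \<Delta> \<pi> e)\<^sup>2 / 2" unfolding r_def by (rule iexp_first_order)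
        also have "\<dots> = s\<^sup>2 * ((\<Delta> \<pi> e)\<^sup>2 / 2)" by (simp add: power_mult_distrib)
        also have "\<dots> \<le> s\<^sup>2 * (32 * (h_bound v)\<^sup>2 * real n ^ 2 / S)"
          using \<Delta>2 by (intro mult_left_mono) auto
        finally have "norm (r \<pi> e) \<le> s\<^sup>2 * (32 * (h_bound v)\<^sup>2 * real n ^ 2 / S)" .
        then have "\<bar>h n v \<pi> e\<bar> / (2 * sqrt S) * norm (r \<pi> e) \<le> h_bound v / (2 * sqrt S) * (s\<^sup>2 * (32 * (h_bound v)\<^sup>2 * real n ^ 2 / S))"
          using h_le[OF \<pi> e, of v] sS h_bound_nonneg by (intro mult_mono divide_right_mono) auto
        also have "\<dots> = s\<^sup>2 * (16 * (h_bound v) ^ 3 * real n ^ 2 / (S * sqrt S))"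
          by (simp add: power3_eq_cube power2_eq_square mult_ac)
        finally have le: "\<bar>h n v \<pi> e\<bar> / (2 * sqrt S) * norm (r \<pi> e)
          \<le> s\<^sup>2 * (16 * (h_bound v) ^ 3 * real n ^ 2 / (S * sqrt S))" .
        have n1: "norm (iexp (s * W \<pi>)) = 1" by (rule norm_exp_i_times)
        have n2: "norm (\<i> * h n v \<pi> e / (2 * sqrt S)) = \<bar>h n v \<pi> e\<bar> / (2 * sqrt S)"
          using S by (simp add: norm_mult norm_divide)
        show ?thesis using le unfolding norm_mult[of "\<i> * h n v \<pi> e / (2 * sqrt S)"] n2
          unfolding norm_mult[of "iexp (s * W \<pi>)"] n1 by simp
      qed
      have "norm (\<Sum>e\<in>edges n. (\<i> * h n v \<pi> e / (2 * sqrt S)) * (iexp (s * W \<pi>) * r \<pi> e))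
        \<le> real (card (edges n)) * (s\<^sup>2 * (16 * (h_bound v) ^ 3 * real n ^ 2 / (S * sqrt S)))"
        by (rule sum_norm_bound[OF rb])
      also have "\<dots> \<le> real n ^ 2 * (s\<^sup>2 * (16 * (h_bound v) ^ 3 * real n ^ 2 / (S * sqrt S)))"
        using h_bound_nonneg S by (intro mult_right_mono card_edges_le) auto
      also have "\<dots> = s\<^sup>2 * R" by (simp add: R_def power4_eq_xxxx power2_eq_square)
      finally have 2: "norm (\<Sum>e\<in>edges n. (\<i> * h n v \<pi> e / (2 * sqrt S)) * (iexp (s * W \<pi>) * r \<pi> e)) \<le> s\<^sup>2 * R" .
      have 3: "norm (complex_of_real (- s * (G \<pi> - 1)) * iexp (s * W \<pi>)) = \<bar>s\<bar> * \<bar>G \<pi> - 1\<bar>"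
        unfolding norm_mult by (simp only: norm_of_real abs_mult abs_minus norm_exp_i_times mult_1_right)
      show "norm (- (s * G \<pi>) * iexp (s * W \<pi>)
        + (\<Sum>e\<in>edges n. (\<i> * h n v \<pi> e / (2 * sqrt S)) * (iexp (s * W \<pi>) * r \<pi> e)) + s *\<^sub>R iexp (s * W \<pi>))
        \<le> \<bar>s\<bar> * \<bar>G \<pi> - 1\<bar> + s\<^sup>2 * R"
        by (rule three[OF 1 3 2])
    qed
    also have "\<dots> = \<bar>s\<bar> * E n (\<lambda>\<pi>. \<bar>G \<pi> - 1\<bar>) + s\<^sup>2 * R"
      using E_add[of n "\<lambda>\<pi>. \<bar>s\<bar> * \<bar>G \<pi> - 1\<bar>" "\<lambda>_. s\<^sup>2 * R"]
        E_cmult[of n "\<bar>s\<bar>" "\<lambda>\<pi>. \<bar>G \<pi> - 1\<bar>"] E_const[of n "s\<^sup>2 * R"] by linarith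
    also have "\<dots> \<le> \<bar>s\<bar> * (sqrt (real n) * (g * (1 + K ^ 4))) + s\<^sup>2 * R"
      by (intro add_right_mono mult_left_mono VG) auto
    finally show ?thesis .
  qed
  have zero: "score_char n v 0 = 1" by (simp add: char_eq E_const)
  show ?thesis
  proof (rule gaussian_ode_bound[OF zero deriv, of t])
    fix s assume s: "\<bar>s\<bar> \<le> \<bar>t\<bar>"
    then have "s\<^sup>2 \<le> t\<^sup>2" by (simp add: abs_le_square_iff)
    then have "\<bar>s\<bar> * (sqrt (real n) * (g * (1 + K ^ 4))) + s\<^sup>2 * R
      \<le> \<bar>t\<bar> * (sqrt (real n) * (g * (1 + K ^ 4))) + t\<^sup>2 * R"
      using s R0 \<open>g * (1 + K ^ 4) \<ge> 0\<close> by (intro add_mono mult_right_mono) auto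
    then show "norm (\<psi>' s + s *\<^sub>R score_char n v s)
      \<le> \<bar>t\<bar> * (sqrt (real n) * (28 * (h_bound v)\<^sup>2 * real n ^ 2 / S * (1 + K ^ 4)))
        + t\<^sup>2 * (16 * (h_bound v) ^ 3 * real n ^ 4 / (S * sqrt S))"
      using main[of s] unfolding g_def R_def by linarith
  qed
qed

lemma score_char_tendsto:
  assumes C: "\<forall>r. (\<lambda>x. f x $ r) \<in> class_C" and li: "ae_lin_indep f"
    and v: "\<forall>\<^sub>F n in sequentially. v n \<noteq> 0"
  shows "(\<lambda>n. score_char n (v n) t) \<longlonglongrightarrow> complex_of_real (exp (- (t\<^sup>2) / 2))"
proof -
  obtain c N where c: "c > 0"
    and low: "\<And>v n. n \<ge> N \<Longrightarrow> E n (\<lambda>\<pi>. (U n v \<pi>)\<^sup>2) \<ge> c * real n ^ 3 * (norm v)\<^sup>2"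
    using score_variance_lower[OF C li] by metis
  define C1 where "C1 = 448 * B\<^sup>2 * (1 + K ^ 4) / c"
  define C2 where "C2 = 1024 * B ^ 3 / (c * sqrt c)"
  have ev: "\<forall>\<^sub>F n in sequentially. norm (score_char n (v n) t - complex_of_real (exp (- (t\<^sup>2) / 2)))
     \<le> (\<bar>t\<bar> * C1 + t\<^sup>2 * C2) * \<bar>t\<bar> / sqrt (real n)"
    using v eventually_ge_at_top[of "max 1 N"]
  proof eventually_elim
    case (elim n)
    define u where "u = norm (v n)"
    define S where "S = E n (\<lambda>\<pi>. (U n (v n) \<pi>)\<^sup>2)"
    have n: "real n > 0" and u: "u > 0" using elim by (auto simp: u_def)
    have S_low: "S \<ge> c * real n ^ 3 * u\<^sup>2" using low[of n "v n"] elim by (simp add: S_def u_def)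
    have S0: "c * real n ^ 3 * u\<^sup>2 > 0" using c n u by simp
    have S: "S > 0" using S_low S0 by linarith
    have K0: "1 + K ^ 4 > 0" by (simp add: K_def add_pos_pos)
    have sn: "sqrt (real n) > 0" "sqrt (real n) * sqrt (real n) = real n" using n by auto
    have 1: "sqrt (real n) * (28 * (h_bound (v n))\<^sup>2 * real n ^ 2 / S * (1 + K ^ 4)) \<le> C1 / sqrt (real n)"
    proof -
      have "28 * (h_bound (v n))\<^sup>2 * real n ^ 2 / S \<le> 28 * (h_bound (v n))\<^sup>2 * real n ^ 2 / (c * real n ^ 3 * u\<^sup>2)"
        by (rule divide_left_mono[OF S_low _ mult_pos_pos[OF S S0]]) simp
      then have "sqrt (real n) * (28 * (h_bound (v n))\<^sup>2 * real n ^ 2 / S * (1 + K ^ 4))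
        \<le> sqrt (real n) * (28 * (h_bound (v n))\<^sup>2 * real n ^ 2 / (c * real n ^ 3 * u\<^sup>2) * (1 + K ^ 4))"
        using K0 by (intro mult_left_mono mult_right_mono) auto
      also have "28 * (h_bound (v n))\<^sup>2 * real n ^ 2 / (c * real n ^ 3 * u\<^sup>2) = 448 * B\<^sup>2 / c / real n"
        using u n c by (simp add: h_bound_def u_def[symmetric] field_simps power2_eq_square power3_eq_cube)
      also have "sqrt (real n) * (448 * B\<^sup>2 / c / real n * (1 + K ^ 4)) = C1 * (sqrt (real n) / real n)"
        by (simp add: C1_def)
      also have "sqrt (real n) / real n = 1 / sqrt (real n)"
        using sn n by (simp add: field_simps)
      finally show ?thesis by simp
    qed
    have 2: "16 * (h_bound (v n)) ^ 3 * real n ^ 4 / (S * sqrt S) \<le> C2 / sqrt (real n)"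
    proof -
      let ?S = "c * real n ^ 3 * u\<^sup>2"
      have "?S * sqrt ?S \<le> S * sqrt S" using S_low S0 S by (intro mult_mono) auto
      then have "16 * (h_bound (v n)) ^ 3 * real n ^ 4 / (S * sqrt S) \<le> 16 * (h_bound (v n)) ^ 3 * real n ^ 4 / (?S * sqrt ?S)"
        by (rule divide_left_mono[OF _ _ mult_pos_pos]) (use S0 S h_bound_nonneg in simp_all)
      also have "sqrt ?S = sqrt c * (real n * sqrt (real n)) * u"
        using u n by (simp add: real_sqrt_mult real_sqrt_power power3_eq_cube)
      also have "16 * (h_bound (v n)) ^ 3 * real n ^ 4 / (?S * (sqrt c * (real n * sqrt (real n)) * u)) = C2 / sqrt (real n)"
        using u n c by (simp add: C2_def h_bound_def u_def[symmetric] field_simps power2_eq_square power3_eq_cube power4_eq_xxxx)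
      finally show ?thesis .
    qed
    have "norm (score_char n (v n) t - complex_of_real (exp (- (t\<^sup>2) / 2)))
      \<le> (\<bar>t\<bar> * (sqrt (real n) * (28 * (h_bound (v n))\<^sup>2 * real n ^ 2 / S * (1 + K ^ 4)))
        + t\<^sup>2 * (16 * (h_bound (v n)) ^ 3 * real n ^ 4 / (S * sqrt S))) * \<bar>t\<bar>"
      using score_char_bound[of n "v n" t] S by (simp add: S_def)
    also have "\<dots> \<le> (\<bar>t\<bar> * (C1 / sqrt (real n)) + t\<^sup>2 * (C2 / sqrt (real n))) * \<bar>t\<bar>"
      by (intro mult_right_mono add_mono mult_left_mono 1 2) auto
    also have "\<dots> = (\<bar>t\<bar> * C1 + t\<^sup>2 * C2) * \<bar>t\<bar> / sqrt (real n)"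
      by (simp add: add_divide_distrib algebra_simps)
    finally show ?case .
  qed
  have "(\<lambda>n. (\<bar>t\<bar> * C1 + t\<^sup>2 * C2) * \<bar>t\<bar> / sqrt (real n)) \<longlonglongrightarrow> 0"
    by (intro tendsto_divide_0[OF tendsto_const] filterlim_at_top_imp_at_infinity
        filterlim_compose[OF sqrt_at_top filterlim_real_sequentially])
  then have "(\<lambda>n. score_char n (v n) t - complex_of_real (exp (- (t\<^sup>2) / 2))) \<longlonglongrightarrow> 0"
    by (rule Lim_null_comparison[OF ev])
  then show ?thesis by (rule LIM_zero_cancel)
qed

lemma integral_perm_model: "integral\<^sup>L (perm_model f n \<theta>) F = E n F"
  for F :: "_ \<Rightarrow> 'b :: {banach, second_countable_topology}"
  unfolding perm_model_def E_def prob_def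
  by (rule lebesgue_integral_point_measure_finite) (auto simp: finite_perms)

lemma measure_perm_model:
  assumes "A \<subseteq> perms n"
  shows "measure (perm_model f n \<theta>) A = E n (indicator A)"
proof -
  have "emeasure (perm_model f n \<theta>) A = (\<Sum>\<pi>\<in>A. ennreal (prob n \<pi>))"
    unfolding perm_model_def prob_def by (rule emeasure_point_measure_finite[OF finite_perms assms])
  also have "\<dots> = ennreal (sum (prob n) A)"
    by (rule sum_ennreal) (simp add: less_imp_le[OF prob_pos])
  finally have "measure (perm_model f n \<theta>) A = sum (prob n) A"
    by (simp add: measure_def sum_nonneg less_imp_le[OF prob_pos])
  also have "\<dots> = (\<Sum>\<pi>\<in>perms n. prob n \<pi> *\<^sub>R indicator A \<pi>)"
    by (rule sum.mono_neutral_cong_left[OF finite_perms assms]) auto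
  finally show ?thesis by (simp only: E_def)
qed

theorem score_clt:
  assumes C: "\<forall>r. (\<lambda>x. f x $ r) \<in> class_C" and li: "ae_lin_indep f"
    and v: "\<forall>\<^sub>F n in sequentially. v n \<noteq> 0"
  shows "(\<lambda>n. measure (perm_model f n \<theta>)
     {\<pi>\<in>perms n. U n (v n) \<pi> / sqrt (E n (\<lambda>\<pi>. (U n (v n) \<pi>)\<^sup>2)) \<le> x})
     \<longlonglongrightarrow> cdf std_normal_distribution x"
proof -
  define W where "W n \<pi> = U n (v n) \<pi> / sqrt (E n (\<lambda>\<pi>. (U n (v n) \<pi>)\<^sup>2))" for n \<pi>
  define M where "M n = distr (perm_model f n \<theta>) borel (W n)" for n
  have meas: "W n \<in> borel_measurable (perm_model f n \<theta>)" for n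
    by (simp add: perm_model_def measurable_def sets_point_measure space_point_measure)
  have rd: "real_distribution (M n)" for n
    unfolding M_def by (rule prob_space.real_distribution_distr[OF prob_space_perm_model meas])
  have "char (M n) t = score_char n (v n) t" for n t
  proof -
    have "char (M n) t = (LINT \<pi>|perm_model f n \<theta>. iexp (t * W n \<pi>))"
      unfolding char_def M_def by (rule integral_distr[OF meas]) measurable
    then show ?thesis by (simp add: integral_perm_model score_char_def W_def)
  qed
  then have "weak_conv_m M std_normal_distribution"
    using score_char_tendsto[OF C li v]
    by (intro levy_continuity rd real_dist_normal_dist) (simp add: char_std_normal_distribution)
  moreover have "isCont (cdf std_normal_distribution) x" by (rule isCont_cdf_std_normal)
  ultimately have "(\<lambda>n. cdf (M n) x) \<longlonglongrightarrow> cdf std_normal_distribution x"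
    by (simp add: weak_conv_m_def weak_conv_def)
  moreover have "cdf (M n) x = measure (perm_model f n \<theta>) {\<pi>\<in>perms n. W n \<pi> \<le> x}" for n
  proof -
    have "W n -` {..x} \<inter> space (perm_model f n \<theta>) = {\<pi>\<in>perms n. W n \<pi> \<le> x}"
      by (auto simp: perm_model_def space_point_measure)
    then show ?thesis unfolding cdf_def M_def by (subst measure_distr[OF meas]) auto
  qed
  ultimately show ?thesis by (simp add: W_def)
qed

end

section \<open>The pseudo-likelihood equation near the true parameter\<close>

lemma matrix_form_sum:
  fixes v w :: "real ^ 'l" and x z :: "'t \<Rightarrow> real ^ 'l"
  shows "v \<bullet> ((\<chi> p q. c * (\<Sum>t\<in>I. a t * (x t $ p * z t $ q))) *v w)
    = c * (\<Sum>t\<in>I. a t * ((v \<bullet> x t) * (w \<bullet> z t)))"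
proof -
  have "v \<bullet> ((\<chi> p q. c * (\<Sum>t\<in>I. a t * (x t $ p * z t $ q))) *v w)
    = (\<Sum>p\<in>UNIV. \<Sum>q\<in>UNIV. \<Sum>t\<in>I. c * (a t * ((v $ p * x t $ p) * (w $ q * z t $ q))))"
    by (simp add: inner_vec_def matrix_vector_mult_def sum_distrib_left sum_distrib_right mult_ac)
  also have "\<dots> = (\<Sum>p\<in>UNIV. \<Sum>t\<in>I. \<Sum>q\<in>UNIV. c * (a t * ((v $ p * x t $ p) * (w $ q * z t $ q))))"
    by (intro sum.cong refl sum.swap)
  also have "\<dots> = (\<Sum>t\<in>I. \<Sum>p\<in>UNIV. \<Sum>q\<in>UNIV. c * (a t * ((v $ p * x t $ p) * (w $ q * z t $ q))))"
    by (rule sum.swap)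
  also have "\<dots> = c * (\<Sum>t\<in>I. a t * ((v \<bullet> x t) * (w \<bullet> z t)))"
  proof -
    have "(v \<bullet> x t) * (w \<bullet> z t) = (\<Sum>p\<in>UNIV. \<Sum>q\<in>UNIV. (v $ p * x t $ p) * (w $ q * z t $ q))" for t
      by (simp add: inner_vec_def sum_product)
    then show ?thesis by (simp only: sum_distrib_left)
  qed
  finally show ?thesis .
qed

lemma abs_matrix_form_le:
  fixes A :: "real ^ 'l ^ 'l"
  assumes "\<And>p q. \<bar>A $ p $ q\<bar> \<le> \<eta>"
  shows "\<bar>v \<bullet> (A *v w)\<bar> \<le> real CARD('l) ^ 2 * \<eta> * (norm v * norm w)"
proof -
  have "v \<bullet> (A *v w) = (\<Sum>p\<in>UNIV. \<Sum>q\<in>UNIV. v $ p * (A $ p $ q * w $ q))"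
    by (simp add: inner_vec_def matrix_vector_mult_def sum_distrib_left)
  also have "\<bar>\<dots>\<bar> \<le> (\<Sum>p\<in>UNIV. \<bar>\<Sum>q\<in>UNIV. v $ p * (A $ p $ q * w $ q)\<bar>)" by (rule sum_abs)
  also have "\<dots> \<le> (\<Sum>p\<in>(UNIV :: 'l set). \<Sum>q\<in>(UNIV :: 'l set). \<eta> * (norm v * norm w))"
  proof (intro sum_mono order.trans[OF sum_abs])
    fix p q
    have "\<bar>v $ p\<bar> * (\<bar>A $ p $ q\<bar> * \<bar>w $ q\<bar>) \<le> norm v * (\<eta> * norm w)"
      by (intro mult_mono component_le_norm_cart assms) (auto intro: order.trans[OF abs_ge_zero assms])
    then show "\<bar>v $ p * (A $ p $ q * w $ q)\<bar> \<le> \<eta> * (norm v * norm w)"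
      by (simp add: abs_mult mult_ac)
  qed
  also have "\<dots> = real CARD('l) ^ 2 * \<eta> * (norm v * norm w)" by (simp add: power2_eq_square)
  finally show ?thesis .
qed

lemma nonneg_mult_le_cancel:
  fixes a x z :: real
  assumes "a * x \<le> a * z" "0 \<le> a"
  shows "a = 0 \<or> x \<le> z"
proof (cases "a = 0")
  case False
  then have "0 < a" using assms(2) by simp
  then show ?thesis using assms(1) by simp
qed simp

lemma pos_def_invertible:
  fixes A :: "real ^ 'l ^ 'l"
  assumes "\<mu> > 0" "\<And>u. \<mu> * (norm u)\<^sup>2 \<le> u \<bullet> (A *v u)"
  shows "invertible A" "A *v (matrix_inv A *v d) = d" "norm (matrix_inv A *v d) \<le> norm d / \<mu>"
proof -
  have "u = 0" if "A *v u = 0" for u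
    using assms(2)[of u] that assms(1) by (simp add: mult_le_0_iff)
  then have "inj ((*v) A)"
    by (subst vec.inj_iff_eq_0) auto
  then show inv: "invertible A" by (metis invertible_left_inverse matrix_left_invertible_injective)
  have "A ** matrix_inv A = mat 1"
    using inv unfolding invertible_def matrix_inv_def by (rule someI2_ex) simp
  then show eq: "A *v (matrix_inv A *v d) = d" by (simp add: matrix_vector_mul_assoc)
  let ?u = "matrix_inv A *v d"
  have "\<mu> * (norm ?u)\<^sup>2 \<le> norm ?u * norm d"
    using assms(2)[of ?u] norm_cauchy_schwarz[of ?u d] unfolding eq by linarith
  then have "norm ?u * (\<mu> * norm ?u) \<le> norm ?u * norm d" by (simp add: power2_eq_square mult_ac)
  then have "norm ?u = 0 \<or> \<mu> * norm ?u \<le> norm d" by (rule nonneg_mult_le_cancel[OF _ norm_ge_zero])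
  then show "norm ?u \<le> norm d / \<mu>" using assms(1) by (auto simp: field_simps)
qed

context perm_gibbs begin

definition q :: "real \<Rightarrow> real" where "q x = \<sigma> x * (1 - \<sigma> x)"

lemma one_minus_\<sigma>: "1 - \<sigma> x = \<sigma> (- x)"
proof -
  have "1 + exp x > 0" by (simp add: add_pos_pos)
  then show ?thesis by (simp add: \<sigma>_def exp_minus field_simps)
qed

lemma q_eq: "exp x / (1 + exp x)\<^sup>2 = q x"
proof -
  have "1 + exp x > 0" by (simp add: add_pos_pos)
  then show ?thesis by (simp add: q_def \<sigma>_def field_simps power2_eq_square)
qed

lemma q_bounds: "0 < q x" "q x \<le> 1"
  using \<sigma>_bounds[of x] by (auto simp: q_def mult_le_one)

lemma deriv_\<sigma>: "(\<sigma> has_real_derivative - q x) (at x)"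
proof -
  have p: "1 + exp x > 0" by (simp add: add_pos_pos)
  have "((\<lambda>x. 1 / (1 + exp x)) has_real_derivative - (exp x / (1 + exp x)\<^sup>2)) (at x)"
    using p by (auto intro!: derivative_eq_intros simp: power2_eq_square)
  moreover have "\<sigma> = (\<lambda>x. 1 / (1 + exp x))" by (rule ext) (simp add: \<sigma>_def)
  ultimately show ?thesis by (simp add: q_eq)
qed

lemma \<sigma>_lipschitz: "\<bar>\<sigma> x - \<sigma> x'\<bar> \<le> \<bar>x - x'\<bar>"
proof -
  have "norm (\<sigma> x - \<sigma> x') \<le> 1 * norm (x - x')"
    by (rule field_differentiable_bound[of UNIV \<sigma> "\<lambda>x. - q x"])
      (use deriv_\<sigma> q_bounds in \<open>auto simp: abs_of_pos\<close>)
  then show ?thesis by simp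
qed

lemma q_lipschitz: "\<bar>q x - q x'\<bar> \<le> \<bar>x - x'\<bar>"
proof -
  have "q x - q x' = (\<sigma> x - \<sigma> x') * (1 - \<sigma> x - \<sigma> x')" by (simp add: q_def algebra_simps)
  moreover have "\<bar>1 - \<sigma> x - \<sigma> x'\<bar> \<le> 1" using \<sigma>_bounds[of x] \<sigma>_bounds[of x'] by (simp add: abs_le_iff)
  ultimately have "\<bar>q x - q x'\<bar> \<le> \<bar>\<sigma> x - \<sigma> x'\<bar>" by (simp add: abs_mult mult_left_le)
  also have "\<dots> \<le> \<bar>x - x'\<bar>" by (rule \<sigma>_lipschitz)
  finally show ?thesis .
qed

lemma \<sigma>_taylor: "\<bar>\<sigma> x - \<sigma> a + q a * (x - a)\<bar> \<le> (x - a)\<^sup>2"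
proof -

  have conv: "convex (cball a \<bar>x - a\<bar>)" by simp
  have "norm ((\<lambda>z. \<sigma> z + q a * z) x - (\<lambda>z. \<sigma> z + q a * z) a) \<le> \<bar>x - a\<bar> * norm (x - a)"
  proof (rule field_differentiable_bound[OF conv, of _ "\<lambda>z. - q z + q a"])
    fix z assume z: "z \<in> cball a \<bar>x - a\<bar>"
    show "((\<lambda>z. \<sigma> z + q a * z) has_field_derivative - q z + q a) (at z within cball a \<bar>x - a\<bar>)"
      by (rule has_field_derivative_at_within) (auto intro!: derivative_eq_intros deriv_\<sigma>)
    show "norm (- q z + q a) \<le> \<bar>x - a\<bar>"
      using q_lipschitz[of a z] z by (simp add: dist_real_def)
  qed (auto simp: dist_real_def)
  then show ?thesis by (simp add: algebra_simps power2_eq_square abs_mult_self_eq)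
qed

lemma \<sigma>_strict_antimono: "x < x' \<Longrightarrow> \<sigma> x' < \<sigma> x"
  by (auto simp: \<sigma>_def add_pos_pos intro!: divide_strict_left_mono mult_pos_pos)

definition score :: "nat \<Rightarrow> (nat \<Rightarrow> nat) \<Rightarrow> real ^ 'l \<Rightarrow> real ^ 'l" where
  "score n \<pi> \<tau> = (\<Sum>e\<in>edges n. \<sigma> (\<tau> \<bullet> y n \<pi> e) *\<^sub>R y n \<pi> e)"

lemma pl_root_iff: "pl_root f n \<pi> \<tau> \<longleftrightarrow> score n \<pi> \<tau> = 0"
  by (simp add: pl_root_def score_def \<sigma>_def)

lemma inner_score: "v \<bullet> score n \<pi> \<theta> = U n v \<pi>"
  by (simp add: score_def U_def h_def inner_sum_right mult.commute)

definition M :: real where "M = 4 * B"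

lemma M_nonneg: "0 \<le> M" using B_nonneg by (simp add: M_def)

lemma inner_y_le: "\<pi> \<in> perms n \<Longrightarrow> e \<in> edges n \<Longrightarrow> \<bar>v \<bullet> y n \<pi> e\<bar> \<le> norm v * M"
  unfolding M_def by (rule theta_y_le)

text \<open>
The bilinear forms of \<open>A_hat\<close> and \<open>Sigma_hat\<close>. Bounds on them are
immediate from bounds on the summands, with no matrix norm involved.
\<close>

definition A_form :: "nat \<Rightarrow> (nat \<Rightarrow> nat) \<Rightarrow> real ^ 'l \<Rightarrow> real ^ 'l \<Rightarrow> real ^ 'l \<Rightarrow> real" where
  "A_form n \<pi> \<tau> v w = (1 / real n ^ 2) * (\<Sum>e\<in>edges n. q (\<tau> \<bullet> y n \<pi> e) * ((v \<bullet> y n \<pi> e) * (w \<bullet> y n \<pi> e)))"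

definition S_form :: "nat \<Rightarrow> (nat \<Rightarrow> nat) \<Rightarrow> real ^ 'l \<Rightarrow> real ^ 'l \<Rightarrow> real ^ 'l \<Rightarrow> real" where
  "S_form n \<pi> \<tau> v w = (1 / real n ^ 3) * (\<Sum>(e, e')\<in>adjacent_edges n.
     \<sigma> (\<tau> \<bullet> y n \<pi> e) * \<sigma> (\<tau> \<bullet> y n \<pi> e') * ((v \<bullet> y n \<pi> e) * (w \<bullet> y n \<pi> e')))"

lemma A_form: "v \<bullet> (A_hat f n \<pi> \<tau> *v w) = A_form n \<pi> \<tau> v w"
proof -
  have "A_hat f n \<pi> \<tau> = (\<chi> p r. (1 / real n ^ 2) * (\<Sum>e\<in>edges n. q (\<tau> \<bullet> y n \<pi> e) * (y n \<pi> e $ p * y n \<pi> e $ r)))"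
    unfolding A_hat_def by (simp add: q_eq[symmetric] mult_ac)
  then show ?thesis by (simp only: matrix_form_sum A_form_def)
qed

lemma S_form: "v \<bullet> (Sigma_hat f n \<pi> \<tau> *v w) = S_form n \<pi> \<tau> v w"
proof -
  have "Sigma_hat f n \<pi> \<tau> = (\<chi> p r. (1 / real n ^ 3) * (\<Sum>t\<in>adjacent_edges n.
     (\<sigma> (\<tau> \<bullet> y n \<pi> (fst t)) * \<sigma> (\<tau> \<bullet> y n \<pi> (snd t))) * (y n \<pi> (fst t) $ p * y n \<pi> (snd t) $ r)))"
    unfolding Sigma_hat_def by (simp add: \<sigma>_def case_prod_unfold)
  then show ?thesis by (simp only: matrix_form_sum S_form_def case_prod_unfold)
qed

lemma A_form_commute: "A_form n \<pi> \<tau> v w = A_form n \<pi> \<tau> w v"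
  by (simp add: A_form_def mult.commute)

lemma edges_average_le:
  assumes "n > 0" "\<And>e. e \<in> edges n \<Longrightarrow> \<bar>g e\<bar> \<le> D" "0 \<le> D"
  shows "\<bar>(1 / real n ^ 2) * (\<Sum>e\<in>edges n. g e)\<bar> \<le> D"
proof -
  have "\<bar>\<Sum>e\<in>edges n. g e\<bar> \<le> (\<Sum>e\<in>edges n. \<bar>g e\<bar>)" by (rule sum_abs)
  also have "\<dots> \<le> (\<Sum>e\<in>edges n. D)" by (intro sum_mono assms)
  also have "\<dots> = card (edges n) * D" by simp
  also have "\<dots> \<le> real n ^ 2 * D" by (intro mult_right_mono card_edges_le assms)
  finally show ?thesis using assms(1) by (simp add: abs_mult field_simps)
qed

lemma card_adjacent_edges_le: "real (card (adjacent_edges n)) \<le> 12 * real n ^ 3"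
proof -
  have "adjacent_edges n \<subseteq> (\<Union>m\<in>{1..n}. {p\<in>adjacent_edges n. m \<in> ends (fst p) \<union> ends (snd p)})"
  proof
    fix p assume p: "p \<in> adjacent_edges n"
    then have "fst (fst p) \<in> {1..n}" by (auto simp: adjacent_edges_def edges_def)
    moreover have "fst (fst p) \<in> ends (fst p) \<union> ends (snd p)" by (simp add: ends_def)
    ultimately show "p \<in> (\<Union>m\<in>{1..n}. {p\<in>adjacent_edges n. m \<in> ends (fst p) \<union> ends (snd p)})"
      using p by blast
  qed
  then have "card (adjacent_edges n) \<le> card (\<Union>m\<in>{1..n}. {p\<in>adjacent_edges n. m \<in> ends (fst p) \<union> ends (snd p)})"
    by (intro card_mono) (auto simp: finite_adjacent_edges)
  also have "\<dots> \<le> (\<Sum>m\<in>{1..n}. card {p\<in>adjacent_edges n. m \<in> ends (fst p) \<union> ends (snd p)})"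
    by (rule card_UN_le) simp
  finally have "real (card (adjacent_edges n)) \<le> real (\<Sum>m\<in>{1..n}. card {p\<in>adjacent_edges n. m \<in> ends (fst p) \<union> ends (snd p)})"
    by (rule of_nat_mono)
  also have "\<dots> = (\<Sum>m\<in>{1..n}. real (card {p\<in>adjacent_edges n. m \<in> ends (fst p) \<union> ends (snd p)}))"
    by (rule of_nat_sum)
  also have "\<dots> \<le> (\<Sum>m\<in>{1..n}. 12 * real n ^ 2)" by (intro sum_mono adjacent_at_vertex)
  finally show ?thesis by (simp add: power2_eq_square power3_eq_cube)
qed

lemma adjacent_average_le:
  assumes "n > 0" "\<And>e e'. e \<in> edges n \<Longrightarrow> e' \<in> edges n \<Longrightarrow> \<bar>g e e'\<bar> \<le> D" "0 \<le> D"
  shows "\<bar>(1 / real n ^ 3) * (\<Sum>(e, e')\<in>adjacent_edges n. g e e')\<bar> \<le> 12 * D"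
proof -
  have "\<bar>\<Sum>(e, e')\<in>adjacent_edges n. g e e'\<bar> \<le> (\<Sum>p\<in>adjacent_edges n. \<bar>case p of (e, e') \<Rightarrow> g e e'\<bar>)"
    by (rule sum_abs)
  also have "\<dots> \<le> (\<Sum>p\<in>adjacent_edges n. D)"
    by (intro sum_mono) (use assms(2) in \<open>auto simp: adjacent_edges_def\<close>)
  also have "\<dots> = card (adjacent_edges n) * D" by simp
  also have "\<dots> \<le> (12 * real n ^ 3) * D" by (intro mult_right_mono card_adjacent_edges_le assms)
  finally show ?thesis using assms(1) by (simp add: abs_mult field_simps)
qed

lemma A_form_bound:
  assumes "\<pi> \<in> perms n" "n > 0"
  shows "\<bar>A_form n \<pi> \<tau> v w\<bar> \<le> M\<^sup>2 * (norm v * norm w)"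
  unfolding A_form_def
proof (rule edges_average_le[OF assms(2)])
  fix e assume e: "e \<in> edges n"
  have "\<bar>q (\<tau> \<bullet> y n \<pi> e)\<bar> * (\<bar>v \<bullet> y n \<pi> e\<bar> * \<bar>w \<bullet> y n \<pi> e\<bar>) \<le> 1 * ((norm v * M) * (norm w * M))"
    using q_bounds[of "\<tau> \<bullet> y n \<pi> e"] M_nonneg
    by (intro mult_mono inner_y_le[OF assms(1) e]) auto
  then show "\<bar>q (\<tau> \<bullet> y n \<pi> e) * ((v \<bullet> y n \<pi> e) * (w \<bullet> y n \<pi> e))\<bar> \<le> M\<^sup>2 * (norm v * norm w)"
    by (simp add: abs_mult power2_eq_square mult_ac)
qed (auto simp: M_nonneg)

lemma S_form_bound:
  assumes "\<pi> \<in> perms n" "n > 0"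
  shows "\<bar>S_form n \<pi> \<tau> v w\<bar> \<le> 12 * (M\<^sup>2 * (norm v * norm w))"
  unfolding S_form_def
proof (rule adjacent_average_le[OF assms(2)])
  fix e e' assume e: "e \<in> edges n" "e' \<in> edges n"
  have "(\<bar>\<sigma> (\<tau> \<bullet> y n \<pi> e)\<bar> * \<bar>\<sigma> (\<tau> \<bullet> y n \<pi> e')\<bar>) * (\<bar>v \<bullet> y n \<pi> e\<bar> * \<bar>w \<bullet> y n \<pi> e'\<bar>) \<le> (1 * 1) * ((norm v * M) * (norm w * M))"
    using \<sigma>_bounds[of "\<tau> \<bullet> y n \<pi> e"] \<sigma>_bounds[of "\<tau> \<bullet> y n \<pi> e'"] M_nonneg
    by (intro mult_mono inner_y_le[OF assms(1)] e) auto
  then show "\<bar>\<sigma> (\<tau> \<bullet> y n \<pi> e) * \<sigma> (\<tau> \<bullet> y n \<pi> e') * ((v \<bullet> y n \<pi> e) * (w \<bullet> y n \<pi> e'))\<bar> \<le> M\<^sup>2 * (norm v * norm w)"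
    by (simp add: abs_mult power2_eq_square mult_ac)
qed (auto simp: M_nonneg)

lemma A_form_lipschitz:
  assumes "\<pi> \<in> perms n" "n > 0"
  shows "\<bar>A_form n \<pi> \<tau> v w - A_form n \<pi> \<tau>' v w\<bar> \<le> M ^ 3 * norm (\<tau> - \<tau>') * (norm v * norm w)"
proof -
  have "A_form n \<pi> \<tau> v w - A_form n \<pi> \<tau>' v w
    = (1 / real n ^ 2) * (\<Sum>e\<in>edges n. (q (\<tau> \<bullet> y n \<pi> e) - q (\<tau>' \<bullet> y n \<pi> e)) * ((v \<bullet> y n \<pi> e) * (w \<bullet> y n \<pi> e)))"
    by (simp add: A_form_def left_diff_distrib sum_subtractf right_diff_distrib diff_divide_distrib)
  also have "\<bar>\<dots>\<bar> \<le> M ^ 3 * norm (\<tau> - \<tau>') * (norm v * norm w)"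
  proof (rule edges_average_le[OF assms(2)])
    fix e assume e: "e \<in> edges n"
    have "\<bar>q (\<tau> \<bullet> y n \<pi> e) - q (\<tau>' \<bullet> y n \<pi> e)\<bar> \<le> \<bar>(\<tau> - \<tau>') \<bullet> y n \<pi> e\<bar>"
      unfolding inner_diff_left by (rule q_lipschitz)
    also have "\<dots> \<le> norm (\<tau> - \<tau>') * M" by (rule inner_y_le[OF assms(1) e])
    finally have "\<bar>q (\<tau> \<bullet> y n \<pi> e) - q (\<tau>' \<bullet> y n \<pi> e)\<bar> * (\<bar>v \<bullet> y n \<pi> e\<bar> * \<bar>w \<bullet> y n \<pi> e\<bar>)
      \<le> (norm (\<tau> - \<tau>') * M) * ((norm v * M) * (norm w * M))"
      using M_nonneg by (intro mult_mono inner_y_le[OF assms(1) e]) auto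
    then show "\<bar>(q (\<tau> \<bullet> y n \<pi> e) - q (\<tau>' \<bullet> y n \<pi> e)) * ((v \<bullet> y n \<pi> e) * (w \<bullet> y n \<pi> e))\<bar>
      \<le> M ^ 3 * norm (\<tau> - \<tau>') * (norm v * norm w)"
      by (simp add: abs_mult power3_eq_cube mult_ac)
  qed (auto simp: M_nonneg)
  finally show ?thesis .
qed

lemma S_form_lipschitz:
  assumes "\<pi> \<in> perms n" "n > 0"
  shows "\<bar>S_form n \<pi> \<tau> v w - S_form n \<pi> \<tau>' v w\<bar> \<le> 24 * M ^ 3 * norm (\<tau> - \<tau>') * (norm v * norm w)"
proof -
  let ?s = "\<lambda>\<tau> e. \<sigma> (\<tau> \<bullet> y n \<pi> e)"
  have "S_form n \<pi> \<tau> v w - S_form n \<pi> \<tau>' v w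
    = (1 / real n ^ 3) * (\<Sum>(e, e')\<in>adjacent_edges n. (?s \<tau> e * ?s \<tau> e' - ?s \<tau>' e * ?s \<tau>' e') * ((v \<bullet> y n \<pi> e) * (w \<bullet> y n \<pi> e')))"
    by (simp add: S_form_def left_diff_distrib sum_subtractf right_diff_distrib diff_divide_distrib case_prod_unfold)
  also have "\<bar>\<dots>\<bar> \<le> 12 * (2 * M ^ 3 * norm (\<tau> - \<tau>') * (norm v * norm w))"
  proof (rule adjacent_average_le[OF assms(2)])
    fix e e' assume e: "e \<in> edges n" "e' \<in> edges n"
    have d: "\<bar>?s \<tau> e - ?s \<tau>' e\<bar> \<le> norm (\<tau> - \<tau>') * M" if "e \<in> edges n" for e
      using \<sigma>_lipschitz[of "\<tau> \<bullet> y n \<pi> e" "\<tau>' \<bullet> y n \<pi> e"] inner_y_le[OF assms(1) that, of "\<tau> - \<tau>'"]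
      unfolding inner_diff_left by linarith
    have "?s \<tau> e * ?s \<tau> e' - ?s \<tau>' e * ?s \<tau>' e' = (?s \<tau> e - ?s \<tau>' e) * ?s \<tau> e' + ?s \<tau>' e * (?s \<tau> e' - ?s \<tau>' e')"
      by (simp add: algebra_simps)
    also have "\<bar>\<dots>\<bar> \<le> \<bar>?s \<tau> e - ?s \<tau>' e\<bar> * \<bar>?s \<tau> e'\<bar> + \<bar>?s \<tau>' e\<bar> * \<bar>?s \<tau> e' - ?s \<tau>' e'\<bar>"
      unfolding abs_mult[symmetric] by (rule abs_triangle_ineq)
    also have "\<dots> \<le> (norm (\<tau> - \<tau>') * M) * 1 + 1 * (norm (\<tau> - \<tau>') * M)"
      using \<sigma>_bounds[of "\<tau> \<bullet> y n \<pi> e'"] \<sigma>_bounds[of "\<tau>' \<bullet> y n \<pi> e"] M_nonneg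
      by (intro add_mono mult_mono d e) auto
    finally have "\<bar>?s \<tau> e * ?s \<tau> e' - ?s \<tau>' e * ?s \<tau>' e'\<bar> * (\<bar>v \<bullet> y n \<pi> e\<bar> * \<bar>w \<bullet> y n \<pi> e'\<bar>)
      \<le> (2 * (norm (\<tau> - \<tau>') * M)) * ((norm v * M) * (norm w * M))"
      using M_nonneg by (intro mult_mono inner_y_le[OF assms(1)] e) (auto simp: mult.commute)
    then show "\<bar>(?s \<tau> e * ?s \<tau> e' - ?s \<tau>' e * ?s \<tau>' e') * ((v \<bullet> y n \<pi> e) * (w \<bullet> y n \<pi> e'))\<bar>
      \<le> 2 * M ^ 3 * norm (\<tau> - \<tau>') * (norm v * norm w)"
      by (simp add: abs_mult power3_eq_cube mult_ac)
  qed (auto simp: M_nonneg)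
  finally show ?thesis by (simp add: mult_ac)
qed

definition mean_score :: "nat \<Rightarrow> (nat \<Rightarrow> nat) \<Rightarrow> real ^ 'l \<Rightarrow> real ^ 'l" where
  "mean_score n \<pi> \<tau> = (1 / real n ^ 2) *\<^sub>R score n \<pi> \<tau>"

lemma mean_score_taylor:
  assumes "\<pi> \<in> perms n" "n > 0"
  shows "\<bar>v \<bullet> mean_score n \<pi> \<tau> - v \<bullet> mean_score n \<pi> \<theta> + A_form n \<pi> \<theta> v (\<tau> - \<theta>)\<bar>
    \<le> M ^ 3 * (norm (\<tau> - \<theta>))\<^sup>2 * norm v"
proof -
  let ?d = "\<tau> - \<theta>"
  let ?g = "\<lambda>e. (v \<bullet> y n \<pi> e) * (\<sigma> (\<tau> \<bullet> y n \<pi> e) - \<sigma> (\<theta> \<bullet> y n \<pi> e) + q (\<theta> \<bullet> y n \<pi> e) * (?d \<bullet> y n \<pi> e))"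
  have "v \<bullet> mean_score n \<pi> \<tau> - v \<bullet> mean_score n \<pi> \<theta> + A_form n \<pi> \<theta> v ?d
    = (1 / real n ^ 2) * (\<Sum>e\<in>edges n. ?g e)"
    by (simp add: mean_score_def score_def A_form_def inner_sum_right algebra_simps sum.distrib sum_subtractf
        diff_divide_distrib add_divide_distrib)
  also have "\<bar>\<dots>\<bar> \<le> M ^ 3 * (norm ?d)\<^sup>2 * norm v"
  proof (rule edges_average_le[OF assms(2)])
    fix e assume e: "e \<in> edges n"
    have "\<bar>\<sigma> (\<tau> \<bullet> y n \<pi> e) - \<sigma> (\<theta> \<bullet> y n \<pi> e) + q (\<theta> \<bullet> y n \<pi> e) * (?d \<bullet> y n \<pi> e)\<bar> \<le> (?d \<bullet> y n \<pi> e)\<^sup>2"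
      unfolding inner_diff_left by (rule \<sigma>_taylor)
    also have "\<dots> \<le> (norm ?d * M)\<^sup>2"
      using inner_y_le[OF assms(1) e, of ?d] by (metis abs_ge_zero power2_abs power_mono)
    finally have "\<bar>v \<bullet> y n \<pi> e\<bar> * \<bar>\<sigma> (\<tau> \<bullet> y n \<pi> e) - \<sigma> (\<theta> \<bullet> y n \<pi> e) + q (\<theta> \<bullet> y n \<pi> e) * (?d \<bullet> y n \<pi> e)\<bar>
      \<le> (norm v * M) * (norm ?d * M)\<^sup>2"
      using M_nonneg by (intro mult_mono inner_y_le[OF assms(1) e]) auto
    then show "\<bar>?g e\<bar> \<le> M ^ 3 * (norm ?d)\<^sup>2 * norm v"
      by (simp add: abs_mult power3_eq_cube power2_eq_square mult_ac)
  qed (auto simp: M_nonneg)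
  finally show ?thesis .
qed

lemma continuous_on_mean_score: "continuous_on S (mean_score n \<pi>)"
proof -
  have pos: "1 + exp x \<noteq> 0" for x :: real by (metis add_pos_pos exp_gt_zero less_irrefl zero_less_one)
  show ?thesis
    unfolding mean_score_def[abs_def] score_def \<sigma>_def by (intro continuous_intros) (simp add: pos)
qed

text \<open>
Each summand of the estimating equation is the gradient of a concave function of \<open>\<theta>
\<bullet> y\<close>, strictly so in the direction of \<open>y\<close>. The difference of two roots
is therefore orthogonal to all \<open>y\<close>, hence in the kernel of the positive definite form.
\<close>

lemma pl_root_unique:
  assumes "\<pi> \<in> perms n" "n > 0" "\<mu> > 0" "\<And>u. \<mu> * (norm u)\<^sup>2 \<le> A_form n \<pi> \<theta> u u"
    and "pl_root f n \<pi> a" "pl_root f n \<pi> b"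
  shows "a = b"
proof -
  let ?g = "\<lambda>e. ((a - b) \<bullet> y n \<pi> e) * (\<sigma> (b \<bullet> y n \<pi> e) - \<sigma> (a \<bullet> y n \<pi> e))"
  have "(\<Sum>e\<in>edges n. ?g e) = (a - b) \<bullet> (score n \<pi> b - score n \<pi> a)"
    unfolding score_def by (simp add: inner_sum_right right_diff_distrib sum_subtractf mult.commute inner_diff_right)
  also have "\<dots> = 0" using assms(5,6) by (simp add: pl_root_iff)
  finally have sum0: "(\<Sum>e\<in>edges n. ?g e) = 0" .
  have nonneg: "?g e \<ge> 0 \<and> (?g e = 0 \<longrightarrow> (a - b) \<bullet> y n \<pi> e = 0)" for e
  proof -
    consider "a \<bullet> y n \<pi> e < b \<bullet> y n \<pi> e" | "a \<bullet> y n \<pi> e = b \<bullet> y n \<pi> e" | "a \<bullet> y n \<pi> e > b \<bullet> y n \<pi> e" by linarith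
    then show ?thesis
    proof cases
      case 1
      then have "0 < ?g e"
        using \<sigma>_strict_antimono[OF 1] by (intro mult_neg_neg) (auto simp: inner_diff_left)
      then show ?thesis by linarith
    next
      case 2 then show ?thesis by (simp add: inner_diff_left)
    next
      case 3
      then have "0 < ?g e"
        using \<sigma>_strict_antimono[OF 3] by (intro mult_pos_pos) (auto simp: inner_diff_left)
      then show ?thesis by linarith
    qed
  qed
  have "\<forall>e\<in>edges n. ?g e = 0"
    using sum_nonneg_eq_0_iff[OF finite_edges, of n ?g] nonneg sum0 by blast
  then have "(a - b) \<bullet> y n \<pi> e = 0" if "e \<in> edges n" for e using nonneg that by blast
  then have "A_form n \<pi> \<theta> (a - b) (a - b) = 0" by (simp add: A_form_def)
  then have "\<mu> * (norm (a - b))\<^sup>2 \<le> 0" using assms(4)[of "a - b"] by simp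
  then show ?thesis using assms(3) by (simp add: mult_le_0_iff)
qed

text \<open>
On a ball of radius \<open>\<rho>\<close> the quadratic Taylor error is absorbed by half of the
positive definite form. Brouwer's fixed point theorem for \<open>\<tau> \<mapsto> closest_point
(\<tau> + mean_score \<tau>)\<close> gives a point at which the mean score satisfies a variational
inequality on the ball. Testing it against the centre shows that the point lies within \<open>2 * r
/ \<mu>\<close> of the centre, so in the interior; there the inequality can be tested in every
direction and forces the mean score to vanish.
\<close>

lemma pl_root_exists:
  assumes \<pi>: "\<pi> \<in> perms n" and n: "n > 0" and \<mu>: "\<mu> > 0" "\<And>u. \<mu> * (norm u)\<^sup>2 \<le> A_form n \<pi> \<theta> u u"
    and r: "norm (mean_score n \<pi> \<theta>) \<le> r" "4 * (M ^ 3 + 1) * r < \<mu>\<^sup>2"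
  obtains \<tau> where "pl_root f n \<pi> \<tau>" "norm (\<tau> - \<theta>) \<le> 2 * r / \<mu>"
proof -
  (* The summand 1 allows dividing by M3 even when M = 0. *)
  define M3 where "M3 = M ^ 3 + 1"
  have M3: "M3 > 0" "M ^ 3 \<le> M3" using M_nonneg by (auto simp: M3_def add_nonneg_pos)
  define \<rho> where "\<rho> = \<mu> / (2 * M3)"
  have r0: "r \<ge> 0" using r(1) norm_ge_zero order.trans by blast
  have \<rho>: "\<rho> > 0" "2 * r / \<mu> < \<rho>"
    using \<mu>(1) M3 r(2) unfolding \<rho>_def M3_def[symmetric] by (simp_all add: field_simps power2_eq_square)
  let ?S = "cball \<theta> \<rho>"
  let ?g = "mean_score n \<pi>"
  let ?F = "\<lambda>\<tau>. closest_point ?S (\<tau> + ?g \<tau>)"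
  have ne: "?S \<noteq> {}" using \<rho> by simp
  have cont: "continuous_on ?S ?F"
    by (rule continuous_on_compose2[OF continuous_on_closest_point[of ?S UNIV]])
      (use ne in \<open>auto intro!: continuous_intros continuous_on_mean_score\<close>)
  obtain \<tau> where \<tau>: "\<tau> \<in> ?S" "?F \<tau> = \<tau>"
    using brouwer[OF compact_cball convex_cball ne cont] closest_point_in_set[OF closed_cball ne] by blast
  (* The variational inequality that characterises the projection of \<tau> + ?g \<tau> onto the ball. *)
  have vi: "?g \<tau> \<bullet> (x - \<tau>) \<le> 0" if "x \<in> ?S" for x
    using closest_point_dot[OF convex_cball closed_cball that, of "\<tau> + ?g \<tau>"] \<tau>(2) by simp
  let ?d = "\<tau> - \<theta>"
  have d: "norm ?d \<le> \<rho>" using \<tau>(1) by (simp add: dist_norm norm_minus_commute)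
  have "0 \<le> ?d \<bullet> ?g \<tau>"
    using vi[of \<theta>] \<rho> by (simp add: inner_diff_right inner_diff_left inner_commute)
  also have "\<dots> \<le> ?d \<bullet> ?g \<theta> - A_form n \<pi> \<theta> ?d ?d + M ^ 3 * (norm ?d)\<^sup>2 * norm ?d"
    using mean_score_taylor[OF \<pi> n, of ?d \<tau>] by linarith
  also have "\<dots> \<le> norm ?d * r - \<mu> * (norm ?d)\<^sup>2 + (\<mu> / 2) * (norm ?d)\<^sup>2"
  proof -
    have "?d \<bullet> ?g \<theta> \<le> norm ?d * norm (?g \<theta>)" by (rule norm_cauchy_schwarz)
    also have "\<dots> \<le> norm ?d * r" by (intro mult_left_mono r) auto
    finally have 1: "?d \<bullet> ?g \<theta> \<le> norm ?d * r" .
    have "M ^ 3 * norm ?d \<le> M3 * \<rho>" using M3 d M_nonneg by (intro mult_mono) auto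
    also have "\<dots> = \<mu> / 2" using M3 by (simp add: \<rho>_def)
    finally have "M ^ 3 * norm ?d * (norm ?d)\<^sup>2 \<le> \<mu> / 2 * (norm ?d)\<^sup>2" by (intro mult_right_mono) auto
    then have "M ^ 3 * (norm ?d)\<^sup>2 * norm ?d \<le> \<mu> / 2 * (norm ?d)\<^sup>2" by (simp add: mult_ac)
    then show ?thesis using 1 \<mu>(2)[of ?d] by linarith
  qed
  finally have "norm ?d * (\<mu> / 2 * norm ?d) \<le> norm ?d * r" by (simp add: power2_eq_square algebra_simps)
  then have "norm ?d = 0 \<or> \<mu> / 2 * norm ?d \<le> r" by (rule nonneg_mult_le_cancel[OF _ norm_ge_zero])
  then have small: "norm ?d \<le> 2 * r / \<mu>" using \<mu>(1) r0 by (auto simp: field_simps)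
  then have lt: "norm ?d < \<rho>" using \<rho> by linarith
  (* A step length that keeps \<tau> + s * g inside the ball, even when g = 0. *)
  define s where "s = (\<rho> - norm ?d) / (norm (?g \<tau>) + 1)"
  have s: "s > 0" using lt by (simp add: s_def add_nonneg_pos)
  have "norm (s *\<^sub>R ?g \<tau>) \<le> \<rho> - norm ?d"
  proof -
    have "norm (s *\<^sub>R ?g \<tau>) = (\<rho> - norm ?d) * (norm (?g \<tau>) / (norm (?g \<tau>) + 1))"
      using lt by (simp add: s_def)
    also have "\<dots> \<le> (\<rho> - norm ?d) * 1"
      using lt by (intro mult_left_mono) (auto simp: divide_le_eq_1 add_nonneg_pos)
    finally show ?thesis by simp
  qed
  then have "\<tau> + s *\<^sub>R ?g \<tau> \<in> ?S"
    using norm_triangle_ineq[of ?d "s *\<^sub>R ?g \<tau>"]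
    by (simp add: dist_norm norm_minus_commute[of \<theta>] algebra_simps)
  from vi[OF this] have "s * (norm (?g \<tau>))\<^sup>2 \<le> 0" by (simp add: power2_norm_eq_inner)
  then have "?g \<tau> = 0" using s by (simp add: mult_le_0_iff)
  then have "pl_root f n \<pi> \<tau>" using n by (simp add: pl_root_iff mean_score_def)
  then show ?thesis using that small by blast
qed

text \<open>
By symmetry of \<open>A_hat\<close>, the plug-in variance is the quadratic form of
\<open>Sigma_hat\<close> at \<open>v = A_hat\<inverse> d\<close>.
\<close>

lemma sandwich_variance_form:
  fixes d :: "real ^ 'l" and n :: nat and \<pi> :: "nat \<Rightarrow> nat" and \<tau> :: "real ^ 'l"
  assumes "\<mu> > 0" "\<And>u. \<mu> * (norm u)\<^sup>2 \<le> A_form n \<pi> \<tau> u u"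
  defines "A \<equiv> A_hat f n \<pi> \<tau>"
  defines "v \<equiv> matrix_inv A *v d"
  shows "invertible A" "A *v v = d" "norm v \<le> norm d / \<mu>"
    "d \<bullet> ((matrix_inv A ** Sigma_hat f n \<pi> \<tau> ** matrix_inv A) *v d) = S_form n \<pi> \<tau> v v"
proof -
  have pd: "\<mu> * (norm u)\<^sup>2 \<le> u \<bullet> (A *v u)" for u
    using assms(2) by (simp add: A_def A_form)
  note P = pos_def_invertible[OF assms(1) pd]
  show "invertible A" by (rule P(1))
  show Av: "A *v v = d" unfolding v_def by (rule P(2))
  show "norm v \<le> norm d / \<mu>" unfolding v_def by (rule P(3))
  have sym: "u \<bullet> (A *v w) = (A *v u) \<bullet> w" for u w
    using A_form_commute[of n \<pi> \<tau> u w] unfolding A_form[symmetric] A_def[symmetric]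
    by (simp add: inner_commute)
  define x where "x = Sigma_hat f n \<pi> \<tau> *v v"
  define z where "z = matrix_inv A *v x"
  have Az: "A *v z = x" unfolding z_def by (rule P(2))
  have "(matrix_inv A ** Sigma_hat f n \<pi> \<tau> ** matrix_inv A) *v d = z"
    by (simp add: z_def x_def v_def flip: matrix_vector_mul_assoc)
  then have "d \<bullet> ((matrix_inv A ** Sigma_hat f n \<pi> \<tau> ** matrix_inv A) *v d) = (A *v v) \<bullet> z"
    by (simp add: Av)
  also have "\<dots> = v \<bullet> x" by (simp add: Az flip: sym)
  finally show "d \<bullet> ((matrix_inv A ** Sigma_hat f n \<pi> \<tau> ** matrix_inv A) *v d) = S_form n \<pi> \<tau> v v"
    by (simp add: x_def S_form)
qed

end

section \<open>Concentration of the estimated matrices\<close>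

context perm_gibbs begin

definition mean_A :: "nat \<Rightarrow> real ^ 'l ^ 'l" where
  "mean_A n = (\<chi> p r. E n (\<lambda>\<pi>. A_hat f n \<pi> \<theta> $ p $ r))"

lemma mean_A_form: "v \<bullet> (mean_A n *v w) = E n (\<lambda>\<pi>. A_form n \<pi> \<theta> v w)"
proof -
  have "A_form n \<pi> \<theta> v w = (\<Sum>p\<in>UNIV. \<Sum>r\<in>UNIV. (v $ p * w $ r) * A_hat f n \<pi> \<theta> $ p $ r)" for \<pi>
    unfolding A_form[symmetric] by (simp add: inner_vec_def matrix_vector_mult_def sum_distrib_left mult_ac)
  then have "E n (\<lambda>\<pi>. A_form n \<pi> \<theta> v w)
     = (\<Sum>p\<in>UNIV. \<Sum>r\<in>UNIV. (v $ p * w $ r) * E n (\<lambda>\<pi>. A_hat f n \<pi> \<theta> $ p $ r))"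
    by (simp only: E_sum E_cmult)
  also have "\<dots> = v \<bullet> (mean_A n *v w)"
    by (simp add: inner_vec_def matrix_vector_mult_def sum_distrib_left mean_A_def mult_ac)
  finally show ?thesis ..
qed

lemma A_form_lower:
  assumes "\<pi> \<in> perms n"
  shows "(\<sigma> (norm \<theta> * M))\<^sup>2 * ((1 / real n ^ 2) * (\<Sum>e\<in>edges n. (u \<bullet> y n \<pi> e)\<^sup>2)) \<le> A_form n \<pi> \<theta> u u"
proof -
  let ?s = "\<sigma> (norm \<theta> * M)"
  have "(\<Sum>e\<in>edges n. ?s\<^sup>2 * (u \<bullet> y n \<pi> e)\<^sup>2) \<le> (\<Sum>e\<in>edges n. q (\<theta> \<bullet> y n \<pi> e) * ((u \<bullet> y n \<pi> e) * (u \<bullet> y n \<pi> e)))"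
  proof (rule sum_mono)
    fix e assume e: "e \<in> edges n"
    have "?s \<le> \<sigma> (\<theta> \<bullet> y n \<pi> e)" "?s \<le> \<sigma> (- (\<theta> \<bullet> y n \<pi> e))"
      using inner_y_le[OF assms e, of \<theta>] by (auto intro!: \<sigma>_antimono)
    then have "?s * ?s \<le> \<sigma> (\<theta> \<bullet> y n \<pi> e) * \<sigma> (- (\<theta> \<bullet> y n \<pi> e))"
      using \<sigma>_bounds[of "norm \<theta> * M"] by (intro mult_mono) auto
    also have "\<dots> = q (\<theta> \<bullet> y n \<pi> e)" by (simp add: q_def one_minus_\<sigma>)
    finally have "?s * ?s * (u \<bullet> y n \<pi> e)\<^sup>2 \<le> q (\<theta> \<bullet> y n \<pi> e) * (u \<bullet> y n \<pi> e)\<^sup>2"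
      by (intro mult_right_mono) auto
    then show "?s\<^sup>2 * (u \<bullet> y n \<pi> e)\<^sup>2 \<le> q (\<theta> \<bullet> y n \<pi> e) * ((u \<bullet> y n \<pi> e) * (u \<bullet> y n \<pi> e))"
      by (simp add: power2_eq_square)
  qed
  then have "(1 / real n ^ 2) * (\<Sum>e\<in>edges n. ?s\<^sup>2 * (u \<bullet> y n \<pi> e)\<^sup>2) \<le> A_form n \<pi> \<theta> u u"
    unfolding A_form_def by (rule mult_left_mono) simp
  then show ?thesis by (simp add: sum_distrib_left[symmetric])
qed

lemma mean_A_lower:
  assumes "n > 0" "\<And>u. c * real n ^ 2 * (norm u)\<^sup>2 \<le> (\<Sum>e\<in>edges n. E n (\<lambda>\<pi>. (u \<bullet> y n \<pi> e)\<^sup>2))"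
  shows "(\<sigma> (norm \<theta> * M))\<^sup>2 * c * (norm u)\<^sup>2 \<le> u \<bullet> (mean_A n *v u)"
proof -
  let ?s = "\<sigma> (norm \<theta> * M)"
  have "?s\<^sup>2 * c * (norm u)\<^sup>2 = ?s\<^sup>2 * ((1 / real n ^ 2) * (c * real n ^ 2 * (norm u)\<^sup>2))"
    using assms(1) by simp
  also have "\<dots> \<le> ?s\<^sup>2 * ((1 / real n ^ 2) * (\<Sum>e\<in>edges n. E n (\<lambda>\<pi>. (u \<bullet> y n \<pi> e)\<^sup>2)))"
    by (intro mult_left_mono assms(2)) auto
  also have "\<dots> = E n (\<lambda>\<pi>. ?s\<^sup>2 * ((1 / real n ^ 2) * (\<Sum>e\<in>edges n. (u \<bullet> y n \<pi> e)\<^sup>2)))"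
    by (simp only: E_cmult E_sum)
  also have "\<dots> \<le> E n (\<lambda>\<pi>. A_form n \<pi> \<theta> u u)" by (rule E_mono) (rule A_form_lower)
  finally show ?thesis by (simp only: mean_A_form)
qed

text \<open>
The deterministic part of the argument, on the event that the mean score at the true parameter has
norm at most \<open>R\<close>, that the entries of \<open>A_hat\<close> are within
\<open>\<eta>\<close> of their means and that the quadratic form of \<open>Sigma_hat\<close> at
\<open>v\<close> is within \<open>\<eta>\<close> of \<open>S\<close>. The root lies within
\<open>D\<close> of the true parameter, and all directions involved have norm at most
\<open>b\<close>. The direction \<open>v\<close> is chosen such that \<open>d \<bullet> u = v
\<bullet> (mean_A n *v u)\<close> for all \<open>u\<close>, which converts the error of the
estimator into the score in the direction \<open>v\<close>.
\<close>

lemma estimator_expansion: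
  fixes d :: "real ^ 'l" and \<eta> R \<mu> S :: real
  assumes \<pi>: "\<pi> \<in> perms n" and n: "n > 0" and \<mu>: "\<mu> > 0"
    and mean_pd: "\<And>u. \<mu> * (norm u)\<^sup>2 \<le> u \<bullet> (mean_A n *v u)"
    and R: "norm (mean_score n \<pi> \<theta>) \<le> R"
    and \<eta>: "\<And>p r. \<bar>A_hat f n \<pi> \<theta> $ p $ r - mean_A n $ p $ r\<bar> \<le> \<eta>"
  defines "v \<equiv> matrix_inv (mean_A n) *v d"
    and "D \<equiv> 4 * R / \<mu>" and "b \<equiv> 4 * norm d / \<mu>" and "L \<equiv> real CARD('l) ^ 2"
  assumes S: "\<bar>S_form n \<pi> \<theta> v v - S\<bar> \<le> \<eta>"
    and small: "L * \<eta> \<le> \<mu> / 2" "4 * (M ^ 3 + 1) * R < (\<mu> / 2)\<^sup>2"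
  defines "\<tau> \<equiv> pl_estimator f n \<pi>"
  defines "A \<equiv> A_hat f n \<pi> \<tau>"
  shows "\<exists>!\<tau>. pl_root f n \<pi> \<tau>" "invertible A"
    "\<bar>d \<bullet> \<tau> - d \<bullet> \<theta> - v \<bullet> mean_score n \<pi> \<theta>\<bar> \<le> b * (M ^ 3 * D\<^sup>2 + L * \<eta> * D)"
    "\<bar>d \<bullet> ((matrix_inv A ** Sigma_hat f n \<pi> \<tau> ** matrix_inv A) *v d) - S\<bar>
      \<le> 24 * M ^ 3 * D * b\<^sup>2 + 24 * M\<^sup>2 * b\<^sup>2 * (L * \<eta> + M ^ 3 * D) / \<mu> + \<eta>"
proof -
  note P = pos_def_invertible[OF \<mu> mean_pd]
  have Av: "mean_A n *v v = d" unfolding v_def by (rule P(2))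
  have "norm v \<le> norm d / \<mu>" unfolding v_def by (rule P(3))
  also have "\<dots> \<le> b" unfolding b_def using \<mu> by (intro divide_right_mono) auto
  finally have vb: "norm v \<le> b" .
  have b0: "b \<ge> 0" using \<mu> by (simp add: b_def)
  have diffA: "\<bar>u \<bullet> (mean_A n *v w) - A_form n \<pi> \<theta> u w\<bar> \<le> L * \<eta> * (norm u * norm w)" for u w
  proof -
    have "\<bar>u \<bullet> ((A_hat f n \<pi> \<theta> - mean_A n) *v w)\<bar> \<le> L * \<eta> * (norm u * norm w)"
      unfolding L_def by (rule abs_matrix_form_le) (use \<eta> in simp)
    then show ?thesis
      by (simp add: matrix_vector_mult_diff_rdistrib inner_diff_right A_form abs_minus_commute)
  qed
  have pd: "\<mu> / 2 * (norm u)\<^sup>2 \<le> A_form n \<pi> \<theta> u u" for u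
  proof -
    have "L * \<eta> * (norm u * norm u) \<le> \<mu> / 2 * (norm u * norm u)"
      by (intro mult_right_mono small) auto
    then show ?thesis using mean_pd[of u] diffA[of u u] by (simp add: power2_eq_square)
  qed
  have \<mu>2: "\<mu> / 2 > 0" using \<mu> by simp
  obtain \<tau>' where \<tau>': "pl_root f n \<pi> \<tau>'" "norm (\<tau>' - \<theta>) \<le> 2 * R / (\<mu> / 2)"
    using pl_root_exists[OF \<pi> n \<mu>2 pd R small(2)] by blast
  show ex1: "\<exists>!\<tau>. pl_root f n \<pi> \<tau>"
    using \<tau>'(1) pl_root_unique[OF \<pi> n \<mu>2 pd] by blast
  have "pl_root f n \<pi> \<tau>" unfolding \<tau>_def pl_estimator_def by (rule theI'[OF ex1])
  then have root: "pl_root f n \<pi> \<tau>" and "\<tau> = \<tau>'" using ex1 \<tau>'(1) by auto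
  let ?\<delta> = "\<tau> - \<theta>"
  have D: "norm ?\<delta> \<le> D" using \<tau>'(2) \<open>\<tau> = \<tau>'\<close> by (simp add: D_def)
  have D0: "D \<ge> 0" using D norm_ge_zero order.trans by blast
  have M3D: "M ^ 3 * D \<le> \<mu> / 4"
  proof -
    have R0: "R \<ge> 0" using R norm_ge_zero order.trans by blast
    have "4 * M ^ 3 * R \<le> 4 * (M ^ 3 + 1) * R" using R0 by (intro mult_right_mono) auto
    then have "4 * M ^ 3 * R \<le> (\<mu> / 2)\<^sup>2" using small(2) by linarith
    then have "4 * M ^ 3 * R / \<mu> \<le> (\<mu> / 2)\<^sup>2 / \<mu>" using \<mu> by (intro divide_right_mono) auto
    also have "\<dots> = \<mu> / 4" using \<mu> by (simp add: power2_eq_square)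
    finally show ?thesis by (simp add: D_def mult_ac)
  qed
  have pd': "\<mu> / 4 * (norm u)\<^sup>2 \<le> A_form n \<pi> \<tau> u u" for u
  proof -
    have "\<bar>A_form n \<pi> \<tau> u u - A_form n \<pi> \<theta> u u\<bar> \<le> M ^ 3 * norm ?\<delta> * (norm u * norm u)"
      by (rule A_form_lipschitz[OF \<pi> n])
    also have "\<dots> \<le> M ^ 3 * D * (norm u * norm u)"
      using D M_nonneg by (intro mult_right_mono mult_left_mono) auto
    also have "\<dots> \<le> \<mu> / 4 * (norm u * norm u)" by (intro mult_right_mono M3D) auto
    finally have "\<bar>A_form n \<pi> \<tau> u u - A_form n \<pi> \<theta> u u\<bar> \<le> \<mu> * (norm u)\<^sup>2 / 4"
      by (simp add: power2_eq_square)
    moreover have "\<mu> * (norm u)\<^sup>2 / 2 \<le> A_form n \<pi> \<theta> u u" using pd[of u] by simp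
    ultimately have "\<mu> * (norm u)\<^sup>2 / 4 \<le> A_form n \<pi> \<tau> u u" by linarith
    then show ?thesis by simp
  qed
  have \<mu>4: "\<mu> / 4 > 0" using \<mu> by simp
  note Sw1 = sandwich_variance_form(1)[OF \<mu>4 pd', folded A_def]
  note Sw = sandwich_variance_form(2-4)[OF \<mu>4 pd', of d, folded A_def]
  show "invertible A" by (rule Sw1)
  have "mean_score n \<pi> \<tau> = 0" using root by (simp add: pl_root_iff mean_score_def)
  then have rem: "\<bar>A_form n \<pi> \<theta> v ?\<delta> - v \<bullet> mean_score n \<pi> \<theta>\<bar> \<le> M ^ 3 * (norm ?\<delta>)\<^sup>2 * norm v"
    using mean_score_taylor[OF \<pi> n, of v \<tau>] by simp
  (* The defining property of the direction v. *)
  have sym: "v \<bullet> (mean_A n *v u) = d \<bullet> u" for u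
  proof -
    have "v \<bullet> (mean_A n *v u) = u \<bullet> (mean_A n *v v)"
      unfolding mean_A_form by (simp only: A_form_commute[of n _ \<theta> v u])
    then show ?thesis by (simp add: Av inner_commute)
  qed
  have "\<bar>d \<bullet> ?\<delta> - v \<bullet> mean_score n \<pi> \<theta>\<bar> \<le> L * \<eta> * (norm v * norm ?\<delta>) + M ^ 3 * (norm ?\<delta>)\<^sup>2 * norm v"
    using diffA[of v ?\<delta>] rem unfolding sym by linarith
  also have "\<dots> \<le> L * \<eta> * (b * D) + M ^ 3 * D\<^sup>2 * b"
  proof (intro add_mono mult_left_mono mult_mono power_mono vb D)
    have "0 \<le> \<eta>" using \<eta> abs_ge_zero order.trans by blast
    then show "0 \<le> L * \<eta>" by (simp add: L_def)
  qed (use M_nonneg b0 D0 in auto)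
  finally show "\<bar>d \<bullet> \<tau> - d \<bullet> \<theta> - v \<bullet> mean_score n \<pi> \<theta>\<bar> \<le> b * (M ^ 3 * D\<^sup>2 + L * \<eta> * D)"
    by (simp add: inner_diff_right algebra_simps)
  define w where "w = matrix_inv A *v d"
  have Aw: "A *v w = d" unfolding w_def by (rule Sw(1))
  have wb: "norm w \<le> b" unfolding w_def using Sw(2) by (simp add: b_def mult.commute)
  have wv: "norm (w - v) \<le> (L * \<eta> + M ^ 3 * D) * b / \<mu>"
  proof -
    let ?u = "w - v"
    have "\<mu> * (norm ?u)\<^sup>2 \<le> ?u \<bullet> (mean_A n *v ?u)" by (rule mean_pd)
    also have "\<dots> = ?u \<bullet> (mean_A n *v w) - ?u \<bullet> (A *v w)"
      by (simp add: matrix_vector_mult_diff_distrib Av Aw inner_diff_right)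
    also have "\<dots> = (?u \<bullet> (mean_A n *v w) - A_form n \<pi> \<theta> ?u w) + (A_form n \<pi> \<theta> ?u w - A_form n \<pi> \<tau> ?u w)"
      by (simp add: A_def A_form)
    also have "\<dots> \<le> L * \<eta> * (norm ?u * norm w) + M ^ 3 * norm (\<theta> - \<tau>) * (norm ?u * norm w)"
      using diffA[of ?u w] A_form_lipschitz[OF \<pi> n, of \<theta> ?u w \<tau>] by linarith
    also have "\<dots> = (L * \<eta> + M ^ 3 * norm ?\<delta>) * (norm ?u * norm w)"
      by (simp add: norm_minus_commute algebra_simps)
    also have "\<dots> \<le> (L * \<eta> + M ^ 3 * D) * (norm ?u * b)"
    proof (rule mult_mono)
      show "L * \<eta> + M ^ 3 * norm ?\<delta> \<le> L * \<eta> + M ^ 3 * D"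
        using M_nonneg by (intro add_left_mono mult_left_mono D) auto
      show "norm ?u * norm w \<le> norm ?u * b" by (intro mult_left_mono wb) auto
      have "0 \<le> \<eta>" using \<eta> abs_ge_zero order.trans by blast
      then show "0 \<le> L * \<eta> + M ^ 3 * D" using M_nonneg D0 by (simp add: L_def)
    qed auto
    finally have "norm ?u * (\<mu> * norm ?u) \<le> norm ?u * ((L * \<eta> + M ^ 3 * D) * b)"
      by (simp add: power2_eq_square mult_ac)
    then have "norm ?u = 0 \<or> \<mu> * norm ?u \<le> (L * \<eta> + M ^ 3 * D) * b"
      by (rule nonneg_mult_le_cancel[OF _ norm_ge_zero])
    moreover have "0 \<le> (L * \<eta> + M ^ 3 * D) * b"
    proof -
      have "0 \<le> \<eta>" using \<eta> abs_ge_zero order.trans by blast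
      then show ?thesis using M_nonneg D0 b0 by (simp add: L_def)
    qed
    ultimately show ?thesis using \<mu> by (auto simp: pos_le_divide_eq mult.commute)
  qed
  have eqV: "d \<bullet> ((matrix_inv A ** Sigma_hat f n \<pi> \<tau> ** matrix_inv A) *v d) = S_form n \<pi> \<tau> w w"
    unfolding w_def by (rule Sw(3))
  have 1: "\<bar>S_form n \<pi> \<tau> w w - S_form n \<pi> \<theta> w w\<bar> \<le> 24 * M ^ 3 * D * b\<^sup>2"
  proof -
    have "\<bar>S_form n \<pi> \<tau> w w - S_form n \<pi> \<theta> w w\<bar> \<le> 24 * M ^ 3 * norm ?\<delta> * (norm w * norm w)"
      by (rule S_form_lipschitz[OF \<pi> n])
    also have "\<dots> \<le> 24 * M ^ 3 * D * (b * b)"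
      using M_nonneg b0 D0 by (intro mult_mono mult_left_mono D wb) auto
    finally show ?thesis by (simp add: power2_eq_square)
  qed
  have 2: "\<bar>S_form n \<pi> \<theta> w w - S_form n \<pi> \<theta> v v\<bar> \<le> 24 * M\<^sup>2 * b\<^sup>2 * (L * \<eta> + M ^ 3 * D) / \<mu>"
  proof -
    have "S_form n \<pi> \<theta> w w - S_form n \<pi> \<theta> v v = S_form n \<pi> \<theta> (w - v) w + S_form n \<pi> \<theta> v (w - v)"
      by (simp add: S_form[symmetric] inner_diff_left inner_diff_right matrix_vector_mult_diff_distrib)
    also have "\<bar>\<dots>\<bar> \<le> 12 * (M\<^sup>2 * (norm (w - v) * norm w)) + 12 * (M\<^sup>2 * (norm v * norm (w - v)))"
      using S_form_bound[OF \<pi> n, of \<theta> "w - v" w] S_form_bound[OF \<pi> n, of \<theta> v "w - v"] by linarith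
    also have "\<dots> \<le> 12 * (M\<^sup>2 * (norm (w - v) * b)) + 12 * (M\<^sup>2 * (b * norm (w - v)))"
      by (intro add_mono mult_left_mono mult_right_mono wb vb) auto
    also have "\<dots> = 24 * M\<^sup>2 * b * norm (w - v)" by simp
    also have "\<dots> \<le> 24 * M\<^sup>2 * b * ((L * \<eta> + M ^ 3 * D) * b / \<mu>)"
      using b0 by (intro mult_left_mono wv) auto
    finally show ?thesis by (simp add: power2_eq_square mult_ac)
  qed
  show "\<bar>d \<bullet> ((matrix_inv A ** Sigma_hat f n \<pi> \<tau> ** matrix_inv A) *v d) - S\<bar>
      \<le> 24 * M ^ 3 * D * b\<^sup>2 + 24 * M\<^sup>2 * b\<^sup>2 * (L * \<eta> + M ^ 3 * D) / \<mu> + \<eta>"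
    unfolding eqV using 1 2 S by linarith
qed

text \<open>
Disjoint edges have uncorrelated contributions: the swap of one edge does not affect the other, so
the Stein identity gives zero. The second moment of the score therefore consists of the adjacent
pairs, which are collected by \<open>Sigma_hat\<close>, and of the \<open>O(n\<^sup>2)\<close>
diagonal terms.
\<close>

lemma E_S_form:
  assumes "n > 0"
  shows "\<bar>E n (\<lambda>\<pi>. S_form n \<pi> \<theta> v v) - E n (\<lambda>\<pi>. (U n v \<pi>)\<^sup>2) / real n ^ 3\<bar> \<le> (norm v * M)\<^sup>2 / real n"
proof -
  let ?G = "\<lambda>e e'. E n (\<lambda>\<pi>. h n v \<pi> e * h n v \<pi> e')"
  have disj: "?G e e' = 0" if "e \<in> edges n" "ends e \<inter> ends e' = {}" for e e'
  proof -
    have "h n v (swap e \<pi>) e' = h n v \<pi> e'" for \<pi>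
      by (rule h_local) (use that(2) in \<open>auto simp: ends_def Transposition.transpose_def\<close>)
    then show ?thesis
      using stein_identity[OF that(1), of v "\<lambda>\<pi>. h n v \<pi> e'"] E_const[of n "0::real"] by simp
  qed
  have "E n (\<lambda>\<pi>. (U n v \<pi>)\<^sup>2) = (\<Sum>e\<in>edges n. \<Sum>e'\<in>edges n. ?G e e')"
    unfolding U_def power2_eq_square sum_product by (simp only: E_sum)
  also have "\<dots> = (\<Sum>e\<in>edges n. ?G e e) + (\<Sum>(e, e')\<in>adjacent_edges n. ?G e e')"
    by (rule sum_edge_pairs) (rule disj)
  finally have UU: "E n (\<lambda>\<pi>. (U n v \<pi>)\<^sup>2) = (\<Sum>e\<in>edges n. ?G e e) + (\<Sum>(e, e')\<in>adjacent_edges n. ?G e e')" .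
  have "S_form n \<pi> \<theta> v v = (1 / real n ^ 3) * (\<Sum>p\<in>adjacent_edges n. h n v \<pi> (fst p) * h n v \<pi> (snd p))" for \<pi>
    by (simp add: S_form_def h_def case_prod_unfold mult_ac)
  then have "E n (\<lambda>\<pi>. S_form n \<pi> \<theta> v v) = (1 / real n ^ 3) * (\<Sum>p\<in>adjacent_edges n. ?G (fst p) (snd p))"
    by (simp only: E_cmult E_sum)
  then have "E n (\<lambda>\<pi>. S_form n \<pi> \<theta> v v) - E n (\<lambda>\<pi>. (U n v \<pi>)\<^sup>2) / real n ^ 3 = - ((\<Sum>e\<in>edges n. ?G e e) / real n ^ 3)"
    unfolding UU by (simp add: case_prod_unfold add_divide_distrib)
  then have "\<bar>E n (\<lambda>\<pi>. S_form n \<pi> \<theta> v v) - E n (\<lambda>\<pi>. (U n v \<pi>)\<^sup>2) / real n ^ 3\<bar> = \<bar>\<Sum>e\<in>edges n. ?G e e\<bar> / real n ^ 3"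
    by simp
  also have "\<bar>\<Sum>e\<in>edges n. ?G e e\<bar> \<le> (\<Sum>e\<in>edges n. (norm v * M)\<^sup>2)"
  proof (rule order.trans[OF sum_abs sum_mono])
    fix e assume e: "e \<in> edges n"
    have "?G e e \<le> E n (\<lambda>_. (norm v * M)\<^sup>2)"
    proof (rule E_mono)
      fix \<pi> assume "\<pi> \<in> perms n"
      then have "\<bar>h n v \<pi> e\<bar> \<le> norm v * M" unfolding M_def by (rule abs_h_le[OF _ e])
      then have "\<bar>h n v \<pi> e\<bar>\<^sup>2 \<le> (norm v * M)\<^sup>2" by (rule power_mono) simp
      then show "h n v \<pi> e * h n v \<pi> e \<le> (norm v * M)\<^sup>2" by (simp add: power2_eq_square)
    qed
    moreover have "0 \<le> ?G e e" using E_sq_nonneg[of n "\<lambda>\<pi>. h n v \<pi> e"] by (simp add: power2_eq_square)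
    ultimately show "\<bar>?G e e\<bar> \<le> (norm v * M)\<^sup>2" by (simp add: E_const)
  qed
  also have "\<dots> = card (edges n) * (norm v * M)\<^sup>2" by simp
  also have "\<dots> \<le> real n ^ 2 * (norm v * M)\<^sup>2" by (intro mult_right_mono card_edges_le) auto
  finally have "\<bar>E n (\<lambda>\<pi>. S_form n \<pi> \<theta> v v) - E n (\<lambda>\<pi>. (U n v \<pi>)\<^sup>2) / real n ^ 3\<bar> \<le> real n ^ 2 * (norm v * M)\<^sup>2 / real n ^ 3"
    by (simp add: divide_right_mono)
  also have "\<dots> = (norm v * M)\<^sup>2 / real n" using assms by (simp add: power2_eq_square power3_eq_cube)
  finally show ?thesis .
qed

definition Pr :: "nat \<Rightarrow> ((nat \<Rightarrow> nat) \<Rightarrow> bool) \<Rightarrow> real" where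
  "Pr n Q = measure (perm_model f n \<theta>) {\<pi>\<in>perms n. Q \<pi>}"

lemma Pr_eq_E: "Pr n Q = E n (\<lambda>\<pi>. of_bool (Q \<pi>))"
proof -
  have "Pr n Q = E n (indicator {\<pi>\<in>perms n. Q \<pi>})" unfolding Pr_def by (rule measure_perm_model) auto
  also have "\<dots> = E n (\<lambda>\<pi>. of_bool (Q \<pi>))" by (rule E_cong) (simp add: indicator_def)
  finally show ?thesis .
qed

lemma Pr_le_add:
  assumes "\<And>\<pi>. \<pi> \<in> perms n \<Longrightarrow> Q \<pi> \<Longrightarrow> Q' \<pi> \<or> Q'' \<pi>"
  shows "Pr n Q \<le> Pr n Q' + Pr n Q''"
  unfolding Pr_eq_E E_add[symmetric] by (rule E_mono) (use assms in auto)

lemma Pr_ex_le: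
  fixes Q :: "'i::finite \<Rightarrow> _"
  shows "Pr n (\<lambda>\<pi>. \<exists>i. Q i \<pi>) \<le> (\<Sum>i\<in>UNIV. Pr n (Q i))"
  unfolding Pr_eq_E E_sum[symmetric]
proof (rule E_mono)
  fix \<pi>
  show "of_bool (\<exists>i. Q i \<pi>) \<le> (\<Sum>i\<in>UNIV. of_bool (Q i \<pi>) :: real)"
  proof (cases "\<exists>i. Q i \<pi>")
    case True
    then obtain i where "Q i \<pi>" by blast
    then have "1 = (of_bool (Q i \<pi>) :: real)" by simp
    also have "\<dots> \<le> (\<Sum>i\<in>UNIV. of_bool (Q i \<pi>))" by (rule member_le_sum) auto
    finally show ?thesis using True by simp
  qed (auto intro: sum_nonneg)
qed

lemma chebyshev:
  assumes "hamming_lipschitz n L F" "\<eta> > 0"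
  shows "Pr n (\<lambda>\<pi>. \<not> \<bar>F \<pi> - E n F\<bar> \<le> \<eta>) \<le> real n * (L * (1 + K ^ 4))\<^sup>2 / \<eta>\<^sup>2"
proof -
  have "Pr n (\<lambda>\<pi>. \<not> \<bar>F \<pi> - E n F\<bar> \<le> \<eta>) \<le> E n (\<lambda>\<pi>. (1 / \<eta>\<^sup>2) * (F \<pi> - E n F)\<^sup>2)"
    unfolding Pr_eq_E
  proof (rule E_mono)
    fix \<pi>
    show "of_bool (\<not> \<bar>F \<pi> - E n F\<bar> \<le> \<eta>) \<le> (1 / \<eta>\<^sup>2) * (F \<pi> - E n F)\<^sup>2"
    proof (cases "\<bar>F \<pi> - E n F\<bar> \<le> \<eta>")
      case False
      then have "\<eta>\<^sup>2 \<le> \<bar>F \<pi> - E n F\<bar>\<^sup>2" using assms(2) by (intro power_mono) auto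
      then show ?thesis using False assms(2) by (simp add: field_simps)
    qed simp
  qed
  also have "\<dots> = (1 / \<eta>\<^sup>2) * E n (\<lambda>\<pi>. (F \<pi> - E n F)\<^sup>2)" by (rule E_cmult)
  also have "\<dots> \<le> (1 / \<eta>\<^sup>2) * (real n * (L * (1 + K ^ 4))\<^sup>2)"
    by (intro mult_left_mono E_variance assms) auto
  finally show ?thesis by simp
qed

lemma A_hat_entry: "A_hat f n \<pi> \<tau> $ p $ r = A_form n \<pi> \<tau> (axis p 1) (axis r 1)"
  by (simp add: A_hat_def A_form_def inner_axis' q_eq[symmetric] mult_ac)

lemma A_hat_entry_lipschitz:
  assumes "n > 0"
  shows "hamming_lipschitz n (4 * M\<^sup>2 / real n) (\<lambda>\<pi>. A_hat f n \<pi> \<theta> $ p $ r)"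
proof -
  have "hamming_lipschitz n (4 * M\<^sup>2 * real n)
    (\<lambda>\<pi>. \<Sum>e\<in>edges n. (\<lambda>z. q (\<theta> \<bullet> z) * ((axis p 1 \<bullet> z) * (axis r 1 \<bullet> z))) (y n \<pi> e))"
  proof (rule edge_sum_lipschitz)
    fix \<pi> e assume a: "\<pi> \<in> perms n" "e \<in> edges n"
    have "\<bar>q (\<theta> \<bullet> y n \<pi> e)\<bar> * (\<bar>axis p 1 \<bullet> y n \<pi> e\<bar> * \<bar>axis r 1 \<bullet> y n \<pi> e\<bar>) \<le> 1 * (M * M)"
      using q_bounds[of "\<theta> \<bullet> y n \<pi> e"] M_nonneg inner_y_le[OF a, of "axis p 1"] inner_y_le[OF a, of "axis r 1"]
      by (intro mult_mono) auto
    then show "\<bar>q (\<theta> \<bullet> y n \<pi> e) * ((axis p 1 \<bullet> y n \<pi> e) * (axis r 1 \<bullet> y n \<pi> e))\<bar> \<le> M\<^sup>2"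
      by (simp add: abs_mult power2_eq_square)
  qed simp
  then show ?thesis
    unfolding A_hat_entry A_form_def
    by (rule hamming_lipschitz_scale) (use assms in \<open>simp_all add: power2_eq_square\<close>)
qed

lemma S_form_hamming:
  assumes "n > 0"
  shows "hamming_lipschitz n (24 * (norm v * M)\<^sup>2 / real n) (\<lambda>\<pi>. S_form n \<pi> \<theta> v v)"
proof -
  have "hamming_lipschitz n (24 * (norm v * M)\<^sup>2 * real n ^ 2)
    (\<lambda>\<pi>. \<Sum>(e, e')\<in>adjacent_edges n. h n v \<pi> e * h n v \<pi> e')"
  proof (rule adjacent_sum_lipschitz)
    fix \<pi> e e' assume a: "\<pi> \<in> perms n" "e \<in> edges n" "e' \<in> edges n"
    have "\<bar>h n v \<pi> e\<bar> * \<bar>h n v \<pi> e'\<bar> \<le> (norm v * M) * (norm v * M)"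
      unfolding M_def using B_nonneg by (intro mult_mono abs_h_le a) auto
    then show "\<bar>h n v \<pi> e * h n v \<pi> e'\<bar> \<le> (norm v * M)\<^sup>2" by (simp add: abs_mult power2_eq_square)
  next
    fix \<pi> \<rho> :: "nat \<Rightarrow> nat" and e e' assume "\<And>m. m \<in> ends e \<union> ends e' \<Longrightarrow> \<pi> m = \<rho> m"
    then have "h n v \<pi> e = h n v \<rho> e" "h n v \<pi> e' = h n v \<rho> e'" by (intro h_local; simp)+
    then show "h n v \<pi> e * h n v \<pi> e' = h n v \<rho> e * h n v \<rho> e'" by simp
  qed simp
  moreover have "S_form n \<pi> \<theta> v v = (1 / real n ^ 3) * (\<Sum>(e, e')\<in>adjacent_edges n. h n v \<pi> e * h n v \<pi> e')" for \<pi>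
    by (simp add: S_form_def h_def case_prod_unfold mult_ac)
  moreover have "(1 / real n ^ 3) * (24 * (norm v * M)\<^sup>2 * real n ^ 2) = 24 * (norm v * M)\<^sup>2 / real n"
    using assms by (simp add: power2_eq_square power3_eq_cube)
  ultimately show ?thesis
    by (simp only:) (erule hamming_lipschitz_scale; simp)
qed

lemma mean_score_norm_le:
  fixes \<pi> :: "nat \<Rightarrow> nat"
  assumes "n > 0" "\<And>p. \<bar>U n (axis p 1) \<pi>\<bar> \<le> real n ^ 2 * t"
  shows "norm (mean_score n \<pi> \<theta>) \<le> real CARD('l) * t"
proof -
  have "norm (mean_score n \<pi> \<theta>) \<le> (\<Sum>p\<in>UNIV. \<bar>mean_score n \<pi> \<theta> $ p\<bar>)" by (rule norm_le_l1_cart)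
  also have "\<dots> \<le> (\<Sum>p\<in>(UNIV :: 'l set). t)"
  proof (rule sum_mono)
    fix p
    have "mean_score n \<pi> \<theta> $ p = (1 / real n ^ 2) * (axis p 1 \<bullet> score n \<pi> \<theta>)"
      by (simp add: mean_score_def inner_axis')
    then have "\<bar>mean_score n \<pi> \<theta> $ p\<bar> = \<bar>U n (axis p 1) \<pi>\<bar> / real n ^ 2"
      by (simp add: inner_score abs_mult)
    also have "\<dots> \<le> t" using assms(2)[of p] assms(1) by (simp add: divide_le_eq mult.commute)
    finally show "\<bar>mean_score n \<pi> \<theta> $ p\<bar> \<le> t" .
  qed
  finally show ?thesis by simp
qed

end

section \<open>Coverage of the confidence interval\<close>

text \<open>
The reflected normal law has the same characteristic function, hence is the same law.
\<close>

lemma cdf_std_normal_minus: "cdf std_normal_distribution (- x) = 1 - cdf std_normal_distribution x"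
proof -
  let ?N = std_normal_distribution
  interpret N: real_distribution ?N by (rule real_dist_normal_dist)
  have meas: "uminus \<in> borel_measurable ?N" by simp
  have "distr ?N borel uminus = ?N"
  proof (rule Levy_uniqueness)
    show "real_distribution (distr ?N borel uminus)" by (rule N.real_distribution_distr[OF meas])
    show "real_distribution ?N" by (rule real_dist_normal_dist)
    have "char (distr ?N borel uminus) t = char ?N (- t)" for t
      unfolding char_def by (subst integral_distr[OF meas]) simp_all
    then show "char (distr ?N borel uminus) = char ?N"
      by (intro ext) (simp add: char_std_normal_distribution)
  qed
  then have "cdf ?N (- x) = measure (distr ?N borel uminus) {.. - x}" by (simp only: cdf_def)
  also have "\<dots> = measure ?N {x..}"
  proof -
    have "uminus -` {.. - x} \<inter> space ?N = {x..}" by auto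
    then show ?thesis by (subst measure_distr[OF meas]) auto
  qed
  also have "\<dots> = 1 - measure ?N {..<x}"
    using N.prob_compl[of "{..<x}"] by (simp add: Compl_eq_Diff_UNIV[symmetric])
  also have "measure ?N {..<x} = cdf ?N x"
  proof -
    have "measure ?N {x} = 0" using isCont_cdf_std_normal[of x] by (simp add: N.isCont_cdf)
    moreover have "measure ?N ({..<x} \<union> {x}) = measure ?N {..<x} + measure ?N {x}"
      by (rule N.finite_measure_Union) auto
    moreover have "{..<x} \<union> {x} = {..x}" by auto
    ultimately show ?thesis by (simp add: cdf_def)
  qed
  finally show ?thesis .
qed

lemma std_normal_quantile:
  assumes "0 < p" "p < 1"
  shows "cdf std_normal_distribution (quantile std_normal_distribution p) = p"
proof -
  let ?N = std_normal_distribution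
  interpret N: real_distribution ?N by (rule real_dist_normal_dist)
  let ?S = "{x. p \<le> cdf ?N x}"
  have cont: "continuous_on UNIV (cdf ?N)"
    using isCont_cdf_std_normal by (simp add: continuous_on_eq_continuous_at)
  obtain b where b: "p < cdf ?N b"
    using order_tendstoD(1)[OF N.cdf_lim_at_top_prob assms(2)] by (auto simp: eventually_at_top_linorder)
  obtain a where a: "cdf ?N a < p"
    using order_tendstoD(2)[OF N.cdf_lim_at_bot assms(1)] by (auto simp: eventually_at_bot_linorder)
  have "a \<le> b" using a b N.cdf_nondecreasing[of b a] by linarith
  then obtain x0 where x0: "cdf ?N x0 = p"
    using IVT[of "cdf ?N" a p b] a b isCont_cdf_std_normal by auto
  have bdd: "bdd_below ?S"
  proof (rule bdd_belowI[of _ a])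
    fix x assume "x \<in> ?S"
    then show "a \<le> x" using a N.cdf_nondecreasing[of x a] by (cases "a \<le> x") auto
  qed
  have "closed ?S" using cont by (intro closed_Collect_le continuous_on_const)
  then have "Inf ?S \<in> ?S" using x0 bdd by (intro closed_contains_Inf) auto
  moreover have "Inf ?S \<le> x0" using x0 bdd by (intro cInf_lower) auto
  ultimately show ?thesis
    using N.cdf_nondecreasing[of "Inf ?S" x0] x0 by (simp add: quantile_def)
qed

lemma z_normal:
  assumes "0 < \<alpha>" "\<alpha> < 1"
  shows "0 < z_normal (\<alpha> / 2)"
    "cdf std_normal_distribution (z_normal (\<alpha> / 2)) - cdf std_normal_distribution (- z_normal (\<alpha> / 2)) = 1 - \<alpha>"
proof -
  let ?N = std_normal_distribution and ?z = "z_normal (\<alpha> / 2)"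
  interpret N: real_distribution ?N by (rule real_dist_normal_dist)
  have z: "cdf ?N ?z = 1 - \<alpha> / 2"
    unfolding z_normal_def by (rule std_normal_quantile) (use assms in auto)
  then show "cdf ?N ?z - cdf ?N (- ?z) = 1 - \<alpha>" by (simp add: cdf_std_normal_minus)
  have "cdf ?N 0 = 1 / 2" using cdf_std_normal_minus[of 0] by simp
  then show "0 < ?z" using N.cdf_nondecreasing[of ?z 0] z assms by (cases "?z \<le> 0") auto
qed

context perm_gibbs begin

definition V_hat :: "nat \<Rightarrow> real ^ 'l \<Rightarrow> (nat \<Rightarrow> nat) \<Rightarrow> real" where
  "V_hat n d \<pi> = d \<bullet> ((matrix_inv (A_hat f n \<pi> (pl_estimator f n \<pi>)) ** Sigma_hat f n \<pi> (pl_estimator f n \<pi>)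
     ** matrix_inv (A_hat f n \<pi> (pl_estimator f n \<pi>))) *v d)"

text \<open>
Everything about the data that the coverage argument needs: \<open>s\<close> plays the role of the
standard deviation of the rescaled score, and \<open>\<epsilon>\<close> bounds both approximation
errors.
\<close>

definition expansion_event ::
  "nat \<Rightarrow> real ^ 'l \<Rightarrow> real ^ 'l \<Rightarrow> real \<Rightarrow> real \<Rightarrow> (nat \<Rightarrow> nat) \<Rightarrow> bool" where
  "expansion_event n d v s \<epsilon> \<pi> \<longleftrightarrow> (\<exists>!\<tau>. pl_root f n \<pi> \<tau>) \<and> invertible (A_hat f n \<pi> (pl_estimator f n \<pi>)) \<and>
     \<bar>sqrt (real n) * (d \<bullet> pl_estimator f n \<pi> - d \<bullet> \<theta>) - s * (U n v \<pi> / sqrt (E n (\<lambda>\<pi>. (U n v \<pi>)\<^sup>2)))\<bar> \<le> \<epsilon> \<and>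
     \<bar>V_hat n d \<pi> - s\<^sup>2\<bar> \<le> \<epsilon>"

text \<open>
All errors are measured in powers of \<open>x = n^(-1/8)\<close>. The events used are
\<open>\<bar>U\<bar> \<le> n\<^sup>2 x\<^sup>3 = n^(3/2) / x\<close> for every coordinate direction,
and deviations at most \<open>x\<^sup>2\<close> for the entries of \<open>A_hat\<close> and for the
quadratic form of \<open>Sigma_hat\<close>. Chebyshev's inequality bounds the probabilities of their
failure by multiples of \<open>x\<^sup>2\<close>, \<open>x^4\<close> and \<open>x^4\<close>. On them
\<open>R\<close> is of order \<open>x\<^sup>3\<close> and \<open>\<eta> = x\<^sup>2\<close>, and the
error \<open>sqrt n * (R\<^sup>2 + \<eta> R)\<close> of the linearisation is of order
\<open>x\<close>, because \<open>sqrt n * x^4 = 1\<close>.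
\<close>

lemma estimator_expansion_whp:
  fixes d :: "real ^ 'l"
  assumes C: "\<forall>r. (\<lambda>x. f x $ r) \<in> class_C" and li: "ae_lin_indep f" and d: "d \<noteq> 0"
  obtains v :: "nat \<Rightarrow> real ^ 'l" and s \<epsilon> bad :: "nat \<Rightarrow> real" and s\<^sub>0 :: real
  where "\<forall>\<^sub>F n in sequentially. v n \<noteq> 0" "\<epsilon> \<longlonglongrightarrow> 0" "bad \<longlonglongrightarrow> 0" "s\<^sub>0 > 0"
    "\<forall>\<^sub>F n in sequentially. s\<^sub>0 \<le> s n"
    "\<forall>\<^sub>F n in sequentially. Pr n (\<lambda>\<pi>. \<not> expansion_event n d (v n) (s n) (\<epsilon> n) \<pi>) \<le> bad n"
proof -
  obtain c N where c: "c > 0"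
    and UU: "\<And>v n. n \<ge> N \<Longrightarrow> E n (\<lambda>\<pi>. (U n v \<pi>)\<^sup>2) \<ge> c * real n ^ 3 * (norm v)\<^sup>2"
    and yy: "\<And>v n. n \<ge> N \<Longrightarrow> (\<Sum>e\<in>edges n. E n (\<lambda>\<pi>. (v \<bullet> y n \<pi> e)\<^sup>2)) \<ge> c * real n ^ 2 * (norm v)\<^sup>2"
    using score_variance_lower[OF C li] by metis
  define \<mu> where "\<mu> = (\<sigma> (norm \<theta> * M))\<^sup>2 * c"
  have \<mu>: "\<mu> > 0" using \<sigma>_bounds[of "norm \<theta> * M"] c by (simp add: \<mu>_def)
  define v where "v n = matrix_inv (mean_A n) *v d" for n
  define Cd where "Cd = real CARD('l)"
  define L where "L = real CARD('l) ^ 2"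
  define b where "b = 4 * norm d / \<mu>"
  define c1 where "c1 = 4 * Cd / \<mu>"
  define \<kappa> where "\<kappa> = (1 + K ^ 4)\<^sup>2"
  define x where "x n = real n powr (- 1 / 8)" for n
  define s where "s n = sqrt (E n (\<lambda>\<pi>. (U n (v n) \<pi>)\<^sup>2) / real n ^ 3)" for n
  define \<epsilon>\<^sub>1 where "\<epsilon>\<^sub>1 n = b * (M ^ 3 * c1\<^sup>2 * x n ^ 2 + L * c1 * x n)" for n
  define \<epsilon>\<^sub>2 where "\<epsilon>\<^sub>2 n = 24 * M ^ 3 * (c1 * x n ^ 3) * b\<^sup>2 + 24 * M\<^sup>2 * b\<^sup>2 * (L * x n ^ 2 + M ^ 3 * (c1 * x n ^ 3)) / \<mu>
     + x n ^ 2 + (b * M)\<^sup>2 * x n ^ 8" for n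
  define bad where "bad n = Cd * (16 * M\<^sup>2 * \<kappa> * x n ^ 2) + L * (16 * M ^ 4 * \<kappa> * x n ^ 4) + 576 * (b * M) ^ 4 * \<kappa> * x n ^ 4" for n
  have b0: "b \<ge> 0" using \<mu> by (simp add: b_def)
  have x_lim: "x \<longlonglongrightarrow> 0"
    unfolding x_def by (rule tendsto_neg_powr) (auto intro: filterlim_real_sequentially)
  have x_pos: "x n > 0" and x8: "x n ^ 8 * real n = 1" and x4: "sqrt (real n) * x n ^ 4 = 1" if "n > 0" for n
  proof -
    have n: "real n > 0" using that by simp
    show x0: "x n > 0" using n by (simp add: x_def)
    have "x n ^ 8 = real n powr (- 1)" using n by (simp add: x_def powr_power)
    then show x8: "x n ^ 8 * real n = 1" using n by (simp add: powr_minus_divide)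
    have "(sqrt (real n) * x n ^ 4)\<^sup>2 = real n * (x n ^ 4 * x n ^ 4)"
      unfolding power_mult_distrib by (simp add: power2_eq_square)
    also have "x n ^ 4 * x n ^ 4 = x n ^ 8" unfolding power_add[symmetric] by simp
    finally have "(sqrt (real n) * x n ^ 4)\<^sup>2 = 1\<^sup>2" using x8 by (simp add: mult.commute)
    then show "sqrt (real n) * x n ^ 4 = 1"
    proof (rule power2_eq_imp_eq)
      show "0 \<le> sqrt (real n) * x n ^ 4" using less_imp_le[OF x0] by (intro mult_nonneg_nonneg) auto
    qed simp
  qed
  have xk: "(\<lambda>n. x n ^ k) \<longlonglongrightarrow> 0" if "k > 0" for k
    using tendsto_power[OF x_lim, of k] that by (simp add: zero_power)
  have xl: "(\<lambda>n. x n) \<longlonglongrightarrow> 0" "(\<lambda>n. x n ^ 2) \<longlonglongrightarrow> 0" "(\<lambda>n. x n ^ 3) \<longlonglongrightarrow> 0"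
    "(\<lambda>n. x n ^ 4) \<longlonglongrightarrow> 0" "(\<lambda>n. x n ^ 8) \<longlonglongrightarrow> 0"
    by (rule x_lim, (rule xk, simp)+)
  have "(\<lambda>n. \<epsilon>\<^sub>1 n) \<longlonglongrightarrow> b * (M ^ 3 * c1\<^sup>2 * 0 + L * c1 * 0)"
    unfolding \<epsilon>\<^sub>1_def by (intro tendsto_add tendsto_mult tendsto_const xl)
  then have eps1: "\<epsilon>\<^sub>1 \<longlonglongrightarrow> 0" by simp
  have "(\<lambda>n. \<epsilon>\<^sub>2 n) \<longlonglongrightarrow> 24 * M ^ 3 * (c1 * 0) * b\<^sup>2 + 24 * M\<^sup>2 * b\<^sup>2 * (L * 0 + M ^ 3 * (c1 * 0)) / \<mu>
     + 0 + (b * M)\<^sup>2 * 0"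
    unfolding \<epsilon>\<^sub>2_def using \<mu>
    by (intro tendsto_add tendsto_mult tendsto_divide tendsto_const xl) (rule less_imp_neq[symmetric])
  then have eps2: "\<epsilon>\<^sub>2 \<longlonglongrightarrow> 0" by simp
  have "(\<lambda>n. bad n) \<longlonglongrightarrow> Cd * (16 * M\<^sup>2 * \<kappa> * 0) + L * (16 * M ^ 4 * \<kappa> * 0) + 576 * (b * M) ^ 4 * \<kappa> * 0"
    unfolding bad_def by (intro tendsto_add tendsto_mult tendsto_const xl)
  then have bad: "bad \<longlonglongrightarrow> 0" by simp
  have eps: "(\<lambda>n. max (\<epsilon>\<^sub>1 n) (\<epsilon>\<^sub>2 n)) \<longlonglongrightarrow> 0" using tendsto_max[OF eps1 eps2] by simp
  have lim: "(\<lambda>n. L * x n ^ 2) \<longlonglongrightarrow> 0" "(\<lambda>n. 4 * (M ^ 3 + 1) * (Cd * x n ^ 3)) \<longlonglongrightarrow> 0"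
    by (intro tendsto_mult_right_zero xl)+
  have ev_small: "\<forall>\<^sub>F n in sequentially. L * x n ^ 2 < \<mu> / 2"
    "\<forall>\<^sub>F n in sequentially. 4 * (M ^ 3 + 1) * (Cd * x n ^ 3) < (\<mu> / 2)\<^sup>2"
    by (rule order_tendstoD(2)[OF lim(1)], use \<mu> in simp, rule order_tendstoD(2)[OF lim(2)], use \<mu> in simp)
  (* From d = mean_A n *v v n and the bound M^2 on the form of mean_A n, norm d <= M^2 * norm (v n). *)
  define s\<^sub>0 where "s\<^sub>0 = sqrt c * (norm d / (M\<^sup>2 + 1))"
  have M1: "M\<^sup>2 + 1 > 0" by (simp add: add_nonneg_pos)
  have s0: "s\<^sub>0 > 0" using c d M1 by (simp add: s\<^sub>0_def)
  have v_low: "norm d / (M\<^sup>2 + 1) \<le> norm (v n)" and v_up: "norm (v n) \<le> b"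
    and pd: "\<And>u. \<mu> * (norm u)\<^sup>2 \<le> u \<bullet> (mean_A n *v u)" if n: "n > 0" "n \<ge> N" for n
  proof -
    show pd: "\<mu> * (norm u)\<^sup>2 \<le> u \<bullet> (mean_A n *v u)" for u
      unfolding \<mu>_def by (rule mean_A_lower[OF n(1) yy[OF n(2)]])
    note P = pos_def_invertible[OF \<mu> pd]
    have "norm (v n) \<le> norm d / \<mu>" unfolding v_def by (rule P(3))
    also have "\<dots> \<le> b" unfolding b_def using \<mu> by (intro divide_right_mono) auto
    finally show "norm (v n) \<le> b" .
    have "norm d * norm d = d \<bullet> (mean_A n *v v n)"
      unfolding v_def P(2) by (simp add: power2_norm_eq_inner flip: power2_eq_square)
    also have "\<dots> \<le> E n (\<lambda>_. M\<^sup>2 * (norm d * norm (v n)))"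
      unfolding mean_A_form by (rule E_mono) (use A_form_bound[OF _ n(1)] abs_le_D1 in blast)
    also have "\<dots> = norm d * (M\<^sup>2 * norm (v n))" by (simp add: E_const)
    finally have "norm d \<le> M\<^sup>2 * norm (v n)" using d by simp
    also have "\<dots> \<le> (M\<^sup>2 + 1) * norm (v n)" by (simp add: algebra_simps)
    finally show "norm d / (M\<^sup>2 + 1) \<le> norm (v n)" using M1 by (simp add: divide_le_eq mult.commute)
  qed
  have ev_s: "s\<^sub>0 \<le> s n" if n: "n > 0" "n \<ge> N" for n
  proof -
    have "s\<^sub>0 \<le> sqrt c * norm (v n)" unfolding s\<^sub>0_def using c v_low[OF n] by (intro mult_left_mono) auto
    also have "\<dots> = sqrt (c * (norm (v n))\<^sup>2)" by (simp add: real_sqrt_mult)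
    also have "\<dots> \<le> s n"
      unfolding s_def using UU[OF n(2), of "v n"] n by (intro real_sqrt_le_mono) (simp add: field_simps)
    finally show ?thesis .
  qed
  have v_nz: "v n \<noteq> 0" if n: "n > 0" "n \<ge> N" for n
  proof -
    have "norm d / (M\<^sup>2 + 1) > 0" using d M1 by simp
    then show ?thesis using v_low[OF n] by auto
  qed
  have main: "\<forall>\<^sub>F n in sequentially. Pr n (\<lambda>\<pi>. \<not> expansion_event n d (v n) (s n) (max (\<epsilon>\<^sub>1 n) (\<epsilon>\<^sub>2 n)) \<pi>) \<le> bad n"
    using ev_small eventually_ge_at_top[of "max 1 N"]
  proof eventually_elim
    case (elim n)
    then have n: "n > 0" "n \<ge> N" by auto
    have nr: "real n > 0" using n by simp
    note xp = x_pos[OF n(1)] and x8n = x8[OF n(1)] and x4n = x4[OF n(1)]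
    have inv_n: "1 / real n = x n ^ 8" using x8n nr by (simp add: field_simps)
    define S where "S = E n (\<lambda>\<pi>. S_form n \<pi> \<theta> (v n) (v n))"
    let ?Q1 = "\<lambda>p \<pi>. \<not> \<bar>U n (axis p 1) \<pi> - E n (U n (axis p 1))\<bar> \<le> real n ^ 2 * x n ^ 3"
    let ?Q2 = "\<lambda>p r \<pi>. \<not> \<bar>A_hat f n \<pi> \<theta> $ p $ r - E n (\<lambda>\<pi>. A_hat f n \<pi> \<theta> $ p $ r)\<bar> \<le> x n ^ 2"
    let ?Q3 = "\<lambda>\<pi>. \<not> \<bar>S_form n \<pi> \<theta> (v n) (v n) - E n (\<lambda>\<pi>. S_form n \<pi> \<theta> (v n) (v n))\<bar> \<le> x n ^ 2"
    have P1: "Pr n (?Q1 p) \<le> 16 * M\<^sup>2 * \<kappa> * x n ^ 2" for p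
    proof -
      have "Pr n (?Q1 p) \<le> real n * ((4 * h_bound (axis p 1) * real n) * (1 + K ^ 4))\<^sup>2 / (real n ^ 2 * x n ^ 3)\<^sup>2"
        by (rule chebyshev[OF U_lipschitz]) (use nr xp in simp)
      also have "\<dots> = 16 * M\<^sup>2 * \<kappa> * (1 / real n) / x n ^ 6"
        using nr xp by (simp add: h_bound_def M_def \<kappa>_def field_simps power2_eq_square power_mult_distrib eval_nat_numeral)
      also have "\<dots> = 16 * M\<^sup>2 * \<kappa> * x n ^ 2"
        unfolding inv_n using xp by (simp add: field_simps flip: power_add)
      finally show ?thesis .
    qed
    have P2: "Pr n (?Q2 p r) \<le> 16 * M ^ 4 * \<kappa> * x n ^ 4" for p r
    proof -
      have "Pr n (?Q2 p r) \<le> real n * ((4 * M\<^sup>2 / real n) * (1 + K ^ 4))\<^sup>2 / (x n ^ 2)\<^sup>2"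
        by (rule chebyshev[OF A_hat_entry_lipschitz[OF n(1)]]) (use xp in simp)
      also have "\<dots> = 16 * M ^ 4 * \<kappa> * (1 / real n) / x n ^ 4"
        using nr xp by (simp add: \<kappa>_def field_simps power_mult_distrib eval_nat_numeral)
      also have "\<dots> = 16 * M ^ 4 * \<kappa> * x n ^ 4"
        unfolding inv_n using xp by (simp add: field_simps flip: power_add)
      finally show ?thesis .
    qed
    have P3: "Pr n ?Q3 \<le> 576 * (b * M) ^ 4 * \<kappa> * x n ^ 4"
    proof -
      have "Pr n ?Q3 \<le> real n * ((24 * (norm (v n) * M)\<^sup>2 / real n) * (1 + K ^ 4))\<^sup>2 / (x n ^ 2)\<^sup>2"
        by (rule chebyshev[OF S_form_hamming[OF n(1)]]) (use xp in simp)
      also have "\<dots> = 576 * (norm (v n) * M) ^ 4 * \<kappa> * ((1 / real n) / x n ^ 4)"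
        using nr xp by (simp add: \<kappa>_def field_simps power_mult_distrib eval_nat_numeral)
      also have "\<dots> = 576 * (norm (v n) * M) ^ 4 * \<kappa> * x n ^ 4"
        unfolding inv_n using xp by (simp add: field_simps flip: power_add)
      also have "\<dots> \<le> 576 * (b * M) ^ 4 * \<kappa> * x n ^ 4"
        using xp M_nonneg v_up[OF n]
        by (intro mult_right_mono mult_left_mono power_mono) (auto simp: \<kappa>_def)
      finally show ?thesis .
    qed
    have good: "expansion_event n d (v n) (s n) (max (\<epsilon>\<^sub>1 n) (\<epsilon>\<^sub>2 n)) \<pi>"
      if \<pi>: "\<pi> \<in> perms n" and nQ: "\<not> (\<exists>p. ?Q1 p \<pi>)" "\<not> (\<exists>p. \<exists>r. ?Q2 p r \<pi>)" "\<not> ?Q3 \<pi>" for \<pi>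
    proof -
      have R: "norm (mean_score n \<pi> \<theta>) \<le> Cd * x n ^ 3"
        unfolding Cd_def by (rule mean_score_norm_le[OF n(1)]) (use nQ(1) E_U in auto)
      have \<eta>: "\<bar>A_hat f n \<pi> \<theta> $ p $ r - mean_A n $ p $ r\<bar> \<le> x n ^ 2" for p r
        using nQ(2) by (simp add: mean_A_def)
      have S: "\<bar>S_form n \<pi> \<theta> (v n) (v n) - S\<bar> \<le> x n ^ 2" using nQ(3) by (simp add: S_def)
      note X = estimator_expansion[OF \<pi> n(1) \<mu> pd[OF n] R \<eta>, of d, folded v_def L_def b_def, OF S]
      have sm: "L * (x n)\<^sup>2 \<le> \<mu> / 2" using elim(1) by simp
      note X = X[OF sm elim(2)]
      have D: "4 * (Cd * x n ^ 3) / \<mu> = c1 * x n ^ 3" by (simp add: c1_def)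
      let ?\<tau> = "pl_estimator f n \<pi>"
      have e1: "\<bar>sqrt (real n) * (d \<bullet> ?\<tau> - d \<bullet> \<theta>) - s n * (U n (v n) \<pi> / sqrt (E n (\<lambda>\<pi>. (U n (v n) \<pi>)\<^sup>2)))\<bar> \<le> \<epsilon>\<^sub>1 n"
      proof -
        let ?S2 = "E n (\<lambda>\<pi>. (U n (v n) \<pi>)\<^sup>2)"
        have "c * real n ^ 3 * (norm (v n))\<^sup>2 > 0" using c nr v_nz[OF n] by simp
        then have S2: "?S2 > 0" using UU[OF n(2), of "v n"] by linarith
        have n3: "sqrt (real n ^ 3) = real n * sqrt (real n)"
          by (simp add: power3_eq_cube real_sqrt_mult)
        have sW: "s n * (U n (v n) \<pi> / sqrt ?S2) = sqrt (real n) * (v n \<bullet> mean_score n \<pi> \<theta>)"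
        proof -
          have "s n * (U n (v n) \<pi> / sqrt ?S2) = U n (v n) \<pi> / (real n * sqrt (real n))"
            unfolding s_def real_sqrt_divide n3 using S2 by simp
          also have "\<dots> = sqrt (real n) * (U n (v n) \<pi> / real n ^ 2)"
          proof -
            have "sqrt (real n) * sqrt (real n) = real n" by simp
            then show ?thesis using nr by (simp add: field_simps power2_eq_square)
          qed
          also have "U n (v n) \<pi> / real n ^ 2 = v n \<bullet> mean_score n \<pi> \<theta>"
            by (simp add: mean_score_def inner_score)
          finally show ?thesis .
        qed
        have "\<bar>sqrt (real n) * (d \<bullet> ?\<tau> - d \<bullet> \<theta>) - s n * (U n (v n) \<pi> / sqrt ?S2)\<bar>
          = sqrt (real n) * \<bar>d \<bullet> ?\<tau> - d \<bullet> \<theta> - v n \<bullet> mean_score n \<pi> \<theta>\<bar>"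
          unfolding sW by (simp add: abs_mult flip: right_diff_distrib)
        also have "\<dots> \<le> sqrt (real n) * (b * (M ^ 3 * (c1 * x n ^ 3)\<^sup>2 + L * x n ^ 2 * (c1 * x n ^ 3)))"
          using X(3) unfolding D by (intro mult_left_mono) auto
        also have "\<dots> = (sqrt (real n) * x n ^ 4) * \<epsilon>\<^sub>1 n"
          by (simp add: \<epsilon>\<^sub>1_def algebra_simps eval_nat_numeral)
        finally show ?thesis unfolding x4n by simp
      qed
      have e2: "\<bar>V_hat n d \<pi> - (s n)\<^sup>2\<bar> \<le> \<epsilon>\<^sub>2 n"
      proof -
        have s2: "(s n)\<^sup>2 = E n (\<lambda>\<pi>. (U n (v n) \<pi>)\<^sup>2) / real n ^ 3"
          unfolding s_def by (rule real_sqrt_pow2) (simp add: E_sq_nonneg)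
        have "\<bar>S - (s n)\<^sup>2\<bar> \<le> (norm (v n) * M)\<^sup>2 / real n" unfolding s2 S_def by (rule E_S_form[OF n(1)])
        also have "\<dots> \<le> (b * M)\<^sup>2 / real n"
          using M_nonneg v_up[OF n] by (intro divide_right_mono power_mono mult_right_mono) auto
        also have "\<dots> = (b * M)\<^sup>2 * x n ^ 8" by (simp flip: inv_n)
        finally have "\<bar>S - (s n)\<^sup>2\<bar> \<le> (b * M)\<^sup>2 * x n ^ 8" .
        then show ?thesis using X(4) unfolding D V_hat_def \<epsilon>\<^sub>2_def by linarith
      qed
      show ?thesis unfolding expansion_event_def
        using X(1,2) max.coboundedI1[OF e1] max.coboundedI2[OF e2] by blast
    qed
    define G where "G = expansion_event n d (v n) (s n) (max (\<epsilon>\<^sub>1 n) (\<epsilon>\<^sub>2 n))"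
    define B1 where "B1 \<pi> \<longleftrightarrow> (\<exists>p. ?Q1 p \<pi>)" for \<pi>
    define B2 where "B2 \<pi> \<longleftrightarrow> (\<exists>p. \<exists>r. ?Q2 p r \<pi>)" for \<pi>
    define B3 where "B3 \<pi> \<longleftrightarrow> ?Q3 \<pi>" for \<pi>
    have G: "G \<pi>" if "\<pi> \<in> perms n" "\<not> B1 \<pi>" "\<not> B2 \<pi>" "\<not> B3 \<pi>" for \<pi>
      unfolding G_def by (rule good) (fact that[unfolded B1_def B2_def B3_def])+
    have "Pr n (\<lambda>\<pi>. \<not> G \<pi>) \<le> Pr n B1 + Pr n (\<lambda>\<pi>. B2 \<pi> \<or> B3 \<pi>)"
      by (rule Pr_le_add) (use G in blast)
    also have "Pr n (\<lambda>\<pi>. B2 \<pi> \<or> B3 \<pi>) \<le> Pr n B2 + Pr n B3" by (rule Pr_le_add) blast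
    finally have "Pr n (\<lambda>\<pi>. \<not> expansion_event n d (v n) (s n) (max (\<epsilon>\<^sub>1 n) (\<epsilon>\<^sub>2 n)) \<pi>)
      \<le> Pr n (\<lambda>\<pi>. \<exists>p. ?Q1 p \<pi>) + (Pr n (\<lambda>\<pi>. \<exists>p. \<exists>r. ?Q2 p r \<pi>) + Pr n ?Q3)"
      unfolding G_def B1_def B2_def B3_def by simp
    also have "Pr n (\<lambda>\<pi>. \<exists>p. ?Q1 p \<pi>) \<le> Cd * (16 * M\<^sup>2 * \<kappa> * x n ^ 2)"
    proof -
      have "Pr n (\<lambda>\<pi>. \<exists>p. ?Q1 p \<pi>) \<le> (\<Sum>p\<in>UNIV. Pr n (?Q1 p))" by (rule Pr_ex_le)
      also have "\<dots> \<le> (\<Sum>p\<in>(UNIV :: 'l set). 16 * M\<^sup>2 * \<kappa> * x n ^ 2)" by (intro sum_mono P1)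
      finally show ?thesis by (simp add: Cd_def)
    qed
    also have "Pr n (\<lambda>\<pi>. \<exists>p. \<exists>r. ?Q2 p r \<pi>) \<le> L * (16 * M ^ 4 * \<kappa> * x n ^ 4)"
    proof -
      have "Pr n (\<lambda>\<pi>. \<exists>p. \<exists>r. ?Q2 p r \<pi>) \<le> (\<Sum>p\<in>UNIV. Pr n (\<lambda>\<pi>. \<exists>r. ?Q2 p r \<pi>))" by (rule Pr_ex_le)
      also have "\<dots> \<le> (\<Sum>p\<in>UNIV. \<Sum>r\<in>UNIV. Pr n (?Q2 p r))" by (intro sum_mono Pr_ex_le)
      also have "\<dots> \<le> (\<Sum>p\<in>(UNIV :: 'l set). \<Sum>r\<in>(UNIV :: 'l set). 16 * M ^ 4 * \<kappa> * x n ^ 4)"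
        by (intro sum_mono P2)
      finally show ?thesis by (simp add: L_def power2_eq_square)
    qed
    also note P3
    finally show ?case by (simp add: bad_def)
  qed
  show ?thesis
  proof (rule that[OF _ eps bad s0 _ main])
    show "\<forall>\<^sub>F n in sequentially. v n \<noteq> 0"
      using eventually_ge_at_top[of "max 1 N"] by eventually_elim (use v_nz in auto)
    show "\<forall>\<^sub>F n in sequentially. s\<^sub>0 \<le> s n"
      using eventually_ge_at_top[of "max 1 N"] by eventually_elim (use ev_s in auto)
  qed
qed

definition coverage :: "nat \<Rightarrow> real ^ 'l \<Rightarrow> real \<Rightarrow> (nat \<Rightarrow> nat) \<Rightarrow> bool" where
  "coverage n d z \<pi> \<longleftrightarrow> (\<exists>!\<tau>. pl_root f n \<pi> \<tau>) \<and> invertible (A_hat f n \<pi> (pl_estimator f n \<pi>)) \<and> 0 \<le> V_hat n d \<pi> \<and>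
     \<bar>d \<bullet> pl_estimator f n \<pi> - d \<bullet> \<theta>\<bar> \<le> z / sqrt (real n) * sqrt (V_hat n d \<pi>)"

lemma abs_sqrt_diff_le:
  assumes "0 < s" "\<bar>V - s\<^sup>2\<bar> \<le> \<epsilon>" "0 \<le> V"
  shows "\<bar>sqrt V - s\<bar> \<le> \<epsilon> / s"
proof -
  have "\<bar>sqrt V - s\<bar> * s \<le> \<bar>sqrt V - s\<bar> * (sqrt V + s)" using assms by (intro mult_left_mono) auto
  also have "\<dots> = \<bar>(sqrt V - s) * (sqrt V + s)\<bar>" using assms by (simp add: abs_mult)
  also have "(sqrt V - s) * (sqrt V + s) = V - s\<^sup>2"
    using assms(3) by (simp add: algebra_simps power2_eq_square)
  finally show ?thesis using assms by (simp add: pos_le_divide_eq)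
qed

text \<open>
If \<open>\<epsilon>\<close> is small compared with \<open>k\<close>, the interval covers the true
value when \<open>\<bar>W\<bar> \<le> z - k\<close> and only when \<open>\<bar>W\<bar> \<le> z +
k\<close>.
\<close>

lemma coverage_sandwich:
  assumes ev: "expansion_event n d v s \<epsilon> \<pi>" and n: "n > 0" and s: "0 < s\<^sub>0" "s\<^sub>0 \<le> s"
    and z: "z > 0" and \<epsilon>: "\<epsilon> < s\<^sub>0\<^sup>2" "\<epsilon> * (1 + z / s\<^sub>0) \<le> k * s\<^sub>0"
  defines "W \<equiv> U n v \<pi> / sqrt (E n (\<lambda>\<pi>. (U n v \<pi>)\<^sup>2))"
  shows "\<bar>W\<bar> \<le> z - k \<Longrightarrow> coverage n d z \<pi>" "coverage n d z \<pi> \<Longrightarrow> \<bar>W\<bar> \<le> z + k"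
proof -
  define X where "X = sqrt (real n) * (d \<bullet> pl_estimator f n \<pi> - d \<bullet> \<theta>)"
  define V where "V = V_hat n d \<pi>"
  have XW: "\<bar>X - s * W\<bar> \<le> \<epsilon>" and Vs: "\<bar>V - s\<^sup>2\<bar> \<le> \<epsilon>"
    and ex: "\<exists>!\<tau>. pl_root f n \<pi> \<tau>" "invertible (A_hat f n \<pi> (pl_estimator f n \<pi>))"
    using ev by (auto simp: expansion_event_def X_def V_def W_def)
  have e0: "\<epsilon> \<ge> 0" using XW by linarith
  have "s\<^sub>0\<^sup>2 \<le> s\<^sup>2" using s by (intro power_mono) auto
  then have V0: "V \<ge> 0" using Vs \<epsilon>(1) by linarith
  have "\<bar>sqrt V - s\<bar> \<le> \<epsilon> / s" using s by (intro abs_sqrt_diff_le[OF _ Vs V0]) auto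
  also have "\<dots> \<le> \<epsilon> / s\<^sub>0" using s e0 by (intro divide_left_mono) auto
  finally have sV: "\<bar>sqrt V - s\<bar> \<le> \<epsilon> / s\<^sub>0" .
  have zV: "\<bar>z * sqrt V - z * s\<bar> \<le> z * (\<epsilon> / s\<^sub>0)"
  proof -
    have "\<bar>z * sqrt V - z * s\<bar> = z * \<bar>sqrt V - s\<bar>"
      using z by (simp add: abs_mult flip: right_diff_distrib)
    also have "\<dots> \<le> z * (\<epsilon> / s\<^sub>0)" using z by (intro mult_left_mono sV) auto
    finally show ?thesis .
  qed
  have k0: "0 \<le> k"
  proof -
    have "0 \<le> \<epsilon> * (1 + z / s\<^sub>0)" using e0 z s by simp
    then have "0 \<le> k * s\<^sub>0" using \<epsilon>(2) by linarith
    then show ?thesis using s by (simp add: zero_le_mult_iff)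
  qed
  have "k * s\<^sub>0 \<le> k * s" using s k0 by (intro mult_left_mono) auto
  then have tot: "\<epsilon> + z * (\<epsilon> / s\<^sub>0) \<le> k * s" using \<epsilon>(2) by (simp add: algebra_simps)
  have cov: "coverage n d z \<pi> \<longleftrightarrow> \<bar>X\<bar> \<le> z * sqrt V"
  proof -
    have "\<bar>d \<bullet> pl_estimator f n \<pi> - d \<bullet> \<theta>\<bar> \<le> z / sqrt (real n) * sqrt V \<longleftrightarrow> \<bar>X\<bar> \<le> z * sqrt V"
    proof -
      have sn: "sqrt (real n) > 0" using n by simp
      have "\<bar>X\<bar> = \<bar>d \<bullet> pl_estimator f n \<pi> - d \<bullet> \<theta>\<bar> * sqrt (real n)"
        unfolding X_def abs_mult by simp
      then show ?thesis using pos_le_divide_eq[OF sn] by simp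
    qed
    then show ?thesis using ex V0 by (simp add: coverage_def V_def)
  qed
  have sW: "\<bar>s * W\<bar> = s * \<bar>W\<bar>" using s by (simp add: abs_mult)
  show "coverage n d z \<pi>" if "\<bar>W\<bar> \<le> z - k"
  proof -
    have "s * \<bar>W\<bar> \<le> s * (z - k)" using that s by (intro mult_left_mono) auto
    then have "\<bar>s * W\<bar> \<le> z * s - k * s" unfolding sW by (simp add: algebra_simps)
    then show ?thesis unfolding cov using XW zV tot by linarith
  qed
  show "\<bar>W\<bar> \<le> z + k" if "coverage n d z \<pi>"
  proof -
    have "\<bar>s * W\<bar> \<le> z * s + k * s" using that XW zV tot unfolding cov by linarith
    then have "s * \<bar>W\<bar> \<le> s * (z + k)" unfolding sW by (simp add: algebra_simps)
    then show ?thesis using s by simp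
  qed
qed

lemma Pr_add_disjoint_le:
  assumes "\<And>\<pi>. \<pi> \<in> perms n \<Longrightarrow> Q \<pi> \<Longrightarrow> Q'' \<pi>" "\<And>\<pi>. \<pi> \<in> perms n \<Longrightarrow> Q' \<pi> \<Longrightarrow> Q'' \<pi>"
    "\<And>\<pi>. \<pi> \<in> perms n \<Longrightarrow> \<not> (Q \<pi> \<and> Q' \<pi>)"
  shows "Pr n Q + Pr n Q' \<le> Pr n Q''"
  unfolding Pr_eq_E E_add[symmetric] by (rule E_mono) (use assms in auto)

text \<open>
Only the one-sided events \<open>W \<le> x\<close> are controlled by the central limit theorem. The
two-sided event \<open>\<bar>W\<bar> \<le> z + k\<close> is contained in \<open>W \<le> z +
k\<close> without \<open>W \<le> - (z + 2 * k)\<close>; the extra \<open>k\<close> keeps the two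
one-sided events apart. Continuity of the normal distribution function removes \<open>k\<close> in
the end.
\<close>

theorem coverage_tendsto:
  fixes d :: "real ^ 'l"
  assumes C: "\<forall>r. (\<lambda>x. f x $ r) \<in> class_C" and li: "ae_lin_indep f" and d: "d \<noteq> 0" and z: "z > 0"
  shows "(\<lambda>n. Pr n (coverage n d z)) \<longlonglongrightarrow> cdf std_normal_distribution z - cdf std_normal_distribution (- z)"
proof -
  let ?\<Phi> = "cdf std_normal_distribution"
  obtain v s \<epsilon> bad s\<^sub>0 where v: "\<forall>\<^sub>F n in sequentially. v n \<noteq> 0" and eps: "\<epsilon> \<longlonglongrightarrow> 0" and bad: "bad \<longlonglongrightarrow> 0"
    and s0: "s\<^sub>0 > 0" and s: "\<forall>\<^sub>F n in sequentially. s\<^sub>0 \<le> s n"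
    and whp: "\<forall>\<^sub>F n in sequentially. Pr n (\<lambda>\<pi>. \<not> expansion_event n d (v n) (s n) (\<epsilon> n) \<pi>) \<le> bad n"
    by (rule estimator_expansion_whp[OF C li d])
  define W where "W n \<pi> = U n (v n) \<pi> / sqrt (E n (\<lambda>\<pi>. (U n (v n) \<pi>)\<^sup>2))" for n \<pi>
  define F where "F n x = Pr n (\<lambda>\<pi>. W n \<pi> \<le> x)" for n x
  have F: "(\<lambda>n. F n x) \<longlonglongrightarrow> ?\<Phi> x" for x
    unfolding F_def Pr_def W_def by (rule score_clt[OF C li v])
  have bounds: "\<forall>\<^sub>F n in sequentially. F n (z - k) - F n (- (z - k)) - bad n \<le> Pr n (coverage n d z) \<and>
      Pr n (coverage n d z) \<le> F n (z + k) - F n (- (z + 2 * k)) + bad n" if k: "0 < k" "k < z" for k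
  proof -
    have "\<forall>\<^sub>F n in sequentially. \<epsilon> n < s\<^sub>0\<^sup>2"
      using s0 by (intro order_tendstoD(2)[OF eps]) auto
    moreover have "\<forall>\<^sub>F n in sequentially. \<epsilon> n * (1 + z / s\<^sub>0) < k * s\<^sub>0"
    proof (rule order_tendstoD(2))
      show "(\<lambda>n. \<epsilon> n * (1 + z / s\<^sub>0)) \<longlonglongrightarrow> 0" using tendsto_mult_left_zero[OF eps] .
    qed (use k s0 in simp)
    ultimately show ?thesis
      using s whp eventually_gt_at_top[of 0]
    proof eventually_elim
      case (elim n)
      let ?G = "expansion_event n d (v n) (s n) (\<epsilon> n)"
      note sand = coverage_sandwich[where z = z and k = k and d = d and v = "v n", OF _ elim(5) s0 elim(3) z elim(1) less_imp_le[OF elim(2)], folded W_def]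
      have "F n (z - k) \<le> Pr n (\<lambda>\<pi>. W n \<pi> \<le> - (z - k)) + Pr n (\<lambda>\<pi>. \<bar>W n \<pi>\<bar> \<le> z - k)"
        unfolding F_def by (rule Pr_le_add) auto
      also have "Pr n (\<lambda>\<pi>. \<bar>W n \<pi>\<bar> \<le> z - k) \<le> Pr n (coverage n d z) + Pr n (\<lambda>\<pi>. \<not> ?G \<pi>)"
      proof (rule Pr_le_add)
        fix \<pi> assume "\<bar>W n \<pi>\<bar> \<le> z - k"
        then show "coverage n d z \<pi> \<or> \<not> ?G \<pi>" using sand(1)[of \<pi>] by blast
      qed
      finally have 1: "F n (z - k) - F n (- (z - k)) - bad n \<le> Pr n (coverage n d z)"
        using elim(4) by (simp add: F_def)
      have "Pr n (coverage n d z) \<le> Pr n (\<lambda>\<pi>. \<bar>W n \<pi>\<bar> \<le> z + k) + Pr n (\<lambda>\<pi>. \<not> ?G \<pi>)"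
        by (rule Pr_le_add) (use sand(2) in blast)
      moreover have "Pr n (\<lambda>\<pi>. \<bar>W n \<pi>\<bar> \<le> z + k) + Pr n (\<lambda>\<pi>. W n \<pi> \<le> - (z + 2 * k)) \<le> Pr n (\<lambda>\<pi>. W n \<pi> \<le> z + k)"
        by (rule Pr_add_disjoint_le) (use k z in auto)
      ultimately have 2: "Pr n (coverage n d z) \<le> F n (z + k) - F n (- (z + 2 * k)) + bad n"
        using elim(4) by (simp add: F_def)
      show ?case using 1 2 by blast
    qed
  qed
  have cont: "(\<lambda>k. ?\<Phi> (g k)) \<midarrow>0\<rightarrow> ?\<Phi> (g 0)" if "isCont g 0" for g :: "real \<Rightarrow> real"
    using isCont_o2[OF that isCont_cdf_std_normal] by (simp add: isCont_def)
  have lowk: "((\<lambda>k. ?\<Phi> (z - k) - ?\<Phi> (- (z - k))) \<longlongrightarrow> ?\<Phi> z - ?\<Phi> (- z)) (at_right 0)"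
    using tendsto_diff[OF cont[of "\<lambda>k. z - k"] cont[of "\<lambda>k. - (z - k)"]]
    by (auto intro!: continuous_intros intro: filterlim_mono[OF _ order_refl at_le] )
  have upk: "((\<lambda>k. ?\<Phi> (z + k) - ?\<Phi> (- (z + 2 * k))) \<longlongrightarrow> ?\<Phi> z - ?\<Phi> (- z)) (at_right 0)"
    using tendsto_diff[OF cont[of "\<lambda>k. z + k"] cont[of "\<lambda>k. - (z + 2 * k)"]]
    by (auto intro!: continuous_intros intro: filterlim_mono[OF _ order_refl at_le] )
  have small: "\<forall>\<^sub>F k in at_right 0. 0 < k \<and> k < z"
    using z eventually_at_right[of 0 z] by (auto simp: eventually_at_right)
  show ?thesis
  proof (rule order_tendstoI)
    fix a assume a: "a < ?\<Phi> z - ?\<Phi> (- z)"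
    have "\<forall>\<^sub>F k in at_right 0. a < ?\<Phi> (z - k) - ?\<Phi> (- (z - k)) \<and> 0 < k \<and> k < z"
      using order_tendstoD(1)[OF lowk a] small by eventually_elim auto
    then obtain k where k: "a < ?\<Phi> (z - k) - ?\<Phi> (- (z - k))" "0 < k" "k < z"
      using eventually_happens'[OF trivial_limit_at_right_real] by blast
    have "(\<lambda>n. F n (z - k) - F n (- (z - k)) - bad n) \<longlonglongrightarrow> ?\<Phi> (z - k) - ?\<Phi> (- (z - k)) - 0"
      by (intro tendsto_diff F bad)
    then have "\<forall>\<^sub>F n in sequentially. a < F n (z - k) - F n (- (z - k)) - bad n"
      using k(1) by (intro order_tendstoD(1)) auto
    then show "\<forall>\<^sub>F n in sequentially. a < Pr n (coverage n d z)"
      using bounds[OF k(2,3)] by eventually_elim auto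
  next
    fix a assume a: "?\<Phi> z - ?\<Phi> (- z) < a"
    have "\<forall>\<^sub>F k in at_right 0. ?\<Phi> (z + k) - ?\<Phi> (- (z + 2 * k)) < a \<and> 0 < k \<and> k < z"
      using order_tendstoD(2)[OF upk a] small by eventually_elim auto
    then obtain k where k: "?\<Phi> (z + k) - ?\<Phi> (- (z + 2 * k)) < a" "0 < k" "k < z"
      using eventually_happens'[OF trivial_limit_at_right_real] by blast
    have "(\<lambda>n. F n (z + k) - F n (- (z + 2 * k)) + bad n) \<longlonglongrightarrow> ?\<Phi> (z + k) - ?\<Phi> (- (z + 2 * k)) + 0"
      by (intro tendsto_diff tendsto_add F bad)
    then have "\<forall>\<^sub>F n in sequentially. F n (z + k) - F n (- (z + 2 * k)) + bad n < a"
      using k(1) by (intro order_tendstoD(2)) auto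
    then show "\<forall>\<^sub>F n in sequentially. Pr n (coverage n d z) < a"
      using bounds[OF k(2,3)] by eventually_elim auto
  qed
qed

end

theorem lemma1p9:
  fixes f :: "real \<times> real \<Rightarrow> real ^ 'l" and \<theta>\<^sub>0 d :: "real ^ 'l" and \<alpha> :: real
  assumes "\<forall>r. (\<lambda>x. f x $ r) \<in> class_C"
    and "ae_lin_indep f"
    and "0 < \<alpha>" and "\<alpha> < 1"
    and "d \<noteq> 0"
  shows "(\<lambda>n. measure (perm_model f n \<theta>\<^sub>0)
      {\<pi> \<in> perms n.
        let \<theta>\<^sub>P\<^sub>L = pl_estimator f n \<pi>;
            A = A_hat f n \<pi> \<theta>\<^sub>P\<^sub>L;
            V = d \<bullet> ((matrix_inv A ** Sigma_hat f n \<pi> \<theta>\<^sub>P\<^sub>L ** matrix_inv A) *v d)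
        in (\<exists>!\<theta>. pl_root f n \<pi> \<theta>) \<and> invertible A \<and> 0 \<le> V \<and>
           \<bar>d \<bullet> \<theta>\<^sub>P\<^sub>L - d \<bullet> \<theta>\<^sub>0\<bar> \<le> z_normal (\<alpha> / 2) / sqrt (real n) * sqrt V})
    \<longlonglongrightarrow> 1 - \<alpha>"
proof -
  have "compact unit_square" by (intro compact_Times compact_Icc)
  then have "bounded (f ` unit_square)"
    using class_C_continuous[OF assms(1)] by (intro compact_imp_bounded compact_continuous_image)
  then obtain B where B: "\<And>p. p \<in> unit_square \<Longrightarrow> norm (f p) \<le> B" by (auto simp: bounded_iff)
  interpret perm_gibbs f \<theta>\<^sub>0 B by standard (rule B)
  have "(\<lambda>n. Pr n (coverage n d (z_normal (\<alpha> / 2)))) \<longlonglongrightarrow> 1 - \<alpha>"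
    using coverage_tendsto[OF assms(1,2,5) z_normal(1)[OF assms(3,4)]] z_normal(2)[OF assms(3,4)] by simp
  then show ?thesis by (simp only: Pr_def coverage_def V_hat_def Let_def)
qed

end
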